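(* For each prime $m\geq 5$, there are infinitely many Ramanujan-type congruences of $b_3(n)$ modulo $m$ and infinitely many Ramanujan-type congruences of $b_5(n)$ modulo $m$. That is, for each prime $m\ge 5$ and each $k\in\{3,5\}$ there are infinitely many arithmetic sequences $An+B$ such that $b_k(An+B)\equiv 0 \pmod m$ for all nonnegative integers $n$.
   Context: For a positive integer $k$, $b_k(n)$ denotes the number of $k$-regular partitions of $n$, i.e. partitions of $n$ in which no part is a multiple of $k$; $\sum_{n\ge 0} b_k(n)q^n=\prod_{n\ge 1}\frac{1-q^{kn}}{1-q^n}$, with $b_3(0)=b_5(0)=1$. A Ramanujan-type congruence of $b_k(n)$ modulo $m$ is a congruence $b_k(An+B)\equiv 0\pmod m$ valid for all nonnegative integers $n$, where $An+B$ is an arithmetic sequence ($A\ge 1$, $B\ge 0$ integers). *)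

theory Defs
  imports "HOL-Library.Multiset" "HOL-Number_Theory.Cong"
    "HOL-Computational_Algebra.Primes"
begin

definition partitions :: "nat \<Rightarrow> nat multiset set" where
  "partitions n = {p. 0 \<notin># p \<and> sum_mset p = n}"

definition regular_partitions :: "nat \<Rightarrow> nat \<Rightarrow> nat multiset set" where
  "regular_partitions k n = {p \<in> partitions n. \<forall>i\<in>#p. \<not> k dvd i}"

definition num_regular_partitions :: "nat \<Rightarrow> nat \<Rightarrow> nat" where
  "num_regular_partitions k n = card (regular_partitions k n)"

definition ramanujan_congruence :: "nat \<Rightarrow> nat \<Rightarrow> nat \<Rightarrow> nat \<Rightarrow> bool" where
  "ramanujan_congruence k m A B \<longleftrightarrow>
     A \<ge> 1 \<and> (\<forall>n. [num_regular_partitions k (A * n + B) = 0] (mod m))"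

lemma size_le_sum_mset:
  fixes p :: "nat multiset"
  assumes "0 \<notin># p"
  shows "size p \<le> sum_mset p"
  using assms
proof (induction p)
  case (add x p)
  then show ?case by (cases x) auto
qed simp

text \<open>Finiteness matters because \<^const>\<open>card\<close> is \<open>0\<close> on infinite sets.\<close>

lemma finite_partitions: "finite (partitions n)"
proof (rule finite_subset)
  show "partitions n \<subseteq> mset ` {xs. set xs \<subseteq> {..n} \<and> length xs \<le> n}"
  proof
    fix p assume p: "p \<in> partitions n"
    obtain xs where xs: "p = mset xs" by (metis ex_mset)
    have "x \<le> n" if "x \<in> set xs" for x
      using p that member_le_sum_list[of x xs]
      by (auto simp: partitions_def xs sum_mset_sum_list)
    moreover have "length xs \<le> n"
      using p size_le_sum_mset[of p] by (auto simp: partitions_def xs)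
    ultimately show "p \<in> mset ` {xs. set xs \<subseteq> {..n} \<and> length xs \<le> n}"
      using xs by auto
  qed
  show "finite (mset ` {xs. set xs \<subseteq> {..n} \<and> length xs \<le> n})"
    by (intro finite_imageI finite_lists_length_le) simp
qed

lemma finite_regular_partitions: "finite (regular_partitions k n)"
  unfolding regular_partitions_def using finite_partitions by simp

lemma num_regular_partitions_0: "num_regular_partitions k 0 = 1"
proof -
  have "regular_partitions k 0 = {{#}}"
    by (auto simp: regular_partitions_def partitions_def)
       (metis multiset_nonemptyE)
  then show ?thesis by (simp add: num_regular_partitions_def)
qed

end

theory Submission
  imports "HOL-Complex_Analysis.Complex_Analysis" Defs
begin

text \<open>
  Let \<open>k\<close> be \<open>3\<close> or \<open>5\<close>, let \<open>m \<ge> 5\<close> be prime, and put \<open>N = 12k\<close>, \<open>x = exp(2\<pi>iz/N)\<close> and \<open>t = k(k - 1)/2\<close>. The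
  series \<open>F(x) = x\<^sup>t \<Sum> b\<^sub>k(n) x\<^sup>N\<^sup>n\<close> is the expansion of the eta quotient \<open>\<eta>(kz)/\<eta>(z)\<close>. The idea is that its
  coefficients of index \<open>mn\<close> agree modulo \<open>m\<close> with those of a holomorphic modular form, and that Hecke operators
  act on the forms modulo \<open>m\<close> through a finite set.
  
  The quotient has a pole at some cusps, so it is first multiplied by \<open>P(z)\<^sup>m\<close>, where \<open>P(z) = \<eta>(z)\<eta>(kz)\<close>. The
  product \<open>G = \<eta>(z)\<^sup>m\<^sup>-\<^sup>1 \<eta>(kz)\<^sup>m\<^sup>+\<^sup>1\<close> is a form of weight \<open>m\<close>. By the Frobenius congruence
  \<open>P(x)\<^sup>m \<equiv> P(x\<^sup>m)\<close>, and since the Hecke operator \<open>T\<^sub>m\<close> reduces modulo \<open>m\<close> to \<open>\<Sum> a(n)x\<^sup>n \<mapsto> \<Sum> a(mn)x\<^sup>n\<close>,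
  it follows that \<open>T\<^sub>m G \<equiv> P(x) \<Sum> F(mn)x\<^sup>n\<close>. The quotient \<open>H = T\<^sub>m G / P\<close> is then an integral series
  congruent to \<open>\<Sum> F(mn) x\<^sup>n\<close>. It is holomorphic at every cusp: the growth estimate for \<open>T\<^sub>m G\<close> falls short of
  the order of \<open>P\<close> by less than one, and orders are integers (\<open>modform_quot_form\<close>). So \<open>H\<close> is
  a modular form of weight \<open>m - 1\<close> for \<open>\<Gamma>(N)\<close>. For \<open>m = k = 5\<close> the form
  \<open>\<eta>(z)\<^sup>4\<close> is congruent to \<open>F\<close> itself.
  
  A form of weight \<open>w\<close> for \<open>\<Gamma>(N)\<close> that vanishes to high order at infinity is zero (\<open>modform_vanishing\<close>): the product of its
  conjugates is a form for the full modular group, and there Siegel's maximum argument applies. Hence integral forms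
  are determined by a bounded number of coefficients and have only finitely many reductions modulo \<open>m\<close>
  (\<open>finite_reductions\<close>). For a prime \<open>Q \<equiv> 1\<close> modulo \<open>N\<close> the operators with index \<open>Q\<^sup>i\<close> satisfy a
  two-term recursion that can be run backwards modulo \<open>m\<close>. Its orbits on this finite set are therefore purely periodic, and
  since the recursion extends by zero one step before the identity, some operator of index \<open>Q\<^sup>i\<close> annihilates \<open>H\<close> modulo \<open>m\<close>
  (\<open>hecke_annihilation\<close>). Comparing coefficients gives \<open>F(m Q\<^sup>i n) \<equiv> 0\<close> for all \<open>n\<close> prime
  to \<open>Q\<close>. A suitable residue class of \<open>n\<close> turns this into a Ramanujan-type congruence, and its
  subprogressions are infinitely many more.
  
  What remains is the modularity of the eta products, which is derived from scratch. The inversion formula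
  of the eta function comes from that of a theta function, proved with Liouville's theorem (\<open>theta_inversion\<close>) and
  evaluated at the half-periods. From the generators of the modular group and of \<open>\<Gamma>\<^sub>0(k)\<close> it extends to explicit characters for
  \<open>\<eta>(z)\<^sup>2\<close> and for \<open>\<eta>(z)\<^sup>k\<^sup>s/\<eta>(kz)\<^sup>s\<close> with \<open>s = 24/(k\<^sup>2 - 1)\<close>.
\<close>

section \<open>Integer matrices acting on the upper half-plane\<close>

abbreviation uhp :: "complex set" where "uhp \<equiv> {z. Im z > 0}"

datatype mat2 = M2 int int int int

instantiation mat2 :: monoid_mult
begin
definition one_mat2 :: mat2 where "1 = M2 1 0 0 1"
fun times_mat2 :: "mat2 \<Rightarrow> mat2 \<Rightarrow> mat2" where
  "M2 a b c d * M2 a' b' c' d' = M2 (a*a' + b*c') (a*b' + b*d') (c*a' + d*c') (c*b' + d*d')"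
instance
proof
  fix A B C :: mat2
  show "A * B * C = A * (B * C)"
    by (cases A; cases B; cases C) (simp add: algebra_simps)
  show "1 * A = A" "A * 1 = A" by (cases A; simp add: one_mat2_def)+
qed
end

fun mdet :: "mat2 \<Rightarrow> int" where "mdet (M2 a b c d) = a*d - b*c"
fun adj :: "mat2 \<Rightarrow> mat2" where "adj (M2 a b c d) = M2 d (-b) (-c) a"
fun act :: "mat2 \<Rightarrow> complex \<Rightarrow> complex" where
  "act (M2 a b c d) z = (of_int a * z + of_int b) / (of_int c * z + of_int d)"
fun aut :: "mat2 \<Rightarrow> complex \<Rightarrow> complex" where
  "aut (M2 a b c d) z = of_int c * z + of_int d"

lemma mdet_mult [simp]: "mdet (A * B) = mdet A * mdet B"
  by (cases A; cases B) (simp add: algebra_simps)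

lemma mdet_1 [simp]: "mdet 1 = 1" by (simp add: one_mat2_def)

lemma act_1 [simp]: "act 1 z = z" and aut_1 [simp]: "aut 1 z = 1"
  by (simp_all add: one_mat2_def)

lemma mult_adj: "mdet A = 1 \<Longrightarrow> A * adj A = 1" "mdet A = 1 \<Longrightarrow> adj A * A = 1"
  by (cases A; simp add: one_mat2_def algebra_simps)+

lemma mdet_adj [simp]: "mdet (adj A) = mdet A"
  by (cases A) (simp add: algebra_simps)

lemma aut_nonzero:
  assumes "mdet A > 0" "Im z > 0"
  shows "aut A z \<noteq> 0"
proof (cases A)
  case (M2 a b c d)
  show ?thesis
  proof
    assume 0: "aut A z = 0"
    then have "Im (aut A z) = 0" "Re (aut A z) = 0" by simp_all
    with M2 assms have "c = 0" "d = 0" by auto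
    with M2 assms show False by simp
  qed
qed

lemma Im_act:
  assumes "mdet A > 0" "Im z > 0"
  shows "Im (act A z) = of_int (mdet A) * Im z / (norm (aut A z))\<^sup>2"
proof (cases A)
  case (M2 a b c d)
  have "Im (act A z) = Im ((of_int a * z + of_int b) * cnj (aut A z)) / (norm (aut A z))\<^sup>2"
    using M2 by (simp add: Im_divide cmod_power2 algebra_simps)
  also have "Im ((of_int a * z + of_int b) * cnj (aut A z)) = of_int (mdet A) * Im z"
    using M2 by (simp add: algebra_simps)
  finally show ?thesis .
qed

lemma act_uhp:
  assumes "mdet A > 0" "Im z > 0"
  shows "Im (act A z) > 0"
  using Im_act[OF assms] aut_nonzero[OF assms] assms by simp

lemma aut_mult:
  assumes "mdet B > 0" "Im z > 0"
  shows "aut (A * B) z = aut A (act B z) * aut B z"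
  using aut_nonzero[OF assms] by (cases A; cases B) (simp add: field_simps)

lemma act_mult:
  assumes "mdet A > 0" "mdet B > 0" "Im z > 0"
  shows "act (A * B) z = act A (act B z)"
proof -
  obtain a b c d where A: "A = M2 a b c d" by (cases A)
  obtain a' b' c' d' where B: "B = M2 a' b' c' d'" by (cases B)
  define u where "u = of_int a' * z + of_int b'"
  define v where "v = of_int c' * z + of_int d'"
  have v: "v \<noteq> 0" using aut_nonzero[OF assms(2,3)] B by (simp add: v_def)
  have "act (A * B) z = (of_int a * u + of_int b * v) / (of_int c * u + of_int d * v)"
    by (simp add: A B u_def v_def algebra_simps)
  also have "\<dots> = ((of_int a * (u / v) + of_int b) * v) / ((of_int c * (u / v) + of_int d) * v)"
    using v by (simp add: distrib_right)
  also have "\<dots> = act A (act B z)"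
    using v by (simp add: A B u_def v_def)
  finally show ?thesis .
qed

text \<open>
  Estimates for matrices of positive determinant reduce in this way to the modular group, since an upper
  triangular matrix only scales and translates.
\<close>

lemma hermite_decomposition:
  assumes "mdet M > 0"
  obtains \<gamma> A B D where "mdet \<gamma> = 1" "M = \<gamma> * M2 A B 0 D" "A > 0" "D > 0"
proof (cases M)
  case (M2 a b c d)
  define g where "g = gcd a c"
  have "a \<noteq> 0 \<or> c \<noteq> 0" using assms M2 by auto
  then have g: "g > 0" by (auto simp: g_def)
  obtain a' c' where ac: "a = g * a'" "c = g * c'"
    by (metis g_def dvd_def gcd_dvd1 gcd_dvd2)
  obtain x y where "x * a + y * c = g" using bezout_int[of a c] by (auto simp: g_def)
  then have "g * (x * a' + y * c') = g * 1" by (simp add: ac algebra_simps)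
  then have xy: "x * a' + y * c' = 1" using g by simp
  let ?\<gamma> = "M2 a' (-y) c' x"
  let ?D = "a' * d - c' * b" and ?B = "x * b + y * d"
  have d: "mdet ?\<gamma> = 1" using xy by (simp add: algebra_simps)
  have "a' * ?B + (-y) * ?D = (x * a' + y * c') * b"
    "c' * ?B + x * ?D = (x * a' + y * c') * d"
    by (simp_all only: distrib_left distrib_right left_diff_distrib right_diff_distrib) (simp_all add: algebra_simps)
  then have M: "M = ?\<gamma> * M2 g ?B 0 ?D"
    unfolding xy M2 ac by (simp add: algebra_simps)
  have "mdet M = mdet ?\<gamma> * mdet (M2 g ?B 0 ?D)" unfolding M mdet_mult ..
  then have "mdet M = g * ?D" using d by simp
  then have "?D > 0" using assms g by (simp add: zero_less_mult_iff)
  with d M g show ?thesis using that by blast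
qed

definition TT :: "int \<Rightarrow> mat2" where "TT n = M2 1 n 0 1"
definition VV :: "int \<Rightarrow> mat2" where "VV n = M2 1 0 n 1"
definition NEG :: mat2 where "NEG = M2 (-1) 0 0 (-1)"

text \<open>
  This element of order four fixes \<open>(2 + \<i>)/5\<close>, an elliptic point of \<open>\<Gamma>\<^sub>0(5)\<close>.
\<close>

definition EL :: mat2 where "EL = M2 2 (-1) 5 (-2)"

lemma TT_add: "TT m * TT n = TT (m + n)" and VV_add: "VV m * VV n = VV (m + n)"
  and TT_0: "TT 0 = 1" and VV_0: "VV 0 = 1"
  by (simp_all add: TT_def VV_def one_mat2_def)

fun lowleft :: "mat2 \<Rightarrow> int" where "lowleft (M2 a b c d) = c"

text \<open>
  A Euclidean descent on the bottom row \<open>(c, d)\<close>: right multiplication by a power of \<open>T\<close> moves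
  \<open>d\<close> into \<open>[-|c|/2, |c|/2]\<close>, and then \<open>V\<close> makes \<open>|c|\<close> smaller as long as \<open>|d| < 2|c|/k\<close>, which is
  automatic for \<open>k \<le> 3\<close>. For \<open>k = 5\<close> the remaining window \<open>2 \<le> |5d/c| \<le> 5/2\<close> is where the elliptic
  element of order four takes over.
\<close>

lemma Gamma0_induct [consumes 3, case_names one T Ti V Vi neg ell]:
  fixes k :: int
  assumes k: "k = 1 \<or> k = 3 \<or> k = 5"
    and det: "mdet \<gamma> = 1" and low: "k dvd lowleft \<gamma>"
    and one: "P 1"
    and T: "\<And>\<gamma>. mdet \<gamma> = 1 \<Longrightarrow> k dvd lowleft \<gamma> \<Longrightarrow> P \<gamma> \<Longrightarrow> P (\<gamma> * TT 1)"
    and Ti: "\<And>\<gamma>. mdet \<gamma> = 1 \<Longrightarrow> k dvd lowleft \<gamma> \<Longrightarrow> P \<gamma> \<Longrightarrow> P (\<gamma> * TT (-1))"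
    and V: "\<And>\<gamma>. mdet \<gamma> = 1 \<Longrightarrow> k dvd lowleft \<gamma> \<Longrightarrow> P \<gamma> \<Longrightarrow> P (\<gamma> * VV k)"
    and Vi: "\<And>\<gamma>. mdet \<gamma> = 1 \<Longrightarrow> k dvd lowleft \<gamma> \<Longrightarrow> P \<gamma> \<Longrightarrow> P (\<gamma> * VV (-k))"
    and N: "\<And>\<gamma>. mdet \<gamma> = 1 \<Longrightarrow> k dvd lowleft \<gamma> \<Longrightarrow> P \<gamma> \<Longrightarrow> P (\<gamma> * NEG)"
    and E: "\<And>\<gamma>. k = 5 \<Longrightarrow> mdet \<gamma> = 1 \<Longrightarrow> k dvd lowleft \<gamma> \<Longrightarrow> P \<gamma> \<Longrightarrow> P (\<gamma> * EL)"
  shows "P \<gamma>"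
proof -
  define Q where "Q \<gamma> \<longleftrightarrow> mdet \<gamma> = 1 \<and> k dvd lowleft \<gamma> \<and> P \<gamma>" for \<gamma>
  have k0: "k > 0" using k by auto
  have low_T: "k dvd lowleft (\<gamma> * TT n) \<longleftrightarrow> k dvd lowleft \<gamma>" for \<gamma> n
    by (cases \<gamma>) (simp add: TT_def)
  have low_V: "k dvd lowleft (\<gamma> * VV k) \<longleftrightarrow> k dvd lowleft \<gamma>"
    "k dvd lowleft (\<gamma> * VV (-k)) \<longleftrightarrow> k dvd lowleft \<gamma>" for \<gamma>
  proof -
    obtain a b c d where g: "\<gamma> = M2 a b c d" by (cases \<gamma>)
    show "k dvd lowleft (\<gamma> * VV k) \<longleftrightarrow> k dvd lowleft \<gamma>"
      using dvd_add_times_triv_right_iff[of k c d] by (simp add: g VV_def)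
    show "k dvd lowleft (\<gamma> * VV (-k)) \<longleftrightarrow> k dvd lowleft \<gamma>"
      using dvd_add_times_triv_right_iff[of k c "-d"] by (simp add: g VV_def)
  qed
  have low_N: "k dvd lowleft (\<gamma> * NEG) \<longleftrightarrow> k dvd lowleft \<gamma>" for \<gamma>
    by (cases \<gamma>) (simp add: NEG_def)
  have low_E: "k dvd lowleft (\<gamma> * EL) \<longleftrightarrow> k dvd lowleft \<gamma>" if "k = 5" for \<gamma>
    using that by (cases \<gamma>) (simp add: EL_def, presburger)
  have dets: "mdet (TT n) = 1" "mdet (VV n) = 1" "mdet NEG = 1" "mdet EL = 1" for n
    by (simp_all add: TT_def VV_def NEG_def EL_def)
  have QT1: "Q (\<gamma> * TT 1)" "Q (\<gamma> * TT (-1))" if "Q \<gamma>" for \<gamma>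
    using that T Ti low_T dets by (auto simp: Q_def)
  have QTn: "Q (\<gamma> * TT (int n)) \<and> Q (\<gamma> * TT (- int n))" if "Q \<gamma>" for \<gamma> n
  proof (induction n)
    case 0 then show ?case using that by (simp add: TT_0)
  next
    case (Suc n)
    have "\<gamma> * TT (int (Suc n)) = \<gamma> * TT (int n) * TT 1"
      "\<gamma> * TT (- int (Suc n)) = \<gamma> * TT (- int n) * TT (-1)"
      by (simp_all add: mult.assoc TT_add algebra_simps)
    then show ?case using Suc QT1 by metis
  qed
  have QT: "Q (\<gamma> * TT n)" if "Q \<gamma>" for \<gamma> n
    using QTn[OF that, of "nat \<bar>n\<bar>"] by (cases "n \<ge> 0") auto
  have QV: "Q (\<gamma> * VV k)" "Q (\<gamma> * VV (-k))" if "Q \<gamma>" for \<gamma>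
    using that V Vi low_V dets by (auto simp: Q_def)
  have QN: "Q (\<gamma> * NEG)" if "Q \<gamma>" for \<gamma>
    using that N low_N dets by (auto simp: Q_def)
  have QE: "Q (\<gamma> * EL)" if "Q \<gamma>" "k = 5" for \<gamma>
    using that E low_E dets by (auto simp: Q_def)
  have QTr: "Q \<gamma>" if "Q (\<gamma> * TT n)" for \<gamma> n
    using QT[OF that, of "-n"] by (simp add: mult.assoc TT_add TT_0)
  have QVr: "Q \<gamma>" if "Q (\<gamma> * VV k) \<or> Q (\<gamma> * VV (-k))" for \<gamma>
    using that QV(2)[of "\<gamma> * VV k"] QV(1)[of "\<gamma> * VV (-k)"]
    by (auto simp: mult.assoc VV_add VV_0)
  have EE: "EL * EL * NEG = 1" by (simp add: EL_def NEG_def one_mat2_def)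
  have QEr: "Q \<gamma>" if "Q (\<gamma> * EL)" "k = 5" for \<gamma>
    using QN[OF QE[OF that(1,2)]] EE by (metis mult.assoc mult.right_neutral)
  have main: "Q \<gamma>" if "mdet \<gamma> = 1" "k dvd lowleft \<gamma>" for \<gamma>
    using that
  proof (induction "nat \<bar>lowleft \<gamma>\<bar>" arbitrary: \<gamma> rule: less_induct)
    case less
    have IH: "Q \<delta>" if "\<bar>lowleft \<delta>\<bar> < \<bar>lowleft \<gamma>\<bar>" "mdet \<delta> = 1" "k dvd lowleft \<delta>" for \<delta>
      using less(1)[of \<delta>] that by auto
    obtain a b c d where g: "\<gamma> = M2 a b c d" by (cases \<gamma>)
    show ?case
    proof (cases "c = 0")
      case True
      then have ad: "a * d = 1" using less g by simp
      have Q1: "Q 1" using one by (simp add: Q_def one_mat2_def)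
      from ad have "(a = 1 \<and> d = 1) \<or> (a = -1 \<and> d = -1)" using zmult_eq_1_iff by blast
      then show ?thesis
      proof
        assume "a = 1 \<and> d = 1"
        then have "\<gamma> = 1 * TT b" using True g by (simp add: TT_def)
        then show ?thesis using QT[OF Q1, of b] by metis
      next
        assume "a = -1 \<and> d = -1"
        then have "\<gamma> = 1 * NEG * TT (-b)" using True g by (simp add: TT_def NEG_def)
        then show ?thesis using QT[OF QN[OF Q1], of "-b"] by metis
      qed
    next
      case False
      obtain c' where c': "c = k * c'" using less(3) g by (auto simp: dvd_def)
      have "c' \<noteq> 0" using False c' by auto
      obtain n where n: "2 * \<bar>d + c * n\<bar> \<le> \<bar>c\<bar>"
      proof -
        define r where "r = d mod \<bar>c\<bar>"
        have r: "0 \<le> r" "r < \<bar>c\<bar>" using False by (auto simp: r_def)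
        have "d = \<bar>c\<bar> * (d div \<bar>c\<bar>) + r" by (simp add: r_def)
        then have e: "d = c * (sgn c * (d div \<bar>c\<bar>)) + r"
          by (simp add: mult.assoc[symmetric] abs_sgn)
        show ?thesis
        proof (cases "2 * r \<le> \<bar>c\<bar>")
          case True
          have "d + c * (- (sgn c * (d div \<bar>c\<bar>))) = r" using e by (simp add: algebra_simps)
          then show ?thesis using that[of "- (sgn c * (d div \<bar>c\<bar>))"] True r by simp
        next
          case False
          have "d + c * (- (sgn c * (d div \<bar>c\<bar>)) - sgn c) = r - \<bar>c\<bar>"
            using e by (simp add: algebra_simps abs_sgn)
          then show ?thesis
            using that[of "- (sgn c * (d div \<bar>c\<bar>)) - sgn c"] False r by simp
        qed
      qed
      define e where "e = d + c * n"
      define b' where "b' = a * n + b"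
      have g1: "\<gamma> * TT n = M2 a b' c e"
        by (simp add: g TT_def b'_def e_def algebra_simps)
      have d1: "a * e - b' * c = 1"
        using less(2) g by (simp add: e_def b'_def algebra_simps)
      have ne: "2 * \<bar>e\<bar> \<le> k * \<bar>c'\<bar>" using n k0 by (simp add: e_def c' abs_mult)
      have "Q (\<gamma> * TT n)"
      proof (cases "e = 0")
        case True
        then have cc: "b' * c = -1" using d1 by simp
        then have "c = 1 \<or> c = -1" by (metis dvd_triv_right zdvd1_eq dvd_minus_iff abs_eq_iff abs_1)
        then have k1: "k = 1" using c' k0 by (metis dvd_triv_left zdvd1_eq dvd_minus_iff abs_of_pos)
        \<comment> \<open>The lower left entry becomes \<open>0\<close>.\<close>
        have "Q (\<gamma> * TT n * TT 1 * VV (-k))"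
          by (rule IH) (use g1 True less(2,3) k1 d1 \<open>c = 1 \<or> c = -1\<close> in
              \<open>auto simp: TT_def VV_def g algebra_simps\<close>)
        then show ?thesis using QTr QVr by blast
      next
        case e0: False
        show ?thesis
        proof (cases "\<bar>e\<bar> < 2 * \<bar>c'\<bar>")
          case True
          then have "\<bar>c' + e\<bar> < \<bar>c'\<bar> \<or> \<bar>c' - e\<bar> < \<bar>c'\<bar>" using e0 by linarith
          then have "\<bar>c + k * e\<bar> < \<bar>c\<bar> \<or> \<bar>c - k * e\<bar> < \<bar>c\<bar>"
            using k0 by (simp add: c' abs_mult flip: right_diff_distrib distrib_left)
          then have "Q (\<gamma> * TT n * VV k) \<or> Q (\<gamma> * TT n * VV (-k))"
          proof
            assume *: "\<bar>c + k * e\<bar> < \<bar>c\<bar>"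
            have "Q (\<gamma> * TT n * VV k)"
              by (rule IH) (use g1 g * d1 c' in \<open>auto simp: VV_def algebra_simps\<close>)
            then show ?thesis ..
          next
            assume *: "\<bar>c - k * e\<bar> < \<bar>c\<bar>"
            have "Q (\<gamma> * TT n * VV (-k))"
              by (rule IH) (use g1 g * d1 c' in \<open>auto simp: VV_def algebra_simps\<close>)
            then show ?thesis ..
          qed
          then show ?thesis using QVr by blast
        next
          case big: False
          then have k5: "k = 5" using k ne \<open>c' \<noteq> 0\<close> by auto
          show ?thesis
          proof (cases "\<bar>2 * c' + e\<bar> < \<bar>c'\<bar>")
            case True
            have "Q (\<gamma> * TT n * EL)"
              by (rule IH) (use g1 g True d1 c' k5 in \<open>auto simp: EL_def algebra_simps\<close>)
            then show ?thesis using QEr k5 by blast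
          next
            case False
            then have "\<bar>2 * c' - e\<bar> < \<bar>c'\<bar>" using big ne[unfolded k5] \<open>c' \<noteq> 0\<close> by linarith
            \<comment> \<open>This word has lower left entry \<open>2c - 5e\<close>, the mirror image of \<open>2c + 5e\<close> in the previous case.\<close>
            then have "Q (\<gamma> * TT n * TT (-1) * EL * VV k)"
              by (intro IH) (use g1 g d1 c' k5 in
                  \<open>auto simp: EL_def TT_def VV_def algebra_simps\<close>)
            then show ?thesis using QEr QVr QTr k5 by blast
          qed
        qed
      qed
      then show ?thesis by (rule QTr)
    qed
  qed
  then show ?thesis using det low by (auto simp: Q_def)
qed

section \<open>The Euler product and the theta function\<close>

definition ee :: "complex \<Rightarrow> complex" where "ee z = exp (2 * of_real pi * \<i> * z)"

lemma ee_add: "ee (a + b) = ee a * ee b"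
  by (simp add: ee_def exp_add[symmetric] algebra_simps)
lemma ee_0 [simp]: "ee 0 = 1" by (simp add: ee_def)
lemma ee_minus: "ee (-a) = inverse (ee a)"
  by (simp add: ee_def exp_minus)
lemma ee_diff: "ee (a - b) = ee a / ee b"
  using ee_add[of a "-b"] by (simp add: ee_minus field_simps)
lemma ee_nonzero [simp]: "ee a \<noteq> 0" by (simp add: ee_def)
lemma ee_int: "n \<in> \<int> \<Longrightarrow> ee n = 1"
  by (auto simp: ee_def exp_eq_1 elim!: Ints_cases)
lemma ee_power: "ee a ^ n = ee (of_nat n * a)"
  by (simp add: ee_def exp_of_nat_mult[symmetric] algebra_simps)
lemma norm_ee: "norm (ee z) = exp (- 2 * pi * Im z)"
  by (simp add: ee_def)
lemma norm_ee_less_1: "Im z > 0 \<Longrightarrow> norm (ee z) < 1"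
  by (simp add: norm_ee)
lemma ee_holomorphic [holomorphic_intros]:
  "f holomorphic_on A \<Longrightarrow> (\<lambda>z. ee (f z)) holomorphic_on A"
  unfolding ee_def by (intro holomorphic_intros)
lemma ee_eq_1_iff: "ee z = 1 \<longleftrightarrow> z \<in> \<int>"
proof
  assume "ee z = 1"
  then obtain n :: int where "Re z = of_int n" "Im z = 0"
    unfolding ee_def exp_eq_1 by auto
  then have "z = of_int n" by (simp add: complex_eq_iff)
  then show "z \<in> \<int>" by simp
qed (rule ee_int)
lemma ee_half: "ee (1/2) = -1" and ee_quarter: "ee (1/4) = \<i>"
  by (simp_all add: ee_def exp_eq_polar flip: cis_conv_exp)

lemma holomorphic_infinite_product:
  fixes g :: "nat \<Rightarrow> complex \<Rightarrow> complex"
  assumes A: "open A" and hol: "\<And>n. g n holomorphic_on A"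
    and bnd: "\<And>x. x \<in> A \<Longrightarrow> \<exists>d M. d > 0 \<and> cball x d \<subseteq> A \<and> summable M \<and>
                (\<forall>n. \<forall>y\<in>cball x d. norm (g n y) \<le> M n)"
  shows "(\<lambda>x. \<Prod>n. 1 + g n x) holomorphic_on A"
    and "\<And>x. x \<in> A \<Longrightarrow> convergent_prod (\<lambda>n. 1 + g n x)"
proof -
  show conv: "convergent_prod (\<lambda>n. 1 + g n x)" if x: "x \<in> A" for x
  proof -
    obtain d M where d: "d > 0" and M: "summable M"
      and *: "\<forall>n. \<forall>y\<in>cball x d. norm (g n y) \<le> M n"
      using bnd[OF x] by blast
    have "x \<in> cball x d" using d by simp
    with * have "norm (g n x) \<le> M n" for n by blast
    then have "summable (\<lambda>n. norm (g n x))"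
      by (intro summable_comparison_test'[OF M, of 0]) simp
    then show ?thesis
      by (intro abs_convergent_prod_imp_convergent_prod summable_imp_abs_convergent_prod) simp
  qed
  show "(\<lambda>x. \<Prod>n. 1 + g n x) holomorphic_on A"
  proof (rule holomorphic_uniform_sequence[OF A, where f = "\<lambda>N x. \<Prod>n<N. 1 + g n x"])
    show "(\<lambda>x. \<Prod>n<N. 1 + g n x) holomorphic_on A" for N
      by (intro holomorphic_on_prod holomorphic_on_add holomorphic_on_const hol)
    fix x assume "x \<in> A"
    then obtain d M where d: "d > 0" "cball x d \<subseteq> A" "summable M"
      "\<And>n y. y \<in> cball x d \<Longrightarrow> norm (g n y) \<le> M n"
      using bnd[OF \<open>x \<in> A\<close>] by blast
    have "uniformly_convergent_on (cball x d) (\<lambda>N x. \<Sum>n<N. norm (g n x))"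
      by (rule Weierstrass_m_test'[of _ _ M]) (use d in auto)
    moreover have "continuous_on (cball x d) (g n)" for n
      by (rule holomorphic_on_imp_continuous_on[OF holomorphic_on_subset[OF hol d(2)]])
    ultimately have "uniformly_convergent_on (cball x d) (\<lambda>N x. \<Prod>n<N. 1 + g n x)"
      by (intro uniformly_convergent_on_prod compact_cball)
    then obtain l where l: "uniform_limit (cball x d) (\<lambda>N x. \<Prod>n<N. 1 + g n x) l sequentially"
      by (auto simp: uniformly_convergent_on_def)
    have "l y = (\<Prod>n. 1 + g n y)" if "y \<in> cball x d" for y
    proof -
      have "(\<lambda>N. \<Prod>n<N. 1 + g n y) \<longlonglongrightarrow> l y" by (rule tendsto_uniform_limitI[OF l that])
      moreover have "(\<lambda>N. \<Prod>n<N. 1 + g n y) \<longlonglongrightarrow> (\<Prod>n. 1 + g n y)"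
        using convergent_prod_LIMSEQ[OF conv, of y] d that
        by (subst LIMSEQ_lessThan_iff_atMost) auto
      ultimately show ?thesis by (rule LIMSEQ_unique)
    qed
    then have "uniform_limit (cball x d) (\<lambda>N x. \<Prod>n<N. 1 + g n x) (\<lambda>x. \<Prod>n. 1 + g n x) sequentially"
      by (intro iffD1[OF uniform_limit_cong' l]) auto
    with d show "\<exists>d>0. cball x d \<subseteq> A \<and>
        uniform_limit (cball x d) (\<lambda>N x. \<Prod>n<N. 1 + g n x) (\<lambda>x. \<Prod>n. 1 + g n x) sequentially"
      by blast
  qed
qed

text \<open>
  This is \<open>(qw; q)\<^sub>\<infinity>\<close>. Starting at the exponent \<open>1\<close> makes \<open>w = 1\<close> Euler's product and the shift \<open>w \<mapsto> qw\<close> the removal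
  of one factor.
\<close>

definition qpoch :: "complex \<Rightarrow> complex \<Rightarrow> complex" where
  "qpoch q w = (\<Prod>n. 1 - q ^ Suc n * w)"

lemma qpoch_holomorphic_and_convergent:
  assumes q: "norm q < 1"
  shows "(\<lambda>w. qpoch q w) holomorphic_on UNIV" and "convergent_prod (\<lambda>n. 1 - q ^ Suc n * w)"
proof -
  have bnd: "\<exists>d M. d > 0 \<and> cball x d \<subseteq> UNIV \<and> summable M \<and>
      (\<forall>n. \<forall>y\<in>cball x d. norm (- (q ^ Suc n * y)) \<le> M n)" for x :: complex
  proof (intro exI[of _ "1::real"] exI[of _ "\<lambda>n. norm q ^ Suc n * (norm x + 1)"] conjI allI ballI)
    show "summable (\<lambda>n. norm q ^ Suc n * (norm x + 1))"
      using q by (intro summable_mult2) (simp add: summable_geometric)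
    fix n y assume "y \<in> cball x 1"
    then have "norm y \<le> norm x + 1"
      using norm_triangle_sub[of y x] by (simp add: dist_norm norm_minus_commute)
    then show "norm (- (q ^ Suc n * y)) \<le> norm q ^ Suc n * (norm x + 1)"
      by (simp add: norm_mult norm_power mult_left_mono)
  qed auto
  have hol: "(\<lambda>w. - (q ^ Suc n * w)) holomorphic_on UNIV" for n
    by (intro holomorphic_intros)
  note * = holomorphic_infinite_product[of UNIV "\<lambda>n w. - (q ^ Suc n * w)", OF open_UNIV hol bnd]
  show "(\<lambda>w. qpoch q w) holomorphic_on UNIV"
    unfolding qpoch_def using *(1) by simp
  show "convergent_prod (\<lambda>n. 1 - q ^ Suc n * w)"
    using *(2)[of w] by simp
qed

lemma qpoch_LIMSEQ: "norm q < 1 \<Longrightarrow> (\<lambda>N. \<Prod>n<N. 1 - q ^ Suc n * w) \<longlonglongrightarrow> qpoch q w"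
  using convergent_prod_LIMSEQ[OF qpoch_holomorphic_and_convergent(2), of q w]
  unfolding qpoch_def by (subst LIMSEQ_lessThan_iff_atMost)

lemma qpoch_rec:
  assumes q: "norm q < 1"
  shows "qpoch q w = (1 - q * w) * qpoch q (q * w)"
proof -
  have "(\<lambda>N. (1 - q * w) * (\<Prod>n<N. 1 - q ^ Suc n * (q * w))) \<longlonglongrightarrow> (1 - q * w) * qpoch q (q * w)"
    by (intro tendsto_mult tendsto_const qpoch_LIMSEQ q)
  moreover have "(1 - q * w) * (\<Prod>n<N. 1 - q ^ Suc n * (q * w)) = (\<Prod>n<Suc N. 1 - q ^ Suc n * w)" for N
    unfolding prod.lessThan_Suc_shift by (simp add: mult_ac)
  ultimately have "(\<lambda>N. \<Prod>n<Suc N. 1 - q ^ Suc n * w) \<longlonglongrightarrow> (1 - q * w) * qpoch q (q * w)"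
    by simp
  moreover have "(\<lambda>N. \<Prod>n<Suc N. 1 - q ^ Suc n * w) \<longlonglongrightarrow> qpoch q w"
    using LIMSEQ_Suc[OF qpoch_LIMSEQ[OF q, of w]] by simp
  ultimately show ?thesis using LIMSEQ_unique by blast
qed

lemma qpoch_nonzero:
  assumes "norm q < 1" "\<And>n. q ^ Suc n * w \<noteq> 1"
  shows "qpoch q w \<noteq> 0"
  unfolding qpoch_def
  by (rule prodinf_nonzero) (use assms qpoch_holomorphic_and_convergent in auto)

definition euler_phi :: "complex \<Rightarrow> complex" where "euler_phi q = qpoch q 1"

lemma euler_phi_holomorphic: "euler_phi holomorphic_on ball 0 1"
proof -
  have bnd: "\<exists>d M. d > 0 \<and> cball x d \<subseteq> ball 0 1 \<and> summable M \<and>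
      (\<forall>n. \<forall>y\<in>cball x d. norm (- (y ^ Suc n)) \<le> M n)" if x: "x \<in> ball 0 1" for x :: complex
  proof -
    define r where "r = (1 + norm x) / 2"
    have r: "norm x < r" "r < 1" "r > 0" using x by (auto simp: r_def add_pos_nonneg)
    have yr: "norm y \<le> r" if "y \<in> cball x (r - norm x)" for y
      using norm_triangle_sub[of y x] that by (simp add: dist_norm norm_minus_commute)
    show ?thesis
      by (rule exI[of _ "r - norm x"], rule exI[of _ "\<lambda>n. r ^ Suc n"])
         (use r yr in \<open>auto simp: norm_mult norm_power summable_geometric
             intro!: summable_mult mult_mono power_mono dest: order.trans\<close>,
          use r yr in \<open>force dest: order.strict_trans1\<close>)
  qed
  have hol: "(\<lambda>w. - (w ^ Suc n)) holomorphic_on ball 0 (1::real)" for n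
    by (intro holomorphic_intros)
  show ?thesis
    using holomorphic_infinite_product(1)[of "ball 0 1" "\<lambda>n w. - (w ^ Suc n)", OF open_ball hol bnd]
    unfolding euler_phi_def[abs_def] qpoch_def by simp
qed

lemma euler_phi_nonzero: "norm q < 1 \<Longrightarrow> euler_phi q \<noteq> 0"
  unfolding euler_phi_def
proof (rule qpoch_nonzero)
  assume q: "norm q < 1"
  have "norm (q ^ Suc n) < 1" for n
    using q power_less_one_iff[of "norm q" "Suc n"] by (simp add: norm_power norm_mult)
  then show "q ^ Suc n * 1 \<noteq> 1" for n by (metis less_irrefl mult.right_neutral norm_one)
qed

lemma norm_square_less_1: "norm (q::complex) < 1 \<Longrightarrow> norm (q\<^sup>2) < 1"
  by (simp add: norm_power power_less_one_iff)

text \<open>Splitting the Euler product into even and odd exponents.\<close>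

lemma euler_phi_even_odd:
  assumes q: "norm q < 1" "q \<noteq> 0"
  shows "euler_phi q = qpoch (q\<^sup>2) (1 / q) * euler_phi (q\<^sup>2)"
proof -
  have "(\<lambda>N. (\<Prod>n<N. 1 - (q\<^sup>2) ^ Suc n * (1/q)) * (\<Prod>n<N. 1 - (q\<^sup>2) ^ Suc n * 1))
      \<longlonglongrightarrow> qpoch (q\<^sup>2) (1 / q) * euler_phi (q\<^sup>2)"
    unfolding euler_phi_def
    by (intro tendsto_mult qpoch_LIMSEQ norm_square_less_1 q)
  moreover have "(\<Prod>n<N. 1 - (q\<^sup>2) ^ Suc n * (1/q)) * (\<Prod>n<N. 1 - (q\<^sup>2) ^ Suc n * 1) =
      (\<Prod>n<2*N. 1 - q ^ Suc n * 1)" for N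
  proof (induction N)
    case (Suc N)
    have "(q\<^sup>2) ^ Suc N * (1/q) = q ^ Suc (2 * N)" "(q\<^sup>2) ^ Suc N = q ^ Suc (Suc (2 * N))"
      using q by (simp_all add: power_mult[symmetric] field_simps power2_eq_square power_mult power_mult_distrib)
    then show ?case using Suc[symmetric] by (simp add: algebra_simps)
  qed simp
  ultimately have 1: "(\<lambda>N. \<Prod>n<2*N. 1 - q ^ Suc n * 1) \<longlonglongrightarrow> qpoch (q\<^sup>2) (1 / q) * euler_phi (q\<^sup>2)"
    by simp
  have "strict_mono (\<lambda>N::nat. 2 * N)" by (simp add: strict_mono_def)
  from LIMSEQ_subseq_LIMSEQ[OF qpoch_LIMSEQ[OF q(1), of 1] this]
  have "(\<lambda>N. \<Prod>n<2*N. 1 - q ^ Suc n * 1) \<longlonglongrightarrow> euler_phi q"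
    by (simp add: euler_phi_def o_def)
  with 1 show ?thesis using LIMSEQ_unique by blast
qed

lemma qpoch_plus_minus:
  assumes q: "norm q < 1"
  shows "qpoch q w * qpoch q (-w) = qpoch (q\<^sup>2) (w\<^sup>2)"
proof -
  have "(\<lambda>N. (\<Prod>n<N. 1 - q ^ Suc n * w) * (\<Prod>n<N. 1 - q ^ Suc n * (-w)))
      \<longlonglongrightarrow> qpoch q w * qpoch q (-w)"
    by (intro tendsto_mult qpoch_LIMSEQ q)
  moreover have "(\<Prod>n<N. 1 - q ^ Suc n * w) * (\<Prod>n<N. 1 - q ^ Suc n * (-w)) =
      (\<Prod>n<N. 1 - (q\<^sup>2) ^ Suc n * w\<^sup>2)" for N
    unfolding prod.distrib[symmetric]
    by (intro prod.cong refl) (simp add: algebra_simps power2_eq_square power_mult_distrib)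
  ultimately have "(\<lambda>N. \<Prod>n<N. 1 - (q\<^sup>2) ^ Suc n * w\<^sup>2) \<longlonglongrightarrow> qpoch q w * qpoch q (-w)"
    by simp
  then show ?thesis
    using qpoch_LIMSEQ[OF norm_square_less_1[OF q], of "w\<^sup>2"] LIMSEQ_unique by blast
qed

text \<open>
  Euler's identity \<open>\<Prod>(1 + q\<^sup>n)(1 - q\<^sup>2\<^sup>n\<^sup>-\<^sup>1) = 1\<close>, with the odd product
  factored over the two square roots \<open>\<plusminus>s\<close> of \<open>q\<close>. It makes the product of the theta function over the three
  half-periods an elementary function.
\<close>

lemma half_period_identity:
  assumes q: "norm q < 1" "q \<noteq> 0" and s: "s\<^sup>2 = q"
  shows "qpoch q (-1) * ((1 - s) * qpoch q s) * ((1 + s) * qpoch q (-s)) = 1"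
proof -
  have "qpoch (q\<^sup>2) (1/q) = (1 - q) * qpoch (q\<^sup>2) q"
    using qpoch_rec[OF norm_square_less_1[OF q(1)], of "1/q"] q by (simp add: power2_eq_square)
  moreover have "qpoch q s * qpoch q (-s) = qpoch (q\<^sup>2) q"
    using qpoch_plus_minus[OF q(1), of s] s by simp
  moreover have "(1 - s) * (1 + s) = 1 - q" using s by (simp add: algebra_simps power2_eq_square)
  ultimately have odd: "((1 - s) * qpoch q s) * ((1 + s) * qpoch q (-s)) = qpoch (q\<^sup>2) (1/q)"
    by (metis mult.assoc mult.left_commute)
  have "euler_phi q * qpoch q (-1) = euler_phi (q\<^sup>2)"
    using qpoch_plus_minus[OF q(1), of 1] by (simp add: euler_phi_def)
  then have "euler_phi (q\<^sup>2) * (qpoch q (-1) * qpoch (q\<^sup>2) (1/q)) = euler_phi (q\<^sup>2) * 1"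
    using euler_phi_even_odd[OF q] by (simp add: mult_ac)
  then have "qpoch q (-1) * qpoch (q\<^sup>2) (1/q) = 1"
    using euler_phi_nonzero[OF norm_square_less_1[OF q(1)]] by simp
  then show ?thesis using odd by (simp add: mult.assoc)
qed

text \<open>
  Jacobi's \<open>\<theta>\<^sub>1\<close> without the factors that are independent of \<open>u\<close>.
\<close>

definition theta :: "complex \<Rightarrow> complex \<Rightarrow> complex" where
  "theta \<tau> u = (ee (u/2) - ee (-u/2)) * qpoch (ee \<tau>) (ee u) * qpoch (ee \<tau>) (ee (-u))"

context
  fixes \<tau> :: complex
  assumes tau: "Im \<tau> > 0"
begin

lemma norm_nome: "norm (ee \<tau>) < 1" using tau by (rule norm_ee_less_1)

lemma theta_holomorphic: "theta \<tau> holomorphic_on UNIV"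
proof -
  have 1: "(\<lambda>u. qpoch (ee \<tau>) (ee u)) holomorphic_on UNIV"
    using holomorphic_on_compose_gen[OF _ qpoch_holomorphic_and_convergent(1)[OF norm_nome], of ee UNIV]
    by (simp add: o_def holomorphic_intros)
  have 2: "(\<lambda>u. qpoch (ee \<tau>) (ee (-u))) holomorphic_on UNIV"
    using holomorphic_on_compose_gen[OF _ qpoch_holomorphic_and_convergent(1)[OF norm_nome],
        of "\<lambda>u. ee (-u)" UNIV]
    by (simp add: o_def holomorphic_intros)
  show ?thesis unfolding theta_def by (intro holomorphic_intros 1 2) auto
qed

lemma theta_uminus: "theta \<tau> (-u) = - theta \<tau> u"
  by (simp add: theta_def algebra_simps)

lemma theta_add_1: "theta \<tau> (u + 1) = - theta \<tau> u"
proof -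
  have "ee ((u + 1) / 2) = - ee (u/2)" "ee (-(u + 1) / 2) = - ee (-u/2)"
  proof -
    have "(u + 1) / 2 = u/2 + 1/2" "-(u + 1) / 2 = -u/2 - 1/2" by (simp_all add: field_simps)
    then show "ee ((u + 1) / 2) = - ee (u/2)" "ee (-(u + 1) / 2) = - ee (-u/2)"
      by (simp_all only: ee_add ee_diff ee_half) simp_all
  qed
  moreover have "ee (u + 1) = ee u" "ee (-(u + 1)) = ee (-u)"
    using ee_add[of "u" "1"] ee_diff[of "-u" "1"] ee_int[of 1] by simp_all
  ultimately show ?thesis by (simp add: theta_def algebra_simps)
qed

lemma theta_add_tau: "theta \<tau> (u + \<tau>) = - ee (- u - \<tau>/2) * theta \<tau> u"
proof -
  define q where "q = ee \<tau>"
  define w where "w = ee u"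
  have q: "norm q < 1" "q \<noteq> 0" "w \<noteq> 0" using norm_nome by (auto simp: q_def w_def)
  have 1: "ee (u + \<tau>) = q * w" "ee (-(u + \<tau>)) = 1 / (q * w)" "ee (-u) = 1 / w"
    by (simp_all add: ee_add ee_minus ee_diff q_def w_def field_simps)
  have 2: "ee ((u + \<tau>)/2) - ee (-(u + \<tau>)/2) = - ee (-(u + \<tau>)/2) * (1 - q * w)"
  proof -
    have "(u + \<tau>)/2 = -(u + \<tau>)/2 + (u + \<tau>)" by (simp add: field_simps)
    then have "ee ((u + \<tau>)/2) = ee (-(u + \<tau>)/2) * (q * w)" using ee_add 1(1) by metis
    then show ?thesis by (simp add: right_diff_distrib)
  qed
  have 3: "ee (u/2) - ee (-u/2) = ee (u/2) * (1 - 1/w)"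
    using ee_add[of "u/2" "-u"] 1 by (simp add: algebra_simps)
  have 4: "ee (-u - \<tau>/2) * ee (u/2) = ee (-(u + \<tau>)/2)"
    unfolding ee_add[symmetric] by (rule arg_cong[of _ _ ee]) (simp add: field_simps)
  have 5: "qpoch q (1/(q*w)) = (1 - 1/w) * qpoch q (1/w)"
    using qpoch_rec[OF q(1), of "1/(q*w)"] q by simp
  have "theta \<tau> (u + \<tau>) = - ee (-(u + \<tau>)/2) * ((1 - q * w) * qpoch q (q * w)) * qpoch q (1/(q*w))"
    unfolding theta_def 2 by (simp only: q_def[symmetric] 1 mult.assoc)
  also have "\<dots> = - ee (-(u + \<tau>)/2) * qpoch q w * ((1 - 1/w) * qpoch q (1/w))"
    using qpoch_rec[OF q(1), of w] 5 by simp
  also have "\<dots> = - ee (- u - \<tau>/2) * theta \<tau> u"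
    unfolding theta_def 3 4[symmetric] by (simp add: q_def[symmetric] w_def[symmetric] 1 mult_ac)
  finally show ?thesis .
qed

lemma theta_zeros:
  assumes "theta \<tau> u = 0"
  obtains a b :: int where "u = of_int a + of_int b * \<tau>"
proof -
  note lattice = that
  have lat: thesis if "of_int b * \<tau> + u \<in> \<int> \<or> of_int b * \<tau> - u \<in> \<int>" for b :: int
    using that
  proof
    assume "of_int b * \<tau> + u \<in> \<int>"
    then obtain n where "of_int b * \<tau> + u = of_int n" by (auto elim!: Ints_cases)
    then show thesis using lattice[of n "-b"] by (simp add: algebra_simps)
  next
    assume "of_int b * \<tau> - u \<in> \<int>"
    then obtain n where "of_int b * \<tau> - u = of_int n" by (auto elim!: Ints_cases)
    then show thesis using lattice[of "-n" "b"] by (simp add: algebra_simps)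
  qed
  consider "ee (u/2) = ee (-u/2)" | "qpoch (ee \<tau>) (ee u) = 0" | "qpoch (ee \<tau>) (ee (-u)) = 0"
    using assms by (auto simp: theta_def)
  then show ?thesis
  proof cases
    case 1
    then have "ee u = 1" using ee_diff[of "u/2" "-u/2"] by simp
    then show ?thesis using lat[of 0] by (simp add: ee_eq_1_iff)
  next
    case 2
    then obtain n where "ee \<tau> ^ Suc n * ee u = 1" using qpoch_nonzero norm_nome by blast
    then show ?thesis using lat[of "int (Suc n)"]
      by (metis ee_add ee_eq_1_iff ee_power of_int_of_nat_eq)
  next
    case 3
    then obtain n where "ee \<tau> ^ Suc n * ee (-u) = 1" using qpoch_nonzero norm_nome by blast
    then show ?thesis using lat[of "int (Suc n)"]
      by (metis ee_add ee_eq_1_iff ee_power of_int_of_nat_eq uminus_add_conv_diff add.commute)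
  qed
qed

lemma theta_0 [simp]: "theta \<tau> 0 = 0" by (simp add: theta_def)

lemma theta_deriv_0:
  "(theta \<tau> has_field_derivative (2 * of_real pi * \<i> * (euler_phi (ee \<tau>))\<^sup>2)) (at 0)"
proof -
  define A where "A = (\<lambda>u. qpoch (ee \<tau>) (ee u) * qpoch (ee \<tau>) (ee (-u)))"
  have 1: "(\<lambda>u. qpoch (ee \<tau>) (ee u)) holomorphic_on UNIV"
    using holomorphic_on_compose_gen[OF _ qpoch_holomorphic_and_convergent(1)[OF norm_nome], of ee UNIV]
    by (simp add: o_def holomorphic_intros)
  have 2: "(\<lambda>u. qpoch (ee \<tau>) (ee (-u))) holomorphic_on UNIV"
    using holomorphic_on_compose_gen[OF _ qpoch_holomorphic_and_convergent(1)[OF norm_nome],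
        of "\<lambda>u. ee (-u)" UNIV]
    by (simp add: o_def holomorphic_intros)
  have "A holomorphic_on UNIV" unfolding A_def by (intro holomorphic_intros 1 2)
  then have A: "(A has_field_derivative deriv A 0) (at 0)"
    using holomorphic_derivI by blast
  have "((\<lambda>u. ee (u/2) - ee (-u/2)) has_field_derivative (2 * of_real pi * \<i>)) (at 0)"
    unfolding ee_def by (auto intro!: derivative_eq_intros)
  from DERIV_mult[OF this A]
  have "((\<lambda>u. (ee (u/2) - ee (-u/2)) * A u) has_field_derivative (2 * of_real pi * \<i> * A 0)) (at 0)"
    by simp
  moreover have "theta \<tau> = (\<lambda>u. (ee (u/2) - ee (-u/2)) * A u)"
    by (auto simp: theta_def A_def)
  moreover have "A 0 = (euler_phi (ee \<tau>))\<^sup>2"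
    by (simp add: A_def euler_phi_def power2_eq_square)
  ultimately show ?thesis by simp
qed

text \<open>
  At a half-period \<open>u\<close> the numbers \<open>w = exp(2\<pi>iu)\<close> and \<open>q/w\<close> coincide or, for \<open>u = 1/2\<close>, \<open>w = 1/w\<close>. The two infinite products then agree up
  to one factor, the value is a square times an exponential, and \<open>half_period_identity\<close> evaluates the product
  of the three squares.
\<close>

lemma theta_half_periods:
  "theta \<tau> (1/2) * theta \<tau> (\<tau>/2) * theta \<tau> ((1 + \<tau>)/2) = 2 * ee (-\<tau>/2)"
proof -
  define q where "q = ee \<tau>"
  define s where "s = ee (\<tau>/2)"
  have q: "norm q < 1" "q \<noteq> 0" "s \<noteq> 0" using norm_nome by (auto simp: q_def s_def)
  have s: "s\<^sup>2 = q" unfolding s_def q_def power2_eq_square ee_add[symmetric] by simp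
  have gen: "theta \<tau> u = - ee (-u/2) * ((1 - w) * qpoch q w)\<^sup>2"
    if w: "ee u = w" "w\<^sup>2 = q" for u w
  proof -
    have w0: "w \<noteq> 0" using w by auto
    have "ee (-u) = 1/w" using w by (simp add: ee_minus field_simps)
    moreover have "ee (u/2) - ee (-u/2) = - ee (-u/2) * (1 - w)"
      using ee_add[of "-u/2" u] w by (simp add: algebra_simps)
    moreover have "q * (1 / w) = w" using w0 w(2) by (simp add: field_simps power2_eq_square)
    then have "qpoch q (1/w) = (1 - w) * qpoch q w"
      using qpoch_rec[OF q(1), of "1/w"] by simp
    ultimately show ?thesis
      unfolding theta_def q_def[symmetric] w(1) by (simp add: power2_eq_square mult_ac)
  qed
  have t1: "theta \<tau> (1/2) = 2 * \<i> * (qpoch q (-1))\<^sup>2"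
  proof -
    have "ee (-(1/2)) = -1" "ee (-(1/4)) = -\<i>" "ee (1/4) = \<i>"
      by (simp_all add: ee_minus ee_half ee_quarter)
    then show ?thesis by (simp add: theta_def ee_half q_def[symmetric] power2_eq_square)
  qed
  have t2: "theta \<tau> (\<tau>/2) = - ee (-\<tau>/4) * ((1 - s) * qpoch q s)\<^sup>2"
    using gen[of "\<tau>/2" s] s by (simp add: s_def)
  have "ee ((1 + \<tau>)/2) = -s" using ee_add[of "1/2" "\<tau>/2"] by (simp add: s_def ee_half add_divide_distrib)
  then have t3: "theta \<tau> ((1 + \<tau>)/2) = - ee (-(1 + \<tau>)/4) * ((1 + s) * qpoch q (-s))\<^sup>2"
  proof -
    have "-((1 + \<tau>)/2)/2 = -(1 + \<tau>)/4" by (simp add: field_simps minus_divide_left)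
    then show ?thesis
      using gen[of "(1 + \<tau>)/2" "-s"] s \<open>ee ((1 + \<tau>)/2) = -s\<close> by (metis power2_minus diff_minus_eq_add)
  qed
  have e: "ee (-\<tau>/4) * ee (-(1 + \<tau>)/4) = - \<i> * ee (-\<tau>/2)"
  proof -
    have "ee (-\<tau>/4) * ee (-(1 + \<tau>)/4) = ee (-(1/4)) * ee (-\<tau>/2)"
      unfolding ee_add[symmetric] by (rule arg_cong[of _ _ ee]) (simp add: field_simps)
    then show ?thesis by (simp add: ee_minus ee_quarter)
  qed
  have "theta \<tau> (1/2) * theta \<tau> (\<tau>/2) * theta \<tau> ((1 + \<tau>)/2) =
      2 * \<i> * (ee (-\<tau>/4) * ee (-(1 + \<tau>)/4)) *
      (qpoch q (-1) * ((1 - s) * qpoch q s) * ((1 + s) * qpoch q (-s)))\<^sup>2"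
    unfolding t1 t2 t3 by (simp add: power_mult_distrib mult_ac)
  also have "\<dots> = 2 * ee (-\<tau>/2)"
    unfolding half_period_identity[OF q(1,2) s] e by simp
  finally show ?thesis .
qed

end

section \<open>The transformation of the eta function under inversion\<close>

definition eta :: "complex \<Rightarrow> complex" where "eta z = ee (z / 24) * euler_phi (ee z)"

lemma eta_nonzero: "Im z > 0 \<Longrightarrow> eta z \<noteq> 0"
  by (simp add: eta_def euler_phi_nonzero norm_ee_less_1)

lemma eta_holomorphic: "eta holomorphic_on uhp"
proof -
  have "(euler_phi \<circ> ee) holomorphic_on uhp"
    by (rule holomorphic_on_compose_gen[OF _ euler_phi_holomorphic])
       (auto intro!: holomorphic_intros norm_ee_less_1)
  then show ?thesis
    unfolding eta_def[abs_def] by (intro holomorphic_intros) (simp_all add: o_def)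
qed

lemma eta_add_1: "eta (z + 1) = ee (1/24) * eta z"
proof -
  have "ee (z + 1) = ee z" using ee_add[of z 1] ee_int[of 1] by simp
  moreover have "ee ((z + 1) / 24) = ee (1/24) * ee (z/24)"
    unfolding ee_add[symmetric] by (simp add: add_divide_distrib add.commute)
  ultimately show ?thesis by (simp add: eta_def)
qed

lemma Im_inverse_neg: "Im z > 0 \<Longrightarrow> Im (-1 / z) > 0"
  by (auto simp: Im_divide power2_eq_square complex_eq_iff intro!: divide_pos_pos add_nonneg_pos)

text \<open>
  For \<open>\<tau>' = -1/\<tau>\<close> the function \<open>exp(-\<pi>iu\<^sup>2/\<tau>) \<theta>(u/\<tau> | \<tau>')\<close> has the same quasi-periods and the same zeros
  as \<open>\<theta>(u | \<tau>)\<close>, so their ratio is a bounded entire function; its value is read off at the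
  common zero \<open>u = 0\<close>.
\<close>

lemma theta_inversion:
  assumes tau: "Im \<tau> > 0" and u: "theta \<tau> u \<noteq> 0"
  defines "\<tau>' \<equiv> -1 / \<tau>"
  shows "\<tau> * (euler_phi (ee \<tau>))\<^sup>2 * (ee (-(u\<^sup>2) / (2*\<tau>)) * theta \<tau>' (u / \<tau>)) =
           (euler_phi (ee \<tau>'))\<^sup>2 * theta \<tau> u"
proof -
  have tau': "Im \<tau>' > 0" unfolding \<tau>'_def by (rule Im_inverse_neg[OF tau])
  have t0: "\<tau> \<noteq> 0" using tau by auto
  define K where "K u = ee (-(u\<^sup>2) / (2*\<tau>)) * theta \<tau>' (u / \<tau>)" for u
  define L where "L = (euler_phi (ee \<tau>'))\<^sup>2 / (\<tau> * (euler_phi (ee \<tau>))\<^sup>2)"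
  define R where "R u = (if theta \<tau> u = 0 then L else K u / theta \<tau> u)" for u
  have p0: "euler_phi (ee \<tau>) \<noteq> 0" by (intro euler_phi_nonzero norm_ee_less_1 tau)
  have Khol: "K holomorphic_on UNIV"
  proof -
    have "(theta \<tau>' \<circ> (\<lambda>u. u / \<tau>)) holomorphic_on UNIV"
      by (rule holomorphic_on_compose_gen[OF _ theta_holomorphic[OF tau']])
         (use t0 in \<open>auto intro!: holomorphic_intros\<close>)
    then show ?thesis
      unfolding K_def[abs_def] by (intro holomorphic_intros) (use t0 in \<open>simp_all add: o_def\<close>)
  qed
  have K1: "K (u + 1) = - K u" for u
  proof -
    have a: "(u + 1) / \<tau> = u/\<tau> - \<tau>'" by (simp add: \<tau>'_def add_divide_distrib)
    have "theta \<tau>' (u/\<tau>) = - ee (-(u/\<tau> - \<tau>') - \<tau>'/2) * theta \<tau>' (u/\<tau> - \<tau>')"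
      using theta_add_tau[OF tau', of "u/\<tau> - \<tau>'"] by simp
    moreover have "ee (-((u+1)\<^sup>2) / (2*\<tau>)) = ee (-(u\<^sup>2) / (2*\<tau>)) * ee (-(u/\<tau> - \<tau>') - \<tau>'/2)"
      unfolding ee_add[symmetric] using t0
      by (intro arg_cong[of _ _ ee]) (simp add: \<tau>'_def field_simps power2_eq_square)
    ultimately show ?thesis by (simp add: K_def a)
  qed
  have Kt: "K (u + \<tau>) = - ee (-u - \<tau>/2) * K u" for u
  proof -
    have a: "(u + \<tau>) / \<tau> = u/\<tau> + 1" using t0 by (simp add: add_divide_distrib)
    have "ee (-((u+\<tau>)\<^sup>2) / (2*\<tau>)) = ee (-u - \<tau>/2) * ee (-(u\<^sup>2) / (2*\<tau>))"
      unfolding ee_add[symmetric] using t0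
      by (intro arg_cong[of _ _ ee]) (simp add: \<tau>'_def field_simps power2_eq_square)
    then show ?thesis by (simp add: K_def a theta_add_1[OF tau'])
  qed
  have R1: "R (u + 1) = R u" for u
    unfolding R_def K1 theta_add_1[OF tau] by simp
  have Rt: "R (u + \<tau>) = R u" for u
    unfolding R_def Kt theta_add_tau[OF tau] by simp
  have Rn1: "R (u + of_nat n) = R u" for u n
    by (induction n) (simp_all add: R1 add.assoc[symmetric] flip: of_nat_Suc,
        metis R1 add.assoc add.commute of_nat_Suc)
  have Rn: "R (u + of_int n) = R u" for u n
  proof (cases "n \<ge> 0")
    case True then show ?thesis using Rn1[of u "nat n"] by simp
  next
    case False then show ?thesis using Rn1[of "u + of_int n" "nat (-n)"] by simp
  qed
  have Rm1: "R (u + of_nat n * \<tau>) = R u" for u n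
  proof (induction n)
    case (Suc n)
    have "R (u + of_nat (Suc n) * \<tau>) = R ((u + of_nat n * \<tau>) + \<tau>)" by (simp add: algebra_simps)
    then show ?case using Suc Rt by metis
  qed simp
  have Rm: "R (u + of_int n * \<tau>) = R u" for u n
  proof (cases "n \<ge> 0")
    case True then show ?thesis using Rm1[of u "nat n"] by simp
  next
    case False then show ?thesis using Rm1[of "u + of_int n * \<tau>" "nat (-n)"] by simp
  qed
  have Rper: "R (u + (of_int a + of_int b * \<tau>)) = R u" for u a b
    using Rn[of "u + of_int b * \<tau>" a] Rm[of u b] by (simp add: algebra_simps)
  define r where "r = min 1 (Im \<tau>)"
  have r: "r > 0" using tau by (simp add: r_def)
  have isolated: "theta \<tau> u \<noteq> 0" if "norm u < r" "u \<noteq> 0" for u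
  proof
    assume "theta \<tau> u = 0"
    then obtain a b :: int where ab: "u = of_int a + of_int b * \<tau>" using theta_zeros[OF tau] by blast
    have "\<bar>of_int b * Im \<tau>\<bar> < Im \<tau>"
      using abs_Im_le_cmod[of u] that by (simp add: ab r_def)
    then have "\<bar>real_of_int b\<bar> < 1" using tau by (simp add: abs_mult)
    then have b: "b = 0" by linarith
    then have "\<bar>real_of_int a\<bar> < 1" using abs_Re_le_cmod[of u] that by (simp add: ab r_def)
    then show False using that ab b by simp
  qed
  have Kd: "(K has_field_derivative (2 * of_real pi * \<i> * (euler_phi (ee \<tau>'))\<^sup>2 / \<tau>)) (at 0)"
  proof -
    have "((\<lambda>u. theta \<tau>' (u/\<tau>)) has_field_derivative
        (2 * of_real pi * \<i> * (euler_phi (ee \<tau>'))\<^sup>2 * (1 / \<tau>))) (at 0)"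
      using DERIV_chain2[of "theta \<tau>'" _ "\<lambda>u. u/\<tau>" 0 "1/\<tau>" UNIV] theta_deriv_0[OF tau']
        DERIV_cdivide[OF DERIV_ident, of \<tau>] by simp
    moreover have "((\<lambda>u. ee (-(u\<^sup>2) / (2*\<tau>))) has_field_derivative 0) (at 0)"
      unfolding ee_def using t0 by (auto intro!: derivative_eq_intros)
    ultimately show ?thesis
      unfolding K_def[abs_def] by (auto dest: DERIV_mult)
  qed
  have lim: "((\<lambda>u. K u / theta \<tau> u) \<longlongrightarrow> L) (at 0)"
    by (rule lhopital_complex_simple[OF Kd theta_deriv_0[OF tau]])
       (use p0 t0 in \<open>simp_all add: K_def L_def theta_0[OF tau] theta_0[OF tau'] field_simps\<close>)
  have Rlim: "(R \<longlongrightarrow> R 0) (at 0)"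
  proof -
    have "R 0 = L" by (simp add: R_def theta_0[OF tau])
    moreover have "((\<lambda>u. R u - L) \<longlongrightarrow> 0) (at 0)"
      by (rule Lim_null_comparison[OF _ tendsto_norm_zero[OF LIM_zero[OF lim]]])
         (simp add: R_def)
    ultimately show ?thesis by (simp add: LIM_zero_iff)
  qed
  have Rquot: "R holomorphic_on S" if "\<And>u. u \<in> S \<Longrightarrow> theta \<tau> u \<noteq> 0" for S
  proof -
    have "(\<lambda>u. K u / theta \<tau> u) holomorphic_on S"
      using that by (intro holomorphic_on_divide)
         (auto intro: holomorphic_on_subset[OF Khol] holomorphic_on_subset[OF theta_holomorphic[OF tau]])
    then show ?thesis by (rule holomorphic_transform) (simp add: R_def that)
  qed
  have R0: "R holomorphic_on ball 0 r"
  proof (rule no_isolated_singularity'[where K = "{0}"])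
    show "R holomorphic_on ball 0 r - {0}" by (rule Rquot) (auto dest: isolated)
    show "(R \<longlongrightarrow> R z) (at z within ball 0 r)" if "z \<in> {0}" for z
      using Rlim that by (auto intro: filterlim_mono[OF _ order_refl at_le])
  qed auto
  have "R field_differentiable at u" for u
  proof (cases "theta \<tau> u = 0")
    case False
    have "open {u. theta \<tau> u \<noteq> 0}"
      using holomorphic_on_imp_continuous_on[OF theta_holomorphic[OF tau]]
      by (intro open_Collect_neq continuous_on_const) auto
    moreover have "R holomorphic_on {u. theta \<tau> u \<noteq> 0}" by (rule Rquot) simp
    ultimately show ?thesis using False holomorphic_on_imp_differentiable_at by blast
  next
    case True
    then obtain a b :: int where ab: "u = of_int a + of_int b * \<tau>" using theta_zeros[OF tau] by blast
    have "R field_differentiable at (u + (of_int (-a) + of_int (-b) * \<tau>))"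
      using holomorphic_on_imp_differentiable_at[OF R0 open_ball, of 0] r by (simp add: ab)
    moreover have "(\<lambda>v. v + (of_int (-a) + of_int (-b) * \<tau>)) field_differentiable at u"
      by (intro field_differentiable_add field_differentiable_const) (simp add: field_differentiable_ident)
    ultimately have "(R \<circ> (\<lambda>v. v + (of_int (-a) + of_int (-b) * \<tau>))) field_differentiable at u"
      using field_differentiable_compose by blast
    then show ?thesis by (simp only: o_def Rper)
  qed
  then have hol: "R holomorphic_on UNIV" by (simp add: holomorphic_on_def field_differentiable_at_within)
  have "bounded (range R)"
  proof -
    let ?par = "\<lambda>(x, y). of_real x + of_real y * \<tau> :: complex"
    have "continuous_on (cbox 0 1 \<times> cbox 0 (1::real)) ?par"
      unfolding case_prod_unfold by (intro continuous_intros)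
    then have "compact (?par ` (cbox 0 1 \<times> cbox 0 (1::real)))"
      by (rule compact_continuous_image[OF _ compact_Times[OF compact_cbox compact_cbox]])
    then have "compact (R ` ?par ` (cbox 0 1 \<times> cbox 0 (1::real)))"
      by (rule compact_continuous_image[OF holomorphic_on_imp_continuous_on[OF
            holomorphic_on_subset[OF hol subset_UNIV]]])
    moreover have "range R \<subseteq> R ` ?par ` (cbox 0 1 \<times> cbox 0 (1::real))"
    proof
      fix v assume "v \<in> range R"
      then obtain u where v: "v = R u" by auto
      define y where "y = Im u / Im \<tau>"
      define x where "x = Re u - y * Re \<tau>"
      have u: "u = of_real x + of_real y * \<tau>" using tau by (simp add: complex_eq_iff x_def y_def)
      have "R (?par (frac x, frac y)) = R (?par (frac x, frac y) + (of_int \<lfloor>x\<rfloor> + of_int \<lfloor>y\<rfloor> * \<tau>))"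
        by (simp only: Rper)
      also have "?par (frac x, frac y) + (of_int \<lfloor>x\<rfloor> + of_int \<lfloor>y\<rfloor> * \<tau>) = u"
        by (simp add: u frac_def algebra_simps)
      finally have "v = R (?par (frac x, frac y))" using v by simp
      moreover have "(frac x, frac y) \<in> cbox 0 1 \<times> cbox 0 (1::real)"
        by (simp add: frac_ge_0 less_imp_le[OF frac_lt_1])
      ultimately show "v \<in> R ` ?par ` (cbox 0 1 \<times> cbox 0 (1::real))" by blast
    qed
    ultimately show ?thesis using compact_imp_bounded bounded_subset by blast
  qed
  then have "R constant_on UNIV" using Liouville_theorem hol by blast
  then obtain C where C: "\<And>u. R u = C" by (auto simp: constant_on_def)
  have "C = L" using C[of 0] by (simp add: R_def theta_0[OF tau])
  have "K u = L * theta \<tau> u"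
    using C[of u] \<open>C = L\<close> u by (simp add: R_def field_simps)
  then show ?thesis
    using p0 t0 by (simp add: K_def L_def field_simps)
qed

lemma connected_uhp: "connected uhp"
  using convex_halfspace_Im_gt[of 0] by (simp add: convex_connected)

lemma open_uhp: "open uhp"
  using open_halfspace_Im_gt[of 0] by simp

lemma root_of_unity_constant:
  assumes g: "continuous_on uhp g" and root: "\<And>z. Im z > 0 \<Longrightarrow> g z ^ n = (1::complex)"
    and n: "n \<ge> 1" and z: "Im z > 0" "Im z0 > 0"
  shows "g z = g z0"
proof -
  have "g ` uhp \<subseteq> {w. w ^ n = 1}" using root by auto
  then have "finite (g ` uhp)" using finite_roots_unity[OF n] finite_subset by blast
  then have "g constant_on uhp" by (rule continuous_finite_range_constant[OF connected_uhp g])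
  then show ?thesis using z by (auto simp: constant_on_def)
qed

text \<open>
  The three half-periods eliminate the theta function from the inversion formula and leave a relation
  between the sixth powers of \<open>\<eta>\<close>; roots are extracted by continuity, starting
  at the fixed point \<open>\<i>\<close>.
\<close>

lemma eta_power6_inversion:
  assumes tau: "Im \<tau> > 0"
  shows "eta (-1/\<tau>) ^ 6 = (-\<i> * \<tau>) ^ 3 * eta \<tau> ^ 6"
proof -
  define t where "t = -1/\<tau>"
  define p where "p = euler_phi (ee \<tau>)"
  define p' where "p' = euler_phi (ee t)"
  define K where "K u = ee (-(u\<^sup>2) / (2*\<tau>)) * theta t (u / \<tau>)" for u
  have t: "Im t > 0" unfolding t_def by (rule Im_inverse_neg[OF tau])
  have tau0: "\<tau> \<noteq> 0" using tau by auto
  note hp = theta_half_periods[OF tau]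
  then have "theta \<tau> (1/2) \<noteq> 0" "theta \<tau> (\<tau>/2) \<noteq> 0" "theta \<tau> ((1 + \<tau>)/2) \<noteq> 0"
    by (metis ee_nonzero mult_eq_0_iff zero_neq_numeral)+
  then have inv: "\<tau> * p\<^sup>2 * K (1/2) = p'\<^sup>2 * theta \<tau> (1/2)"
    "\<tau> * p\<^sup>2 * K (\<tau>/2) = p'\<^sup>2 * theta \<tau> (\<tau>/2)"
    "\<tau> * p\<^sup>2 * K ((1+\<tau>)/2) = p'\<^sup>2 * theta \<tau> ((1+\<tau>)/2)"
    unfolding K_def p_def p'_def t_def using theta_inversion[OF tau] by blast+
  have K1: "K (1/2) = - ee (t/8) * theta t (t/2)"
  proof -
    have "(1/2)/\<tau> = -(t/2)" "-((1/2)\<^sup>2)/(2*\<tau>) = t/8"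
      by (simp_all add: t_def power2_eq_square)
    then show ?thesis by (simp only: K_def theta_uminus[OF t]) simp
  qed
  have K2: "K (\<tau>/2) = ee (-\<tau>/8) * theta t (1/2)"
  proof -
    have "(\<tau>/2)/\<tau> = 1/2" "-((\<tau>/2)\<^sup>2)/(2*\<tau>) = -\<tau>/8"
      using tau0 by (simp_all add: t_def power2_eq_square)
    then show ?thesis by (simp only: K_def)
  qed
  have K3: "K ((1+\<tau>)/2) = ee (t/8 - 1/4 - \<tau>/8) * theta t ((1+t)/2)"
  proof -
    have "((1+\<tau>)/2)/\<tau> = - ((1+t)/2) + 1" "-(((1+\<tau>)/2)\<^sup>2)/(2*\<tau>) = t/8 - 1/4 - \<tau>/8"
      using tau0 by (simp_all add: t_def power2_eq_square field_simps)
    then show ?thesis by (simp only: K_def theta_add_1[OF t] theta_uminus[OF t] minus_minus)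
  qed
  have "K (1/2) * K (\<tau>/2) * K ((1+\<tau>)/2) =
      - (ee (t/8) * ee (-\<tau>/8) * ee (t/8 - 1/4 - \<tau>/8)) *
      (theta t (1/2) * theta t (t/2) * theta t ((1+t)/2))"
    unfolding K1 K2 K3 by (simp add: mult_ac)
  also have "\<dots> = - (ee (t/8) * ee (-\<tau>/8) * ee (t/8 - 1/4 - \<tau>/8)) * (2 * ee (-t/2))"
    by (simp only: theta_half_periods[OF t])
  also have "\<dots> = -2 * (ee (t/8) * ee (-\<tau>/8) * ee (t/8 - 1/4 - \<tau>/8) * ee (-t/2))"
    by simp
  also have "ee (t/8) * ee (-\<tau>/8) * ee (t/8 - 1/4 - \<tau>/8) * ee (-t/2) = ee (-(1/4)) * ee (-t/4 - \<tau>/4)"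
    unfolding ee_add[symmetric] by (rule arg_cong[of _ _ ee]) (simp add: field_simps)
  finally have KKK: "K (1/2) * K (\<tau>/2) * K ((1+\<tau>)/2) = 2 * \<i> * ee (-t/4 - \<tau>/4)"
    by (simp add: ee_minus ee_quarter)
  have "(\<tau> * p\<^sup>2) ^ 3 * (K (1/2) * K (\<tau>/2) * K ((1+\<tau>)/2)) =
      (\<tau> * p\<^sup>2 * K (1/2)) * (\<tau> * p\<^sup>2 * K (\<tau>/2)) * (\<tau> * p\<^sup>2 * K ((1+\<tau>)/2))"
    by (simp add: power3_eq_cube mult_ac)
  also have "\<dots> = (p'\<^sup>2)^3 * (theta \<tau> (1/2) * theta \<tau> (\<tau>/2) * theta \<tau> ((1+\<tau>)/2))"
    unfolding inv by (simp add: power3_eq_cube mult_ac)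
  finally have "\<tau>^3 * p^6 * (\<i> * ee (-t/4 - \<tau>/4)) = p'^6 * ee (-\<tau>/2)"
    unfolding KKK hp by (simp add: power_mult_distrib mult_ac flip: power_mult)
  moreover have e1: "ee (\<tau>/24)^6 = ee (-t/4 - \<tau>/4) * ee (\<tau>/2 + t/4)"
    unfolding ee_add[symmetric] ee_power by (rule arg_cong[of _ _ ee]) (simp add: field_simps)
  moreover have e2: "ee (t/24)^6 = ee (-\<tau>/2) * ee (\<tau>/2 + t/4)"
    unfolding ee_add[symmetric] ee_power by (rule arg_cong[of _ _ ee]) (simp add: field_simps)
  have "\<i> * \<tau>^3 * (ee (\<tau>/24) * p)^6 = (\<tau>^3 * p^6 * (\<i> * ee (-t/4 - \<tau>/4))) * ee (\<tau>/2 + t/4)"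
    by (simp only: power_mult_distrib e1 mult_ac)
  ultimately have "\<i> * \<tau>^3 * (ee (\<tau>/24) * p)^6 = (ee (t/24) * p')^6"
    by (simp only: power_mult_distrib e2 mult_ac)
  moreover have "(-\<i> * \<tau>) ^ 3 = \<i> * \<tau>^3"
    by (subst power_mult_distrib) (simp add: power3_eq_cube)
  ultimately show ?thesis unfolding eta_def t_def[symmetric] p_def p'_def by simp
qed

lemma eta_inversion_continuous: "continuous_on uhp (\<lambda>z. eta (-1/z))"
proof -
  have "(eta \<circ> (\<lambda>z. -1/z)) holomorphic_on uhp"
    by (rule holomorphic_on_compose_gen[OF _ eta_holomorphic])
       (use Im_inverse_neg in \<open>auto intro!: holomorphic_intros\<close>)
  then show ?thesis using holomorphic_on_imp_continuous_on by (auto simp: o_def)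
qed

lemma eta_continuous: "continuous_on uhp eta"
  by (rule holomorphic_on_imp_continuous_on[OF eta_holomorphic])

lemma eta_square_inversion:
  assumes "Im \<tau> > 0"
  shows "(eta (-1/\<tau>))\<^sup>2 = -\<i> * \<tau> * (eta \<tau>)\<^sup>2"
proof -
  define g where "g z = (eta (-1/z))\<^sup>2 / (-\<i> * z * (eta z)\<^sup>2)" for z
  have "g \<tau> = g \<i>"
  proof (rule root_of_unity_constant[where g = g and n = 3])
    show "continuous_on uhp g" unfolding g_def
      by (intro continuous_intros eta_inversion_continuous eta_continuous) (auto simp: eta_nonzero)
    fix z :: complex assume z: "Im z > 0"
    have "g z ^ 3 = eta (-1/z) ^ 6 / ((-\<i> * z)^3 * eta z ^ 6)"
      by (simp add: g_def power_divide power_mult_distrib flip: power_mult)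
    then show "g z ^ 3 = 1" unfolding eta_power6_inversion[OF z] using z eta_nonzero[OF z] by auto
  qed (use assms in auto)
  also have "g \<i> = 1" by (simp add: g_def eta_nonzero)
  finally show ?thesis
    unfolding g_def by (subst (asm) divide_eq_1_iff) simp
qed

lemma csqrt_nonzero_continuous: "continuous_on uhp (\<lambda>z. csqrt (-\<i> * z))"
  by (intro continuous_on_compose2[OF continuous_on_csqrt] continuous_intros)
     (auto simp: complex_nonpos_Reals_iff)

lemma eta_inversion:
  assumes "Im \<tau> > 0"
  shows "eta (-1/\<tau>) = csqrt (-\<i> * \<tau>) * eta \<tau>"
proof -
  define g where "g z = eta (-1/z) / (csqrt (-\<i> * z) * eta z)" for z
  have "g \<tau> = g \<i>"
  proof (rule root_of_unity_constant[where g = g and n = 2])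
    show "continuous_on uhp g" unfolding g_def
      by (intro continuous_intros eta_inversion_continuous eta_continuous csqrt_nonzero_continuous)
         (auto simp: eta_nonzero)
    fix z :: complex assume z: "Im z > 0"
    have "g z ^ 2 = (eta (-1/z))\<^sup>2 / (-\<i> * z * (eta z)\<^sup>2)"
      by (simp add: g_def power_divide power_mult_distrib)
    then show "g z ^ 2 = 1" unfolding eta_square_inversion[OF z] using z eta_nonzero[OF z] by auto
  qed (use assms in auto)
  also have "g \<i> = 1" by (simp add: g_def eta_nonzero)
  finally show ?thesis using assms eta_nonzero[OF assms] by (auto simp: g_def field_simps)
qed

section \<open>Multipliers of eta quotients\<close>

definition transforms :: "(complex \<Rightarrow> complex) \<Rightarrow> nat \<Rightarrow> mat2 \<Rightarrow> complex \<Rightarrow> bool" where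
  "transforms F w g c \<longleftrightarrow> (\<forall>z. Im z > 0 \<longrightarrow> F (act g z) = c * aut g z ^ w * F z)"

lemma transforms_mult:
  assumes "transforms F w A a" "transforms F w B b" "mdet A = 1" "mdet B = 1"
  shows "transforms F w (A * B) (a * b)"
  unfolding transforms_def
proof (intro allI impI)
  fix z :: complex assume z: "Im z > 0"
  have "F (act (A * B) z) = F (act A (act B z))" using act_mult assms z by simp
  also have "\<dots> = a * aut A (act B z) ^ w * (b * aut B z ^ w * F z)"
    using assms(1,2) act_uhp[of B z] assms(4) z by (simp add: transforms_def)
  also have "\<dots> = a * b * aut (A * B) z ^ w * F z"
    using aut_mult[of B z A] assms z by (simp add: power_mult_distrib mult_ac)
  finally show "F (act (A * B) z) = a * b * aut (A * B) z ^ w * F z" .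
qed

lemma transforms_1: "transforms F w 1 1" by (simp add: transforms_def)

lemma transforms_right_inverse:
  assumes A: "transforms F w A a" "mdet A = 1" "a \<noteq> 0" and B: "A * B = 1" "mdet B = 1"
  shows "transforms F w B (1 / a)"
  unfolding transforms_def
proof (intro allI impI)
  fix z :: complex assume z: "Im z > 0"
  have 1: "act A (act B z) = z" using act_mult[of A B z] A B z by simp
  have 2: "aut A (act B z) * aut B z = 1" using aut_mult[of B z A] B z by simp
  have "F z = a * aut A (act B z) ^ w * F (act B z)"
    using A(1)[unfolded transforms_def, rule_format, of "act B z"] act_uhp[of B z] B z 1 by simp
  then have "aut B z ^ w * F z = a * (aut A (act B z) * aut B z) ^ w * F (act B z)"
    by (simp add: power_mult_distrib mult_ac)
  then show "F (act B z) = 1 / a * aut B z ^ w * F z" using 2 A(3) by simp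
qed

text \<open>
  A function that transforms under the generators of \<open>\<Gamma>\<^sub>0(k)\<close> with the values of a character \<open>ch\<close>
  transforms with \<open>ch\<close> under the whole group. The character is only required to be multiplicative against
  generators, so that an explicit formula for it can be checked by a finite computation.
\<close>

lemma transforms_Gamma0:
  assumes k: "k = 1 \<or> k = 3 \<or> k = 5" and \<gamma>: "mdet \<gamma> = 1" "k dvd lowleft \<gamma>"
    and F: "transforms F w (TT 1) t" "transforms F w (VV k) v" "transforms F w NEG n"
      "k = 5 \<Longrightarrow> transforms F w EL e"
    and nz: "t \<noteq> 0" "v \<noteq> 0"
    and ch: "ch 1 = 1"
      "\<And>\<gamma>. mdet \<gamma> = 1 \<Longrightarrow> k dvd lowleft \<gamma> \<Longrightarrow> ch (\<gamma> * TT 1) = ch \<gamma> * t"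
      "\<And>\<gamma>. mdet \<gamma> = 1 \<Longrightarrow> k dvd lowleft \<gamma> \<Longrightarrow> ch (\<gamma> * VV k) = ch \<gamma> * v"
      "\<And>\<gamma>. mdet \<gamma> = 1 \<Longrightarrow> k dvd lowleft \<gamma> \<Longrightarrow> ch (\<gamma> * NEG) = ch \<gamma> * n"
      "\<And>\<gamma>. k = 5 \<Longrightarrow> mdet \<gamma> = 1 \<Longrightarrow> k dvd lowleft \<gamma> \<Longrightarrow> ch (\<gamma> * EL) = ch \<gamma> * e"
  shows "transforms F w \<gamma> (ch \<gamma>)"
  using k \<gamma>
proof (induction rule: Gamma0_induct)
  have dets: "mdet (TT j) = 1" "mdet (VV j) = 1" "mdet NEG = 1" "mdet EL = 1" for j
    by (simp_all add: TT_def VV_def NEG_def EL_def)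
  have inv: "TT 1 * TT (-1) = 1" "TT (-1) * TT 1 = 1" "VV k * VV (-k) = 1" "VV (-k) * VV k = 1"
    by (simp_all add: TT_add TT_0 VV_add VV_0)
  {
    case one
    show ?case by (simp add: ch(1) transforms_1)
  next
    case (T \<gamma>)
    then show ?case using transforms_mult[OF T(3) F(1)] dets ch(2) by simp
  next
    case (Ti \<gamma>)
    have "ch \<gamma> = ch (\<gamma> * TT (-1) * TT 1)" by (simp add: mult.assoc inv)
    also have "\<dots> = ch (\<gamma> * TT (-1)) * t"
      by (rule ch(2)) (use Ti in \<open>cases \<gamma>; simp add: TT_def algebra_simps\<close>)+
    finally show ?case
      using transforms_mult[OF Ti(3) transforms_right_inverse[OF F(1) _ nz(1) inv(1)]] dets Ti nz
      by simp
  next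
    case (V \<gamma>)
    then show ?case using transforms_mult[OF V(3) F(2)] dets ch(3) by simp
  next
    case (Vi \<gamma>)
    have low: "k dvd lowleft (\<gamma> * VV (-k))"
    proof -
      obtain a b c d where g: "\<gamma> = M2 a b c d" by (cases \<gamma>)
      show ?thesis using Vi(2) by (simp add: g VV_def)
    qed
    have "ch \<gamma> = ch (\<gamma> * VV (-k) * VV k)" by (simp add: mult.assoc inv)
    also have "\<dots> = ch (\<gamma> * VV (-k)) * v"
      by (rule ch(3)) (use Vi dets low in simp_all)
    finally show ?case
      using transforms_mult[OF Vi(3) transforms_right_inverse[OF F(2) _ nz(2) inv(3)]] dets Vi nz
      by simp
  next
    case (neg \<gamma>)
    then show ?case using transforms_mult[OF neg(3) F(3)] dets ch(4) by simp
  next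
    case (ell \<gamma>)
    then show ?case using transforms_mult[OF ell(4) F(4)] dets ch(5) by simp
  }
qed

subsection \<open>The square of the eta function\<close>

text \<open>
  The multiplier of \<open>\<eta>\<^sup>2\<close> is a character of the modular group with values in the twelfth roots of unity, and this polynomial is its
  exponent modulo \<open>12\<close>. The factor \<open>1 - c\<^sup>2\<close> separates even and odd \<open>c\<close> modulo \<open>4\<close>, and \<open>c \<equiv> 0\<close> from the other classes
  modulo \<open>3\<close>.
\<close>

fun eta2_exponent :: "mat2 \<Rightarrow> int" where
  "eta2_exponent (M2 a b c d) = (1 - c*c) * (b*d + 3*(c-1)*d + c + 3) + c * (a + d - 3)"

text \<open>
  Right multiplication by \<open>T\<close>, \<open>V\<close> and \<open>-1\<close> has to add \<open>1\<close>, \<open>-1\<close> and \<open>6\<close> to the exponent modulo \<open>12\<close>. By the Chinese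
  remainder theorem it is enough to inspect the matrices modulo \<open>3\<close> and modulo \<open>4\<close>.
\<close>

lemma eta2_exponent_residues:
  "\<forall>a\<in>{0,1,2}. \<forall>b\<in>{0,1,2}. \<forall>c\<in>{0,1,2}. \<forall>d\<in>{0,1,2::int}. (a*d - b*c) mod 3 = 1 \<longrightarrow>
     (eta2_exponent (M2 a (a+b) c (c+d)) - eta2_exponent (M2 a b c d) - 1) mod 3 = 0 \<and>
     (eta2_exponent (M2 (a+b) b (c+d) d) - eta2_exponent (M2 a b c d) + 1) mod 3 = 0 \<and>
     (eta2_exponent (M2 (-a) (-b) (-c) (-d)) - eta2_exponent (M2 a b c d) - 6) mod 3 = 0"
  "\<forall>a\<in>{0,1,2,3}. \<forall>b\<in>{0,1,2,3}. \<forall>c\<in>{0,1,2,3}. \<forall>d\<in>{0,1,2,3::int}. (a*d - b*c) mod 4 = 1 \<longrightarrow>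
     (eta2_exponent (M2 a (a+b) c (c+d)) - eta2_exponent (M2 a b c d) - 1) mod 4 = 0 \<and>
     (eta2_exponent (M2 (a+b) b (c+d) d) - eta2_exponent (M2 a b c d) + 1) mod 4 = 0 \<and>
     (eta2_exponent (M2 (-a) (-b) (-c) (-d)) - eta2_exponent (M2 a b c d) - 6) mod 4 = 0"
  by code_simp+

lemma eta2_exponent_generators:
  assumes "mdet (M2 a b c d) = 1"
  shows "12 dvd eta2_exponent (M2 a (a+b) c (c+d)) - eta2_exponent (M2 a b c d) - 1"
    "12 dvd eta2_exponent (M2 (a+b) b (c+d) d) - eta2_exponent (M2 a b c d) + 1"
    "12 dvd eta2_exponent (M2 (-a) (-b) (-c) (-d)) - eta2_exponent (M2 a b c d) - 6"
proof -
  have m3: "x mod 3 \<in> {0,1,2}" for x :: int by (simp, presburger)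
  have m4: "x mod 4 \<in> {0,1,2,3}" for x :: int by (simp, presburger)
  have cmod: "[x mod n = x] (mod n)" for x n :: int by (simp add: cong_def)
  have cexp: "[eta2_exponent (M2 a b c d) = eta2_exponent (M2 a' b' c' d')] (mod n)"
    if "[a = a'] (mod n)" "[b = b'] (mod n)" "[c = c'] (mod n)" "[d = d'] (mod n)"
    for a b c d a' b' c' d' n
    unfolding eta2_exponent.simps
    by (intro cong_add cong_mult cong_diff cong_refl that)
  have d34: "[(a mod n)*(d mod n) - (b mod n)*(c mod n) = a*d - b*c] (mod n)" for n
    by (intro cong_mult cong_diff cmod)
  have ad: "a * d - b * c = 1" using assms by simp
  have d3: "((a mod 3)*(d mod 3) - (b mod 3)*(c mod 3)) mod 3 = 1"
    by (rule trans[OF d34[of 3, unfolded cong_def ad]]) simp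
  have d4: "((a mod 4)*(d mod 4) - (b mod 4)*(c mod 4)) mod 4 = 1"
    by (rule trans[OF d34[of 4, unfolded cong_def ad]]) simp
  note r3 = eta2_exponent_residues(1)[rule_format, OF m3[of a] m3[of b] m3[of c] m3[of d] d3]
  note r4 = eta2_exponent_residues(2)[rule_format, OF m4[of a] m4[of b] m4[of c] m4[of d] d4]
  let ?E = "\<lambda>n. M2 (a mod n) (b mod n) (c mod n) (d mod n)"
  have g1: "[eta2_exponent (M2 (a mod n) (a mod n + b mod n) (c mod n) (c mod n + d mod n)) - eta2_exponent (?E n) - 1
      = eta2_exponent (M2 a (a+b) c (c+d)) - eta2_exponent (M2 a b c d) - 1] (mod n)" for n
    by (intro cong_diff cexp cong_add cmod cong_refl)
  have g2: "[eta2_exponent (M2 (a mod n + b mod n) (b mod n) (c mod n + d mod n) (d mod n)) - eta2_exponent (?E n) + 1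
      = eta2_exponent (M2 (a+b) b (c+d) d) - eta2_exponent (M2 a b c d) + 1] (mod n)" for n
    by (intro cong_diff cexp cong_add cmod cong_refl)
  have g3: "[eta2_exponent (M2 (-(a mod n)) (-(b mod n)) (-(c mod n)) (-(d mod n))) - eta2_exponent (?E n) - 6
      = eta2_exponent (M2 (-a) (-b) (-c) (-d)) - eta2_exponent (M2 a b c d) - 6] (mod n)" for n
    by (intro cong_diff cexp cong_minus_minus_iff[THEN iffD2] cmod cong_refl)
  have dvd12: "12 dvd x" if "x mod 3 = 0" "x mod 4 = 0" for x :: int
    using that by presburger
  show "12 dvd eta2_exponent (M2 a (a+b) c (c+d)) - eta2_exponent (M2 a b c d) - 1"
    by (rule dvd12) (use r3 r4 g1[of 3] g1[of 4] in \<open>simp_all only: cong_def\<close>)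
  show "12 dvd eta2_exponent (M2 (a+b) b (c+d) d) - eta2_exponent (M2 a b c d) + 1"
    by (rule dvd12) (use r3 r4 g2[of 3] g2[of 4] in \<open>simp_all only: cong_def\<close>)
  show "12 dvd eta2_exponent (M2 (-a) (-b) (-c) (-d)) - eta2_exponent (M2 a b c d) - 6"
    by (rule dvd12) (use r3 r4 g3[of 3] g3[of 4] in \<open>simp_all only: cong_def\<close>)
qed

lemma ee_twelfth_cong:
  assumes "12 dvd (x - y - n)"
  shows "ee (of_int x / 12) = ee (of_int y / 12) * ee (of_int n / 12)"
proof -
  obtain j where "x = y + n + 12 * j" using assms by (auto elim!: dvdE simp: algebra_simps)
  then have "of_int x / (12::complex) = of_int y / 12 + of_int n / 12 + of_int j"
    by (simp add: field_simps)
  then show ?thesis by (simp only: ee_add ee_int[OF Ints_of_int] mult_1_right)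
qed

lemma eta_add_nat: "eta (z + of_nat n) = ee (of_nat n / 24) * eta z"
proof (induction n)
  case (Suc n)
  have "eta (z + of_nat (Suc n)) = eta (z + of_nat n + 1)" by (simp add: add_ac)
  also have "\<dots> = ee (1/24) * ee (of_nat n / 24) * eta z" by (simp add: eta_add_1 Suc)
  also have "ee (1/24) * ee (of_nat n / 24) = ee (of_nat (Suc n) / 24)"
    unfolding ee_add[symmetric] by (simp add: add_divide_distrib)
  finally show ?case .
qed simp

lemma eta_diff_nat: "eta (z - of_nat n) = ee (- (of_nat n / 24)) * eta z"
  using eta_add_nat[of "z - of_nat n" n] by (simp add: ee_minus field_simps)

text \<open>
  The parabolic element fixing the cusp \<open>0\<close>, written as \<open>S\<inverse> T\<^sup>-\<^sup>k S\<close>. The two square roots are kept because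
  their product also occurs for \<open>\<eta>(kz)\<close>.
\<close>

lemma eta_VV:
  fixes k :: nat
  assumes z: "Im z > 0"
  defines "w \<equiv> - of_nat k - 1 / z"
  shows "eta (z / (of_nat k * z + 1)) =
           csqrt (-\<i> * w) * csqrt (-\<i> * z) * ee (- (of_nat k / 24)) * eta z"
proof -
  have w: "Im w > 0" using Im_inverse_neg[OF z] by (simp add: w_def)
  have z0: "z \<noteq> 0" using z by auto
  have w0: "w \<noteq> 0" using w by auto
  have "z / (of_nat k * z + 1) = -1 / w"
  proof -
    have "of_nat k * z + 1 = - (w * z)" using z0 by (simp add: w_def field_simps)
    then show ?thesis using z0 w0 by simp
  qed
  then have "eta (z / (of_nat k * z + 1)) = csqrt (-\<i> * w) * eta w"
    using eta_inversion[OF w] by simp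
  also have "eta w = ee (- (of_nat k / 24)) * (csqrt (-\<i> * z) * eta z)"
  proof -
    have "w = -1 / z - of_nat k" by (simp add: w_def)
    then show ?thesis by (simp only: eta_diff_nat eta_inversion[OF z])
  qed
  finally show ?thesis by (simp only: mult_ac)
qed

lemma transforms_eta_square:
  assumes "mdet \<gamma> = 1"
  shows "transforms (\<lambda>z. (eta z)\<^sup>2) 1 \<gamma> (ee (of_int (eta2_exponent \<gamma>) / 12))"
proof (rule transforms_Gamma0[where k = 1 and t = "ee (1/12)" and v = "ee (-1/12)" and n = "-1" and e = 1])
  show "transforms (\<lambda>z. (eta z)\<^sup>2) 1 (TT 1) (ee (1/12))"
    using ee_power[of "1/24" 2] by (simp add: transforms_def TT_def eta_add_1 power_mult_distrib)
  show "transforms (\<lambda>z. (eta z)\<^sup>2) 1 (VV 1) (ee (-1/12))"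
    unfolding transforms_def
  proof (intro allI impI)
    fix z :: complex assume z: "Im z > 0"
    then have z0: "z \<noteq> 0" by auto
    have "(eta (z / (z + 1)))\<^sup>2 = (-\<i> * (-1 - 1/z)) * (-\<i> * z) * (ee (-(1/24)))\<^sup>2 * (eta z)\<^sup>2"
      using eta_VV[OF z, of 1] by (simp only: power_mult_distrib of_nat_1 mult_1 power2_csqrt)
    also have "(-\<i> * (-1 - 1/z)) * (-\<i> * z) = z + 1" using z0 by (simp add: algebra_simps)
    also have "(ee (-(1/24)))\<^sup>2 = ee (-1/12)" using ee_power[of "-(1/24)" 2] by simp
    finally show "(eta (act (VV 1) z))\<^sup>2 = ee (-1/12) * aut (VV 1) z ^ 1 * (eta z)\<^sup>2"
      by (simp add: VV_def mult_ac)
  qed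
  show "transforms (\<lambda>z. (eta z)\<^sup>2) 1 NEG (-1)" by (simp add: transforms_def NEG_def)
  fix \<gamma> assume g: "mdet \<gamma> = 1"
  obtain a b c d where abcd: "\<gamma> = M2 a b c d" by (cases \<gamma>)
  note gen = eta2_exponent_generators[OF g[unfolded abcd]]
  show "ee (of_int (eta2_exponent (\<gamma> * TT 1)) / 12) = ee (of_int (eta2_exponent \<gamma>) / 12) * ee (1/12)"
    using ee_twelfth_cong[OF gen(1)] by (simp add: abcd TT_def del: eta2_exponent.simps)
  show "ee (of_int (eta2_exponent (\<gamma> * VV 1)) / 12) = ee (of_int (eta2_exponent \<gamma>) / 12) * ee (-1/12)"
    using ee_twelfth_cong[of "eta2_exponent (M2 (a+b) b (c+d) d)" "eta2_exponent (M2 a b c d)" "-1"] gen(2)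
    by (simp add: abcd VV_def del: eta2_exponent.simps)
  show "ee (of_int (eta2_exponent (\<gamma> * NEG)) / 12) = ee (of_int (eta2_exponent \<gamma>) / 12) * (-1)"
    using ee_twelfth_cong[OF gen(3)] ee_half by (simp add: abcd NEG_def del: eta2_exponent.simps)
qed (use assms in \<open>simp_all add: one_mat2_def\<close>)

lemma norm_eta_act:
  assumes "mdet \<gamma> = 1" "Im z > 0"
  shows "norm (eta (act \<gamma> z)) ^ 2 = norm (aut \<gamma> z) * norm (eta z) ^ 2"
proof -
  have "norm ((eta (act \<gamma> z))\<^sup>2) = norm (aut \<gamma> z) * norm (eta z) ^ 2"
    using transforms_eta_square[OF assms(1)] assms(2)
    by (simp add: transforms_def norm_mult norm_ee norm_power)
  then show ?thesis by (simp add: norm_power)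
qed

text \<open>
  On odd \<open>d\<close> this is the nontrivial character modulo \<open>4\<close>.
\<close>

definition sgn4 :: "int \<Rightarrow> complex" where "sgn4 d = (if d mod 4 = 1 then 1 else -1)"

lemma eta_square_diag:
  assumes g: "mdet (M2 a b c d) = 1" "12 dvd b" "12 dvd c" and z: "Im z > 0"
  shows "(eta (act (M2 a b c d) z))\<^sup>2 = sgn4 d * aut (M2 a b c d) z * (eta z)\<^sup>2"
proof -
  obtain b' c' where bc: "b = 12 * b'" "c = 12 * c'" using g by (auto elim!: dvdE)
  have "a * d = 1 + 144 * b' * c'" using g(1) by (simp add: bc)
  then have od: "odd d" by (metis dvd_mult even_add even_mult_iff odd_one even_numeral)
  define x where "x = eta2_exponent (M2 a b c d)"
  have x: "12 dvd x - (3 - 3 * d)"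
  proof -
    have "x - (3 - 3 * d) = 12 * ((1 - 12*12*c'*c') * (b'*d + 3*c'*d + c') - 12*c'*c'*(3 - 3*d) + c' * (a + d - 3))"
      by (simp add: x_def bc algebra_simps)
    then show ?thesis by simp
  qed
  have "ee (of_int x / 12) = sgn4 d"
  proof (cases "d mod 4 = 1")
    case True
    then have "12 dvd x - 0 - 0" using x by presburger
    from ee_twelfth_cong[OF this] show ?thesis using True by (simp add: sgn4_def)
  next
    case False
    then have "12 dvd x - 0 - 6" using x od by presburger
    from ee_twelfth_cong[OF this] show ?thesis using False by (simp add: sgn4_def ee_half)
  qed
  then show ?thesis
    using transforms_eta_square[OF g(1)] z unfolding transforms_def x_def by simp
qed

lemma act_scale:
  assumes "c = k * c'" "k > 0" "Im z > 0"
  shows "of_int k * act (M2 a b c d) z = act (M2 a (k * b) c' d) (of_int k * z)"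
    and "aut (M2 a b c d) z = aut (M2 a (k * b) c' d) (of_int k * z)"
  using assms by (simp_all add: algebra_simps)

lemma eta_scaled_square_diag:
  assumes g: "mdet (M2 a b c d) = 1" "12 dvd b" "12 * int k dvd c" "k > 0" and z: "Im z > 0"
  shows "(eta (of_nat k * act (M2 a b c d) z))\<^sup>2 =
    sgn4 d * aut (M2 a b c d) z * (eta (of_nat k * z))\<^sup>2"
proof -
  obtain c' where c: "c = int k * c'" "12 dvd c'"
    using g(3) by (auto elim!: dvdE intro: that[of "12 * _"])
  have det: "mdet (M2 a (int k * b) c' d) = 1" using g(1) c by (simp add: algebra_simps)
  have Im: "Im (of_int (int k) * z) > 0" using z g by simp
  have k0: "int k > 0" using g(4) by simp
  have "12 dvd int k * b" using g(2) by simp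
  from eta_square_diag[OF det this c(2) Im] show ?thesis
    unfolding act_scale(1)[OF c(1) k0 z, symmetric] act_scale(2)[OF c(1) k0 z, symmetric]
    by (simp only: of_int_of_nat_eq)
qed

subsection \<open>The quotient \<open>\<eta>(z)\<^sup>k\<^sup>s / \<eta>(kz)\<^sup>s\<close>\<close>

lemma csqrt_of_pos_mult:
  assumes "r > 0" "Re z > 0"
  shows "csqrt (of_real r * z) = of_real (sqrt r) * csqrt z"
proof (rule csqrt_unique)
  show "(of_real (sqrt r) * csqrt z)\<^sup>2 = of_real r * z"
    using assms by (simp add: power_mult_distrib flip: of_real_power)
  have "cmod z + Re z > 0" using assms norm_ge_zero[of z] by linarith
  then have "Re (csqrt z) > 0" by simp
  then show "0 < Re (of_real (sqrt r) * csqrt z) \<or>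
      Re (of_real (sqrt r) * csqrt z) = 0 \<and> 0 \<le> Im (of_real (sqrt r) * csqrt z)"
    using assms by simp
qed

definition eta_quot :: "nat \<Rightarrow> nat \<Rightarrow> complex \<Rightarrow> complex" where
  "eta_quot k s z = eta z ^ (k * s) / eta (of_nat k * z) ^ s"

text \<open>
  On \<open>d\<close> prime to \<open>k\<close> this is the Legendre symbol modulo \<open>k\<close>, for \<open>k = 3\<close> and \<open>k = 5\<close>.
\<close>

definition levelchar :: "nat \<Rightarrow> int \<Rightarrow> complex" where
  "levelchar k d = (if k = 3 then (if d mod 3 = 1 then 1 else -1)
                    else (if d mod 5 = 1 \<or> d mod 5 = 4 then 1 else -1))"

text \<open>
  The quotient has a real character because \<open>s(k\<^sup>2 - 1) = 24\<close>: all roots of unity coming from the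
  parabolic generators cancel. For the elliptic generator (\<open>k = 5\<close>) the constant is first seen to
  be a root of unity and then evaluated at the fixed point \<open>(2 + \<i>)/5\<close>.
\<close>

lemma transforms_eta_quot_TT:
  assumes "k \<ge> 1"
  shows "transforms (eta_quot k s) w (TT 1) 1"
  unfolding transforms_def
proof (intro allI impI)
  fix z :: complex assume "Im z > 0"
  have "eta (of_nat k * (z + 1)) = ee (of_nat k / 24) * eta (of_nat k * z)"
    using eta_add_nat[of "of_nat k * z" k] by (simp add: algebra_simps)
  moreover have "ee (1/24) ^ (k * s) = ee (of_nat k / 24) ^ s"
    by (simp add: ee_power mult_ac)
  ultimately have "eta_quot k s (z + 1) = eta_quot k s z"
    by (simp add: eta_quot_def eta_add_1 power_mult_distrib)
  then show "eta_quot k s (act (TT 1) z) = 1 * aut (TT 1) z ^ w * eta_quot k s z"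
    by (simp add: TT_def)
qed

lemma transforms_eta_quot_VV:
  assumes k: "k \<ge> 1" and s: "s * (k\<^sup>2 - 1) = 24" and w: "2 * w = s * (k - 1)"
  shows "transforms (eta_quot k s) w (VV (int k)) 1"
  unfolding transforms_def
proof (intro allI impI)
  fix z :: complex assume z: "Im z > 0"
  then have z0: "z \<noteq> 0" by auto
  define v where "v = - of_nat k - 1 / z"
  define \<alpha> where "\<alpha> = csqrt (-\<i> * v) * csqrt (-\<i> * z)"
  have kz: "Im (of_nat k * z) > 0" using k z by simp
  have v: "Im v > 0" using Im_inverse_neg[OF z] by (simp add: v_def)
  have \<alpha>2: "\<alpha>\<^sup>2 = of_nat k * z + 1"
    using z0 by (simp add: \<alpha>_def power_mult_distrib v_def algebra_simps)
  have 1: "eta (z / (of_nat k * z + 1)) = \<alpha> * ee (- (of_nat k / 24)) * eta z"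
    using eta_VV[OF z, of k] by (simp only: \<alpha>_def v_def)
  have 2: "eta (of_nat k * z / (of_nat k * z + 1)) = \<alpha> * ee (- (1 / 24)) * eta (of_nat k * z)"
  proof -
    have "-\<i> * (-1 - 1 / (of_nat k * z)) = of_real (1 / real k) * (-\<i> * v)"
      using k z0 by (simp add: v_def field_simps)
    then have "csqrt (-\<i> * (-1 - 1 / (of_nat k * z))) = of_real (sqrt (1 / real k)) * csqrt (-\<i> * v)"
      using csqrt_of_pos_mult[of "1 / real k" "-\<i> * v"] k v by simp
    moreover have "csqrt (-\<i> * (of_nat k * z)) = of_real (sqrt (real k)) * csqrt (-\<i> * z)"
      using csqrt_of_pos_mult[of "real k" "-\<i> * z"] k z by (simp add: mult_ac)
    moreover have "of_real (sqrt (1 / real k)) * of_real (sqrt (real k)) = (1::complex)"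
      using k by (simp add: real_sqrt_divide flip: of_real_mult)
    ultimately have "csqrt (-\<i> * (-1 - 1 / (of_nat k * z))) * csqrt (-\<i> * (of_nat k * z)) = \<alpha>"
      unfolding \<alpha>_def by (metis (no_types, opaque_lifting) mult.assoc mult.commute mult.left_neutral)
    then show ?thesis using eta_VV[OF kz, of 1] by simp
  qed
  have "ee (- (of_nat k / 24)) ^ (k * s) = ee (- (1 / 24)) ^ s"
  proof -
    have "k\<^sup>2 \<ge> 1" using k by simp
    then have "s * k\<^sup>2 = 24 + s" using s by (simp add: diff_mult_distrib2)
    then have "(of_nat s :: complex) * of_nat k ^ 2 = 24 + of_nat s"
      by (metis of_nat_add of_nat_mult of_nat_numeral of_nat_power)
    then have "of_nat (k * s) * (- (of_nat k / 24)) = of_nat s * (- (1 / 24)) + (-1 :: complex)"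
      by (simp add: field_simps power2_eq_square)
    then show ?thesis by (simp only: ee_power ee_add) (simp add: ee_int)
  qed
  moreover have "\<alpha> ^ (k * s) = \<alpha> ^ s * (of_nat k * z + 1) ^ w"
  proof -
    have "k * s = s + 2 * w" using w k by (simp add: algebra_simps)
    then show ?thesis by (simp add: power_add power_mult \<alpha>2)
  qed
  moreover have "\<alpha> \<noteq> 0" using z v by (auto simp: \<alpha>_def)
  ultimately have "eta_quot k s (z / (of_nat k * z + 1)) = (of_nat k * z + 1) ^ w * eta_quot k s z"
    using 1 2 by (simp add: eta_quot_def power_mult_distrib)
  then show "eta_quot k s (act (VV (int k)) z) = 1 * aut (VV (int k)) z ^ w * eta_quot k s z"
    by (simp add: VV_def)
qed

lemma eta_quot_continuous: "k \<ge> 1 \<Longrightarrow> continuous_on uhp (eta_quot k s)"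
  unfolding eta_quot_def[abs_def]
  by (intro continuous_intros eta_continuous continuous_on_compose2[OF eta_continuous])
     (auto simp: eta_nonzero)

lemma eta_quot_nonzero: "k \<ge> 1 \<Longrightarrow> Im z > 0 \<Longrightarrow> eta_quot k s z \<noteq> 0"
  by (simp add: eta_quot_def eta_nonzero)

lemma transforms_eta_quot_EL: "transforms (eta_quot 5 1) 2 EL (-1)"
proof -
  define g where "g z = eta_quot 5 1 (act EL z) / (aut EL z ^ 2 * eta_quot 5 1 z)" for z
  have EL: "mdet EL = 1" "mdet (M2 2 (-5) 1 (-2)) = 1" by (simp_all add: EL_def)
  have up: "Im (act EL z) > 0" "aut EL z \<noteq> 0" if "Im z > 0" for z
    using act_uhp[of EL z] aut_nonzero[of EL z] EL that by simp_all
  have g24: "g z ^ 24 = 1" if z: "Im z > 0" for z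
  proof -
    have z5: "Im (5 * z) > 0" using z by simp
    have a: "(eta (act EL z))\<^sup>2 = ee (of_int (eta2_exponent EL) / 12) * aut EL z * (eta z)\<^sup>2"
      using transforms_eta_square[OF EL(1)] z by (simp add: transforms_def)
    have b: "(eta (5 * act EL z))\<^sup>2 =
        ee (of_int (eta2_exponent (M2 2 (-5) 1 (-2))) / 12) * aut EL z * (eta (5 * z))\<^sup>2"
    proof -
      have "(eta (act (M2 2 (-5) 1 (-2)) (5 * z)))\<^sup>2 =
        ee (of_int (eta2_exponent (M2 2 (-5) 1 (-2))) / 12) * aut (M2 2 (-5) 1 (-2)) (5 * z) * (eta (5 * z))\<^sup>2"
        using transforms_eta_square[OF EL(2)] z5 unfolding transforms_def power_one_right by blast
      moreover have "act (M2 2 (-5) 1 (-2)) (5 * z) = 5 * act EL z" "aut (M2 2 (-5) 1 (-2)) (5 * z) = aut EL z"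
        by (simp_all add: EL_def algebra_simps)
      ultimately show ?thesis by simp
    qed
    have pw: "ee (of_int x / 12) ^ 12 = 1" for x by (simp add: ee_power ee_int)
    have "(eta (act EL z)) ^ 24 = aut EL z ^ 12 * eta z ^ 24"
      using arg_cong[OF a, of "\<lambda>x. x ^ 12"] by (simp add: power_mult_distrib pw flip: power_mult)
    moreover have "(eta (5 * act EL z)) ^ 24 = aut EL z ^ 12 * eta (5 * z) ^ 24"
      using arg_cong[OF b, of "\<lambda>x. x ^ 12"] by (simp add: power_mult_distrib pw del: eta2_exponent.simps flip: power_mult)
    moreover have e24: "eta_quot 5 1 y ^ 24 = (eta y ^ 24) ^ 5 / eta (5 * y) ^ 24" for y
      by (simp add: eta_quot_def power_divide flip: power_mult)
    ultimately have "eta_quot 5 1 (act EL z) ^ 24 =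
        (aut EL z ^ 12 * eta z ^ 24) ^ 5 / (aut EL z ^ 12 * eta (5 * z) ^ 24)"
      by (simp only: e24)
    also have "\<dots> = aut EL z ^ 48 * eta_quot 5 1 z ^ 24"
    proof -
      have "(A ^ 12 * E) ^ 5 / (A ^ 12 * F) = A ^ 48 * (E ^ 5 / F)" if "A \<noteq> 0" for A E F :: complex
      proof -
        have "(A ^ 12 * E) ^ 5 = A ^ 12 * (A ^ 48 * E ^ 5)"
          by (simp add: power_mult_distrib flip: power_mult power_add mult.assoc)
        moreover have "A ^ 12 \<noteq> 0" using that by simp
        ultimately show ?thesis
          by (metis mult_divide_mult_cancel_left times_divide_eq_right)
      qed
      then show ?thesis using up[OF z] unfolding e24 by blast
    qed
    finally show ?thesis
      using up[OF z] eta_quot_nonzero[of 5 z 1] z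
      by (simp add: g_def power_divide power_mult_distrib flip: power_mult)
  qed
  have cont: "continuous_on uhp g"
  proof -
    have "continuous_on uhp (act EL)"
      using up(2) by (auto simp: EL_def intro!: continuous_intros)
    moreover have "continuous_on uhp (aut EL)" by (auto simp: EL_def intro!: continuous_intros)
    ultimately show ?thesis unfolding g_def
      by (intro continuous_intros continuous_on_compose2[OF eta_quot_continuous] eta_quot_continuous)
         (use up eta_quot_nonzero in auto)
  qed
  define z0 :: complex where "z0 = (2 + \<i>) / 5"
  have z0: "Im z0 > 0" by (simp add: z0_def)
  have "act EL z0 = z0" "aut EL z0 = \<i>"
    by (simp_all add: EL_def z0_def complex_eq_iff Re_divide Im_divide power2_eq_square)
  then have "g z0 = -1" using eta_quot_nonzero[of 5 z0 1] z0 by (simp add: g_def)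
  then have g: "g z = -1" if "Im z > 0" for z
    using root_of_unity_constant[of g 24 z z0, OF cont g24 _ that z0] by simp
  show ?thesis
    unfolding transforms_def
  proof (intro allI impI)
    fix z :: complex assume z: "Im z > 0"
    show "eta_quot 5 1 (act EL z) = -1 * aut EL z ^ 2 * eta_quot 5 1 z"
      using g[OF z] up[OF z] eta_quot_nonzero[of 5 z 1] z by (simp add: g_def field_simps)
  qed
qed

lemma transforms_eta_quot:
  assumes ks: "(k = 3 \<and> s = 3 \<and> w = 3) \<or> (k = 5 \<and> s = 1 \<and> w = 2)"
    and g: "mdet (M2 a b c d) = 1" "int k dvd c"
  shows "transforms (eta_quot k s) w (M2 a b c d) (levelchar k d)"
proof -
  define ch where "ch = (\<lambda>\<gamma>. case \<gamma> of M2 a b c d \<Rightarrow> levelchar k d)"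
  have k1: "k \<ge> 1" "s * (k\<^sup>2 - 1) = 24" "2 * w = s * (k - 1)" using ks by auto
  have "transforms (eta_quot k s) w (M2 a b c d) (ch (M2 a b c d))"
  proof (rule transforms_Gamma0[where k = "int k" and t = 1 and v = 1 and n = "(-1) ^ w" and e = "-1"])
    show "transforms (eta_quot k s) w (TT 1) 1" by (rule transforms_eta_quot_TT[OF k1(1)])
    show "transforms (eta_quot k s) w (VV (int k)) 1" by (rule transforms_eta_quot_VV[OF k1])
    show "transforms (eta_quot k s) w NEG ((-1) ^ w)"
      by (simp add: transforms_def NEG_def flip: power_mult_distrib)
    show "transforms (eta_quot k s) w EL (-1)" if "int k = 5"
      using ks that transforms_eta_quot_EL by auto
    fix \<gamma> assume \<gamma>: "mdet \<gamma> = 1" "int k dvd lowleft \<gamma>"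
    obtain a b c d where abcd: "\<gamma> = M2 a b c d" by (cases \<gamma>)
    obtain c' where c: "c = int k * c'" using \<gamma> abcd by (auto elim!: dvdE)
    have det: "a * d - b * c = 1" using \<gamma> abcd by simp
    have "levelchar k (c + d) = levelchar k d" using ks c by (auto simp: levelchar_def)
    then show "ch (\<gamma> * TT 1) = ch \<gamma> * 1" by (simp add: abcd ch_def TT_def)
    show "ch (\<gamma> * VV (int k)) = ch \<gamma> * 1" by (simp add: abcd ch_def VV_def)
    have nd: "\<not> int k dvd d"
    proof
      assume "int k dvd d"
      then have "int k dvd a * d - b * c" using c by (intro dvd_diff dvd_mult) auto
      then show False using ks det by auto
    qed
    have mod5: "d mod 5 = 1 \<and> (-d) mod 5 = 4 \<and> (- c - d * 2) mod 5 = 3 \<or>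
        d mod 5 = 2 \<and> (-d) mod 5 = 3 \<and> (- c - d * 2) mod 5 = 1 \<or>
        d mod 5 = 3 \<and> (-d) mod 5 = 2 \<and> (- c - d * 2) mod 5 = 4 \<or>
        d mod 5 = 4 \<and> (-d) mod 5 = 1 \<and> (- c - d * 2) mod 5 = 2" if "k = 5"
    proof -
      have c5: "c = 5 * c'" using c that by simp
      have r: "d mod 5 = 1 \<or> d mod 5 = 2 \<or> d mod 5 = 3 \<or> d mod 5 = 4"
        using nd that by (simp, presburger)
      define e r where "e = d div 5" and "r = d mod 5"
      have d: "d = 5 * e + r" by (simp add: e_def r_def)
      have n: "(- d) mod 5 = (- r) mod 5" "(- c - d * 2) mod 5 = (- (r * 2)) mod 5"
        unfolding d c5 by (simp_all add: mod_eq_dvd_iff algebra_simps)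
      show ?thesis using r unfolding n r_def[symmetric] by auto
    qed
    have "levelchar k (- d) = levelchar k d * (-1) ^ w"
      using ks
    proof
      assume "k = 3 \<and> s = 3 \<and> w = 3"
      moreover from this nd have "d mod 3 = 1 \<and> (-d) mod 3 = 2 \<or> d mod 3 = 2 \<and> (-d) mod 3 = 1"
        by presburger
      ultimately show ?thesis by (auto simp: levelchar_def)
    next
      assume "k = 5 \<and> s = 1 \<and> w = 2"
      moreover from this have "d mod 5 = 1 \<and> (-d) mod 5 = 4 \<or> d mod 5 = 2 \<and> (-d) mod 5 = 3 \<or>
          d mod 5 = 3 \<and> (-d) mod 5 = 2 \<or> d mod 5 = 4 \<and> (-d) mod 5 = 1"
        using mod5 by auto
      ultimately show ?thesis by (auto simp: levelchar_def)
    qed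
    then show "ch (\<gamma> * NEG) = ch \<gamma> * (-1) ^ w" by (simp add: abcd ch_def NEG_def)
    show "ch (\<gamma> * EL) = ch \<gamma> * (-1)" if k5: "int k = 5"
    proof -
      have "levelchar 5 (- c - d * 2) = - levelchar 5 d"
        using mod5 k5 by (auto simp: levelchar_def)
      then show ?thesis using k5 by (simp add: abcd ch_def EL_def)
    qed
  qed (use ks g in \<open>auto simp: ch_def one_mat2_def levelchar_def\<close>)
  then show ?thesis by (simp add: ch_def)
qed

text \<open>
  Since \<open>k\<close> and \<open>s\<close> are odd, \<open>\<eta>(z)\<eta>(kz)\<close> is the product of \<open>\<eta>(z)\<^sup>k\<^sup>s/\<eta>(kz)\<^sup>s\<close> with even powers of both
  eta functions. This settles its sign, which the squares alone leave undetermined.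
\<close>

lemma eta_eta_scaled_principal:
  assumes k: "k = 3 \<or> k = 5" and g: "mdet (M2 a b c d) = 1" "12 * int k dvd b" "12 * int k dvd c"
    "12 * int k dvd d - 1" and z: "Im z > 0"
  shows "eta (act (M2 a b c d) z) * eta (of_nat k * act (M2 a b c d) z) =
           aut (M2 a b c d) z * (eta z * eta (of_nat k * z))"
proof -
  define \<gamma> where "\<gamma> = M2 a b c d"
  define s w :: nat where "s = (if k = 3 then 3 else 1)" and "w = (if k = 3 then 3 else 2)"
  have ks: "(k = 3 \<and> s = 3 \<and> w = 3) \<or> (k = 5 \<and> s = 1 \<and> w = 2)" using k by (auto simp: s_def w_def)
  obtain u p :: nat where u: "s + 1 = 2 * u" "k * s - 1 = 2 * p" "p = w + u - 1" "u \<ge> 1" "k * s = 2 * p + 1"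
    using ks that[of 2 4] that[of 1 2] by auto
  have d: "12 dvd b" "12 dvd c" "int k dvd c" using g by (meson dvd_mult_left dvd_mult_right)+
  have one: "sgn4 d = 1" "levelchar k d = 1"
  proof -
    obtain e where e: "d = 1 + 12 * int k * e"
      using g(4) by (metis dvdE add.commute diff_add_cancel)
    have "(1 + 4 * (3 * int k * e)) mod 4 = 1" by (subst mod_mult_self2) simp
    moreover have "d = 1 + 4 * (3 * int k * e)" using e by simp
    ultimately have "d mod 4 = 1" by simp
    moreover have "(1 + int k * (12 * e)) mod int k = 1 mod int k" by (rule mod_mult_self2)
    then have "d mod int k = 1 mod int k" using e by (simp add: mult_ac)
    ultimately have "d mod 4 = 1 \<and> (if k = 3 then d mod 3 = 1 else d mod 5 = 1)"
      using k by auto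
    then show "sgn4 d = 1" "levelchar k d = 1"
      unfolding sgn4_def levelchar_def by (auto split: if_splits)
  qed
  have up: "Im (act \<gamma> z) > 0" "aut \<gamma> z \<noteq> 0"
    using act_uhp[of \<gamma> z] aut_nonzero[of \<gamma> z] g z by (simp_all add: \<gamma>_def)
  have kp: "k > 0" using k by auto
  have split: "eta y * eta (of_nat k * y) = eta_quot k s y * ((eta (of_nat k * y))\<^sup>2) ^ u / ((eta y)\<^sup>2) ^ p"
    if y: "Im y > 0" for y
  proof -
    have nz: "eta y \<noteq> 0" "eta (of_nat k * y) \<noteq> 0" using y kp by (simp_all add: eta_nonzero)
    have "eta y ^ (k * s) = eta y * ((eta y)\<^sup>2) ^ p" by (simp add: u(5) power_mult)
    moreover have "((eta (of_nat k * y))\<^sup>2) ^ u = eta (of_nat k * y) * eta (of_nat k * y) ^ s"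
      by (simp add: u(1)[symmetric] flip: power_mult power_Suc)
    ultimately show ?thesis using nz by (simp add: eta_quot_def)
  qed
  have 1: "(eta (act \<gamma> z))\<^sup>2 = aut \<gamma> z * (eta z)\<^sup>2"
    using eta_square_diag[OF g(1) d(1,2) z] one by (simp add: \<gamma>_def)
  have 2: "(eta (of_nat k * act \<gamma> z))\<^sup>2 = aut \<gamma> z * (eta (of_nat k * z))\<^sup>2"
    using eta_scaled_square_diag[OF g(1) d(1) g(3) kp z] one by (simp add: \<gamma>_def)
  have 3: "eta_quot k s (act \<gamma> z) = aut \<gamma> z ^ w * eta_quot k s z"
    using transforms_eta_quot[OF ks g(1) d(3)] one z by (simp add: \<gamma>_def transforms_def)
  have Ap: "aut \<gamma> z ^ w * aut \<gamma> z ^ u = aut \<gamma> z * aut \<gamma> z ^ p"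
    using u by (simp flip: power_add power_Suc)
  have "aut \<gamma> z ^ w * Q * (aut \<gamma> z * H) ^ u / (aut \<gamma> z * E) ^ p = aut \<gamma> z * (Q * H ^ u / E ^ p)"
    for Q H E
  proof -
    have "aut \<gamma> z ^ w * Q * (aut \<gamma> z * H) ^ u = (aut \<gamma> z ^ w * aut \<gamma> z ^ u) * (Q * H ^ u)"
      by (simp add: power_mult_distrib mult_ac)
    also have "\<dots> = aut \<gamma> z ^ p * (aut \<gamma> z * (Q * H ^ u))"
      unfolding Ap by (simp only: mult_ac)
    finally have "aut \<gamma> z ^ w * Q * (aut \<gamma> z * H) ^ u / (aut \<gamma> z * E) ^ p =
        aut \<gamma> z * (Q * H ^ u) / E ^ p"
      using up(2) by (simp only: power_mult_distrib mult_divide_mult_cancel_left power_eq_0_iff simp_thms)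
    then show ?thesis by simp
  qed
  then show ?thesis
    unfolding \<gamma>_def[symmetric] split[OF up(1)] 1 2 3 split[OF z] .
qed

section \<open>Modular forms for principal congruence subgroups\<close>

text \<open>
  There is no power of the determinant in this normalisation. The value \<open>0\<close> off the half-plane makes invariance an
  equation between functions; a form \<open>f\<close> itself, which is arbitrary there, is represented by \<open>slash w f 1\<close>.
\<close>

definition slash :: "nat \<Rightarrow> (complex \<Rightarrow> complex) \<Rightarrow> mat2 \<Rightarrow> complex \<Rightarrow> complex" where
  "slash w f M z = (if Im z > 0 then f (act M z) / aut M z ^ w else 0)"

lemma slash_mult:
  assumes "mdet A > 0" "mdet B > 0"
  shows "slash w (slash w f A) B = slash w f (A * B)"
proof
  fix z
  show "slash w (slash w f A) B z = slash w f (A * B) z"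
    using assms act_uhp[of B z]
    by (cases "Im z > 0") (simp_all add: slash_def act_mult aut_mult power_mult_distrib)
qed

lemma slash_1: "Im z > 0 \<Longrightarrow> slash w f 1 z = f z"
  by (simp add: slash_def)

lemma slash_slash_1: "mdet A > 0 \<Longrightarrow> slash w (slash w f 1) A = slash w f A"
  by (subst slash_mult) simp_all

lemma act_holomorphic: "mdet A > 0 \<Longrightarrow> act A holomorphic_on uhp"
  and aut_holomorphic: "aut A holomorphic_on uhp"
proof -
  obtain a b c d where A: "A = M2 a b c d" by (cases A)
  have act: "act A = (\<lambda>z. (of_int a * z + of_int b) / aut A z)" and aut: "aut A = (\<lambda>z. of_int c * z + of_int d)"
    by (auto simp: A)
  show 1: "aut A holomorphic_on uhp" unfolding aut by (intro holomorphic_intros)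
  show "act A holomorphic_on uhp" if "mdet A > 0"
    unfolding act by (intro holomorphic_intros 1) (use aut_nonzero that in auto)
qed

lemma slash_holomorphic:
  assumes "f holomorphic_on uhp" "mdet A > 0"
  shows "slash w f A holomorphic_on uhp"
proof -
  have "(f \<circ> act A) holomorphic_on uhp"
    by (rule holomorphic_on_compose_gen[OF act_holomorphic[OF assms(2)] assms(1)])
       (use act_uhp assms in auto)
  then have "(\<lambda>z. f (act A z) / aut A z ^ w) holomorphic_on uhp"
    by (intro holomorphic_intros aut_holomorphic) (use aut_nonzero assms in \<open>auto simp: o_def\<close>)
  then show ?thesis by (rule holomorphic_transform) (simp add: slash_def)
qed

fun Gamma_N :: "int \<Rightarrow> mat2 \<Rightarrow> bool" where
  "Gamma_N N (M2 a b c d) \<longleftrightarrow> a*d - b*c = 1 \<and> N dvd a - 1 \<and> N dvd b \<and> N dvd c \<and> N dvd d - 1"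

lemma Gamma_N_det: "Gamma_N N A \<Longrightarrow> mdet A = 1" by (cases A) simp

text \<open>
  Holomorphy at the cusps is the requirement that all conjugates are bounded away from the real line;
  in this form it passes to products, sums and Hecke operators without any reference to expansions.
\<close>

definition modform :: "nat \<Rightarrow> int \<Rightarrow> (complex \<Rightarrow> complex) \<Rightarrow> bool" where
  "modform w N f \<longleftrightarrow> f holomorphic_on uhp \<and>
     (\<forall>\<gamma>. Gamma_N N \<gamma> \<longrightarrow> slash w f \<gamma> = slash w f 1) \<and>
     (\<forall>\<gamma> c. mdet \<gamma> = 1 \<longrightarrow> c > 0 \<longrightarrow> (\<exists>C. \<forall>z. Im z \<ge> c \<longrightarrow> norm (slash w f \<gamma> z) \<le> C))"

text \<open>
  An upper triangular matrix scales the imaginary part by a fixed factor, so the bounds on all half-planes \<open>Im z \<ge> c\<close> extend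
  from the modular group to every matrix of positive determinant.
\<close>

lemma modform_bounded:
  assumes "modform w N f" "mdet M > 0" "c > 0"
  shows "\<exists>C. \<forall>z. Im z \<ge> c \<longrightarrow> norm (slash w f M z) \<le> C"
proof -
  obtain \<gamma> A B D where M: "mdet \<gamma> = 1" "M = \<gamma> * M2 A B 0 D" "A > 0" "D > 0"
    using hermite_decomposition[OF assms(2)] by metis
  define U where "U = M2 A B 0 D"
  have U: "mdet U > 0" using M by (simp add: U_def)
  have pos: "real_of_int A / real_of_int D > 0" using M by simp
  then have c': "c * (real_of_int A / real_of_int D) > 0" using assms(3) by (rule mult_pos_pos[rotated])
  obtain C where C: "\<And>z. Im z \<ge> c * (A / D) \<Longrightarrow> norm (slash w f \<gamma> z) \<le> C"
    using assms(1) M(1) c' unfolding modform_def by metis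
  have "norm (slash w f M z) \<le> C / real_of_int D ^ w" if z: "Im z \<ge> c" for z
  proof -
    have "Im z > 0" using z assms by linarith
    have "slash w f M z = slash w (slash w f \<gamma>) U z" using slash_mult[of \<gamma> U] M U by (simp add: U_def)
    also have "\<dots> = slash w f \<gamma> (act U z) / of_int D ^ w"
      using \<open>Im z > 0\<close> by (simp add: slash_def[of _ "slash w f \<gamma>"] U_def)
    finally have eq: "norm (slash w f M z) = norm (slash w f \<gamma> (act U z)) / real_of_int D ^ w"
      using M by (simp add: norm_divide norm_power)
    have "Im (act U z) = Im z * (A / D)"
      using M by (simp add: U_def Im_divide power2_eq_square field_simps)
    then have "Im (act U z) \<ge> c * (A / D)" using z pos by (simp only: mult_right_mono less_imp_le)
    then show ?thesis unfolding eq using C M by (intro divide_right_mono) auto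
  qed
  then show ?thesis by blast
qed

lemma slash_add: "slash w (\<lambda>z. f z + g z) A = (\<lambda>z. slash w f A z + slash w g A z)"
  and slash_cmult: "slash w (\<lambda>z. r * f z) A = (\<lambda>z. r * slash w f A z)"
  by (auto simp: slash_def add_divide_distrib)

lemma modform_add:
  assumes f: "modform w N f" and g: "modform w N g"
  shows "modform w N (\<lambda>z. f z + g z)"
  unfolding modform_def slash_add
proof (intro conjI allI impI)
  show "(\<lambda>z. f z + g z) holomorphic_on uhp"
    using assms by (intro holomorphic_intros) (auto simp: modform_def)
  show "(\<lambda>z. slash w f \<gamma> z + slash w g \<gamma> z) = (\<lambda>z. slash w f 1 z + slash w g 1 z)"
    if "Gamma_N N \<gamma>" for \<gamma>
    using assms that by (simp add: modform_def)
  fix \<gamma> :: mat2 and c :: real assume *: "mdet \<gamma> = 1" "c > 0"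
  obtain C where C: "\<And>z. Im z \<ge> c \<Longrightarrow> norm (slash w f \<gamma> z) \<le> C"
    using f * unfolding modform_def by metis
  obtain D where D: "\<And>z. Im z \<ge> c \<Longrightarrow> norm (slash w g \<gamma> z) \<le> D"
    using g * unfolding modform_def by metis
  show "\<exists>C. \<forall>z. Im z \<ge> c \<longrightarrow> norm (slash w f \<gamma> z + slash w g \<gamma> z) \<le> C"
    using C D by (intro exI[of _ "C + D"] allI impI order.trans[OF norm_triangle_ineq] add_mono) auto
qed

lemma modform_cmult:
  assumes f: "modform w N f"
  shows "modform w N (\<lambda>z. r * f z)"
  unfolding modform_def slash_cmult
proof (intro conjI allI impI)
  show "(\<lambda>z. r * f z) holomorphic_on uhp"
    using assms by (intro holomorphic_intros) (auto simp: modform_def)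
  show "(\<lambda>z. r * slash w f \<gamma> z) = (\<lambda>z. r * slash w f 1 z)" if "Gamma_N N \<gamma>" for \<gamma>
    using assms that by (simp add: modform_def)
  fix \<gamma> :: mat2 and c :: real assume *: "mdet \<gamma> = 1" "c > 0"
  obtain C where C: "\<And>z. Im z \<ge> c \<Longrightarrow> norm (slash w f \<gamma> z) \<le> C"
    using f * unfolding modform_def by metis
  show "\<exists>C. \<forall>z. Im z \<ge> c \<longrightarrow> norm (r * slash w f \<gamma> z) \<le> C"
    using C by (intro exI[of _ "norm r * C"]) (auto simp: norm_mult intro!: mult_left_mono)
qed

lemma modform_cong:
  assumes f: "modform w N f" and eq: "\<And>z. Im z > 0 \<Longrightarrow> f z = g z"
  shows "modform w N g"
proof -
  have "slash w g A = slash w f A" if "mdet A > 0" for A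
    using eq act_uhp that by (auto simp: slash_def fun_eq_iff)
  then have "slash w g A = slash w f A" if "mdet A = 1" for A using that by simp
  moreover have "g holomorphic_on uhp"
    using f eq by (auto simp: modform_def intro: holomorphic_transform)
  moreover from calculation(1)[of 1] have "slash w g 1 = slash w f 1" by simp
  ultimately show ?thesis using f unfolding modform_def by (simp add: Gamma_N_det)
qed

subsection \<open>Reduction theory\<close>

text \<open>
  Dirichlet's approximation theorem for \<open>Re z\<close> yields a bottom row \<open>(k, -h)\<close> with \<open>|kz - h|\<^sup>2 \<le> 4 Im z\<close>.
\<close>

lemma reduction_to_quarter:
  assumes z: "Im z > 0"
  shows "\<exists>\<gamma>. mdet \<gamma> = 1 \<and> Im (act \<gamma> z) \<ge> 1/4"
proof (cases "Im z \<ge> 1/4")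
  case True then show ?thesis by (intro exI[of _ 1]) simp
next
  case False
  define y where "y = Im z"
  have y: "0 < y" "y < 1/4" using z False by (auto simp: y_def)
  define s where "s = 1 / sqrt y"
  have s: "s\<^sup>2 = 1 / y" "s > 1" using y by (simp_all add: s_def power_divide)
  define n where "n = nat \<lceil>s\<rceil>"
  have n: "real n \<ge> s" "real n < s + 1" "n > 0" using s by (auto simp: n_def) linarith+
  obtain h k where hk: "coprime h k" "0 < k" "k \<le> int n" "\<bar>of_int k * Re z - of_int h\<bar> < 1 / n"
    using Dirichlet_approx_coprime[OF n(3)] by metis
  obtain a b where ab: "a * h + b * k = 1" using bezout_int[of h k] hk(1) by auto
  define \<gamma> where "\<gamma> = M2 (-a) (-b) k (-h)"
  have det: "mdet \<gamma> = 1" using ab by (simp add: \<gamma>_def algebra_simps)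
  have "norm (aut \<gamma> z) ^ 2 = (of_int k * Re z - of_int h)\<^sup>2 + (of_int k * y)\<^sup>2"
    by (simp add: \<gamma>_def cmod_power2 y_def)
  also have "(of_int k * Re z - of_int h)\<^sup>2 \<le> y"
  proof -
    have "1 / real n \<le> 1 / s" using n s by (simp add: field_simps)
    then have "\<bar>of_int k * Re z - of_int h\<bar> \<le> sqrt y" using hk(4) by (simp add: s_def)
    then have "\<bar>of_int k * Re z - of_int h\<bar>\<^sup>2 \<le> (sqrt y)\<^sup>2" by (intro power_mono) auto
    then show ?thesis using y by simp
  qed
  also have "(of_int k * y)\<^sup>2 \<le> 3 * y"
  proof -
    have sy: "sqrt y < 1/2" using y real_sqrt_less_mono[of y "1/4"] by (simp add: real_sqrt_divide)
    have "of_int k * y \<le> (s + 1) * y" using hk(3) n y by (intro mult_right_mono) linarith+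
    also have "(s + 1) * y = (1 + sqrt y) * sqrt y"
      using y by (simp add: s_def field_simps flip: real_sqrt_mult)
    also have "\<dots> \<le> (3/2) * sqrt y" using sy y by (intro mult_right_mono) auto
    finally have "(of_int k * y)\<^sup>2 \<le> ((3/2) * sqrt y)\<^sup>2" using hk y by (intro power_mono) auto
    also have "\<dots> = 9/4 * y" using y by (simp add: power_mult_distrib power2_eq_square)
    finally show ?thesis using y by simp
  qed
  finally have le: "norm (aut \<gamma> z) ^ 2 \<le> 4 * y" by simp
  have "norm (aut \<gamma> z) ^ 2 > 0" using aut_nonzero[of \<gamma> z] det z by simp
  moreover have "norm (aut \<gamma> z) ^ 2 * 1 \<le> norm (aut \<gamma> z) ^ 2 * (4 * Im (act \<gamma> z))"
    using le Im_act[of \<gamma> z] det z aut_nonzero[of \<gamma> z] by (simp add: y_def)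
  ultimately have "1 \<le> 4 * Im (act \<gamma> z)" by (simp only: mult_le_cancel_left_pos)
  then have "Im (act \<gamma> z) \<ge> 1/4" by simp
  then show ?thesis using det by blast
qed

text \<open>A periodic function with exponential decay attains its maximum on a half-plane.\<close>

lemma periodic_decay_attains_max:
  fixes \<psi> :: "complex \<Rightarrow> real"
  assumes cont: "continuous_on {z. Im z \<ge> c} \<psi>" and per: "\<And>z. Im z \<ge> c \<Longrightarrow> \<psi> (z + 1) = \<psi> z"
    and decay: "\<And>z. Im z \<ge> c \<Longrightarrow> \<psi> z \<le> C * exp (- Im z)" and pos: "Im z1 \<ge> c" "\<psi> z1 > 0" and c: "c > 0"
  shows "\<exists>z0. Im z0 \<ge> c \<and> (\<forall>z. Im z \<ge> c \<longrightarrow> \<psi> z \<le> \<psi> z0)"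
proof -
  have perN: "\<psi> (z + of_nat n) = \<psi> z" if "Im z \<ge> c" for z n
  proof (induction n)
    case (Suc n)
    have "\<psi> (z + of_nat (Suc n)) = \<psi> ((z + of_nat n) + 1)" by (simp add: add_ac)
    also have "\<dots> = \<psi> z" using per[of "z + of_nat n"] Suc that by simp
    finally show ?case .
  qed simp
  have per_int: "\<psi> (z + of_int n) = \<psi> z" if "Im z \<ge> c" for z n
    using perN[of z "nat n"] perN[of "z + of_int n" "nat (-n)"] that by (cases "n \<ge> 0") auto
  have C0: "C > 0"
  proof -
    have "0 < C * exp (- Im z1)" using decay[OF pos(1)] pos(2) by linarith
    then show ?thesis by (simp add: zero_less_mult_iff)
  qed
  define Y where "Y = max (Im z1) (C / \<psi> z1)"
  have high: "\<psi> z < \<psi> z1" if "Im z > Y" for z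
  proof -
    have zc: "Im z \<ge> c" using that pos by (auto simp: Y_def)
    have "C / \<psi> z1 < Im z" using that by (simp add: Y_def)
    also have "Im z < exp (Im z)" using exp_ge_add_one_self[of "Im z"] by linarith
    finally have "C * exp (- Im z) < \<psi> z1"
      using pos(2) by (simp add: exp_minus field_simps)
    then show ?thesis using decay[OF zc] by linarith
  qed
  define K where "K = cbox (Complex 0 c) (Complex 1 Y)"
  have K: "z \<in> K \<longleftrightarrow> 0 \<le> Re z \<and> Re z \<le> 1 \<and> c \<le> Im z \<and> Im z \<le> Y" for z
    by (auto simp: K_def in_cbox_complex_iff)
  have shift: "\<exists>w\<in>K. \<psi> w = \<psi> z" if "Im z \<ge> c" "Im z \<le> Y" for z
  proof
    show "z + of_int (- \<lfloor>Re z\<rfloor>) \<in> K" using that unfolding K by simp linarith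
    show "\<psi> (z + of_int (- \<lfloor>Re z\<rfloor>)) = \<psi> z" by (rule per_int[OF that(1)])
  qed
  have z1: "\<exists>w\<in>K. \<psi> w = \<psi> z1" by (rule shift) (use pos in \<open>auto simp: Y_def\<close>)
  have "continuous_on K \<psi>" by (rule continuous_on_subset[OF cont]) (auto simp: K)
  then obtain z0 where z0: "z0 \<in> K" "\<And>w. w \<in> K \<Longrightarrow> \<psi> w \<le> \<psi> z0"
    using continuous_attains_sup[of K \<psi>] z1 by (auto simp: K_def)
  have "\<psi> z \<le> \<psi> z0" if "Im z \<ge> c" for z
  proof (cases "Im z \<le> Y")
    case True then show ?thesis using shift[OF that True] z0 by metis
  next
    case False
    then have "\<psi> z < \<psi> z1" using high by simp
    also have "\<psi> z1 \<le> \<psi> z0" using z1 z0 by metis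
    finally show ?thesis by simp
  qed
  then show ?thesis using z0(1) by (auto simp: K)
qed

text \<open>
  The argument is due to Siegel. If \<open>F\<close> does not vanish, the invariant function \<open>|F|\<^sup>2 y\<^sup>K\<close> has a maximum \<open>z\<^sub>0\<close>, and its height can be taken
  at least \<open>1/4\<close>. Comparing \<open>F(z) exp(-2\<pi>iKz)\<close> at height \<open>Im z\<^sub>0\<close> and at half this height by the maximum
  principle gives \<open>exp(4\<pi>y) \<le> 2\<close> for the half height \<open>y\<close>, which is impossible for \<open>y \<ge> 1/8\<close>.
\<close>

lemma level_one_vanishing:
  assumes F: "F holomorphic_on uhp" and K: "K \<ge> 1"
    and inv: "\<And>\<gamma> z. mdet \<gamma> = 1 \<Longrightarrow> Im z > 0 \<Longrightarrow> norm (F (act \<gamma> z)) = norm (aut \<gamma> z) ^ K * norm (F z)"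
    and decay: "\<And>c. c > 0 \<Longrightarrow> \<exists>C. \<forall>z. Im z \<ge> c \<longrightarrow> norm (F z) \<le> C * exp (- 2 * pi * (real K + 1) * Im z)"
    and z: "Im z > 0"
  shows "F z = 0"
proof (rule ccontr)
  assume nz: "F z \<noteq> 0"
  define \<psi> where "\<psi> z = norm (F z) ^ 2 * Im z ^ K" for z
  have \<psi>_inv: "\<psi> (act \<gamma> z) = \<psi> z" if "mdet \<gamma> = 1" "Im z > 0" for \<gamma> z
  proof -
    have "norm (aut \<gamma> z) \<noteq> 0" using aut_nonzero[of \<gamma> z] that by simp
    moreover have "\<psi> (act \<gamma> z) = (norm (aut \<gamma> z) ^ K * norm (F z)) ^ 2 * (Im z / (norm (aut \<gamma> z))\<^sup>2) ^ K"
      using that inv[OF that] Im_act[of \<gamma> z] by (simp add: \<psi>_def)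
    ultimately show ?thesis
      by (simp add: \<psi>_def power_mult_distrib power_divide mult.commute flip: power_mult)
  qed
  have T: "mdet (TT 1) = 1" "act (TT 1) y = y + 1" "aut (TT 1) y = 1" for y by (simp_all add: TT_def)
  have per: "norm (F (y + 1)) = norm (F y)" if "Im y > 0" for y
    using inv[OF T(1) that] T by simp
  have Fcont: "continuous_on S F" if "S \<subseteq> uhp" for S
    using holomorphic_on_imp_continuous_on[OF holomorphic_on_subset[OF F that]] .
  have exp_le: "exp (- 2 * pi * (real K + 1) * y) * exp (2 * pi * real K * y) \<le> exp (-y)" if "y \<ge> 0" for y
  proof -
    have "exp (- 2 * pi * (real K + 1) * y) * exp (2 * pi * real K * y) = exp (- (2 * pi * y))"
      by (simp add: exp_add[symmetric] algebra_simps)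
    also have "\<dots> \<le> exp (-y)" using that pi_gt3 by (simp add: mult_right_mono[of 1 "2*pi" y, simplified])
    finally show ?thesis .
  qed
  obtain z1 where z1: "Im z1 \<ge> 1/4" "\<psi> z1 > 0"
  proof -
    obtain \<gamma> where "mdet \<gamma> = 1" "Im (act \<gamma> z) \<ge> 1/4" using reduction_to_quarter[OF z] by blast
    moreover have "\<psi> z > 0" using nz z by (simp add: \<psi>_def)
    ultimately show ?thesis using that \<psi>_inv z by metis
  qed
  have "\<exists>z0. Im z0 \<ge> 1/4 \<and> (\<forall>z. Im z \<ge> 1/4 \<longrightarrow> \<psi> z \<le> \<psi> z0)"
  proof -
    obtain C where C: "\<And>z. Im z \<ge> 1/4 \<Longrightarrow> norm (F z) \<le> C * exp (- 2 * pi * (real K + 1) * Im z)"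
      using decay[of "1/4"] by auto
    show ?thesis
    proof (rule periodic_decay_attains_max[where c = "1/4" and \<psi> = \<psi> and ?z1.0 = z1 and C = "C ^ 2"])
      show "continuous_on {z. Im z \<ge> 1/4} \<psi>"
        unfolding \<psi>_def by (intro continuous_intros Fcont) auto
      show "\<psi> (y + 1) = \<psi> y" if "Im y \<ge> 1/4" for y using per[of y] that by (simp add: \<psi>_def)
      fix y assume y: "Im y \<ge> 1/4"
      define e where "e = exp (- 2 * pi * (real K + 1) * Im y)"
      have "norm (F y) ^ 2 \<le> (C * e) ^ 2" using C[OF y] by (intro power_mono) (auto simp: e_def)
      moreover have "Im y ^ K \<le> exp (2 * pi * real K * Im y)"
      proof -
        have "Im y \<le> exp (Im y)" using exp_ge_add_one_self[of "Im y"] by linarith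
        then have "Im y ^ K \<le> exp (Im y) ^ K" using y by (intro power_mono) auto
        also have "\<dots> = exp (real K * Im y)" by (simp add: exp_of_nat_mult)
        also have "\<dots> \<le> exp (2 * pi * real K * Im y)"
        proof -
          have "1 * (real K * Im y) \<le> (2 * pi) * (real K * Im y)"
            using y pi_gt3 by (intro mult_right_mono) auto
          then show ?thesis by (simp add: mult_ac)
        qed
        finally show ?thesis .
      qed
      ultimately have "\<psi> y \<le> (C * e) ^ 2 * exp (2 * pi * real K * Im y)"
        unfolding \<psi>_def using y by (intro mult_mono) auto
      also have "\<dots> = C ^ 2 * e * (e * exp (2 * pi * real K * Im y))"
        by (simp add: power2_eq_square mult_ac)
      also have "\<dots> \<le> C ^ 2 * 1 * exp (- Im y)"
        using exp_le[of "Im y"] y by (intro mult_mono) (auto simp: e_def intro!: mult_nonneg_nonneg)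
      finally show "\<psi> y \<le> C ^ 2 * exp (- Im y)" by simp
    qed (use z1 in simp_all)
  qed
  then obtain z0 where z0: "Im z0 \<ge> 1/4" and max: "\<And>z. Im z \<ge> 1/4 \<Longrightarrow> \<psi> z \<le> \<psi> z0" by blast
  have max: "\<psi> y \<le> \<psi> z0" if y: "Im y > 0" for y
    using reduction_to_quarter[OF y] max \<psi>_inv y by metis
  have Fz0: "F z0 \<noteq> 0"
    using max[of z1] z1 by (auto simp: \<psi>_def)
  define y1 where "y1 = Im z0 / 2"
  have y1: "y1 > 0" "Im z0 = 2 * y1" "y1 \<ge> 1/8" using z0 by (simp_all add: y1_def)
  define u where "u z = F z * ee (- (of_nat K * z))" for z
  have u_norm: "norm (u z) = norm (F z) * exp (2 * pi * real K * Im z)" for z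
    by (simp add: u_def norm_mult norm_ee)
  obtain C where C: "\<And>z. Im z \<ge> y1 \<Longrightarrow> norm (F z) \<le> C * exp (- 2 * pi * (real K + 1) * Im z)"
    using decay[OF y1(1)] by blast
  have C0: "C \<ge> 0"
    using C[of "z0"] y1 order.trans[OF norm_ge_zero] by (fastforce simp: zero_le_mult_iff)
  have u_decay: "norm (u z) \<le> C * exp (- Im z)" if "Im z \<ge> y1" for z
  proof -
    have "norm (u z) \<le> C * exp (- 2 * pi * (real K + 1) * Im z) * exp (2 * pi * real K * Im z)"
      unfolding u_norm using C[OF that] by (intro mult_right_mono) auto
    also have "\<dots> \<le> C * exp (- Im z)"
      unfolding mult.assoc using exp_le[of "Im z"] that y1 C0
      by (intro mult_left_mono) (auto simp: mult.assoc)
    finally show ?thesis .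
  qed
  have u_hol: "u holomorphic_on uhp"
    unfolding u_def by (intro holomorphic_intros F)
  have "\<exists>z2. Im z2 \<ge> y1 \<and> (\<forall>z. Im z \<ge> y1 \<longrightarrow> norm (u z) \<le> norm (u z2))"
  proof (rule periodic_decay_attains_max[where c = y1 and \<psi> = "\<lambda>z. norm (u z)" and ?z1.0 = z0 and C = C])
    show "continuous_on {z. Im z \<ge> y1} (\<lambda>z. norm (u z))"
    proof -
      have "{z. Im z \<ge> y1} \<subseteq> uhp" using y1(1) by auto
      then show ?thesis
        using holomorphic_on_imp_continuous_on[OF holomorphic_on_subset[OF u_hol]]
        by (intro continuous_intros) auto
    qed
    show "norm (u (y + 1)) = norm (u y)" if "Im y \<ge> y1" for y
      using per[of y] that y1 by (simp add: u_norm)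
    show "norm (u y) \<le> C * exp (- Im y)" if "Im y \<ge> y1" for y using u_decay that by simp
    show "Im z0 \<ge> y1" "norm (u z0) > 0" using y1 Fz0 by (auto simp: u_def)
  qed (use y1 in simp)
  then obtain z2 where z2: "Im z2 \<ge> y1" "\<And>z. Im z \<ge> y1 \<Longrightarrow> norm (u z) \<le> norm (u z2)" by blast
  have "Im z2 = y1"
  proof (rule ccontr)
    assume "Im z2 \<noteq> y1"
    then have gt: "Im z2 > y1" using z2 by simp
    define S where "S = {z. Im z > y1}"
    have S: "open S" "connected S" unfolding S_def
      using open_halfspace_Im_gt[of y1] convex_connected[OF convex_halfspace_Im_gt[of y1]] by auto
    have "u constant_on S"
      by (rule maximum_modulus_principle[OF holomorphic_on_subset[OF u_hol] S S(1) order_refl, of z2])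
         (use gt z2 y1 in \<open>auto simp: S_def\<close>)
    then obtain k where k: "\<And>z. z \<in> S \<Longrightarrow> u z = k" by (auto simp: constant_on_def)
    have knz: "norm k > 0" using k[of z0] y1 Fz0 by (auto simp: S_def u_def)
    define t where "t = max (2 * y1) (C / norm k)"
    have t: "\<i> * of_real t \<in> S" using y1 by (simp add: S_def t_def less_max_iff_disj)
    have "norm k \<le> C * exp (- t)" using u_decay[of "\<i> * of_real t"] k[OF t] t by (simp add: S_def)
    moreover have "C < norm k * exp t"
    proof -
      have "C \<le> norm k * t" using knz by (simp add: t_def field_simps max_def)
      also have "\<dots> < norm k * exp t" using knz exp_ge_add_one_self[of t] by (intro mult_strict_left_mono) linarith+
      finally show ?thesis .
    qed
    ultimately show False using knz by (simp add: exp_minus field_simps)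
  qed
  have "norm (u z0) \<le> norm (u z2)" using z2(2)[of z0] y1 by simp
  then have "norm (F z0) * exp (2 * pi * real K * (2 * y1)) \<le> norm (F z2) * exp (2 * pi * real K * y1)"
    by (simp add: u_norm \<open>Im z2 = y1\<close> y1(2))
  moreover have "exp (2 * pi * real K * (2 * y1)) = exp (2 * pi * real K * y1) * exp (2 * pi * real K * y1)"
    unfolding exp_add[symmetric] by simp
  ultimately have "norm (F z0) * exp (2 * pi * real K * y1) * exp (2 * pi * real K * y1) \<le>
      norm (F z2) * exp (2 * pi * real K * y1)"
    by (simp only: mult.assoc)
  then have "norm (F z0) * exp (2 * pi * real K * y1) \<le> norm (F z2)"
    by (rule mult_right_le_imp_le) simp
  then have "(norm (F z0) * exp (2 * pi * real K * y1)) ^ 2 \<le> norm (F z2) ^ 2"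
    by (intro power_mono) auto
  then have "norm (F z0) ^ 2 * exp (2 * pi * real K * y1) ^ 2 * y1 ^ K \<le> \<psi> z2"
    using y1 by (simp add: \<psi>_def \<open>Im z2 = y1\<close> power_mult_distrib)
  also have "\<dots> \<le> norm (F z0) ^ 2 * (2 * y1) ^ K" using max[of z2] \<open>Im z2 = y1\<close> y1 by (simp add: \<psi>_def)
  also have "\<dots> = norm (F z0) ^ 2 * 2 ^ K * y1 ^ K" by (simp add: power_mult_distrib)
  finally have "exp (2 * pi * real K * y1) ^ 2 \<le> 2 ^ K"
    using Fz0 y1 by (simp add: mult.assoc)
  moreover have "exp (2 * pi * real K * y1) ^ 2 = exp (4 * pi * y1) ^ K"
    by (simp add: exp_of_nat_mult[symmetric] power2_eq_square exp_add[symmetric] algebra_simps)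
  moreover have "exp (4 * pi * y1) > 2"
  proof -
    have "pi * 1 \<le> pi * (8 * y1)" using y1 by (intro mult_left_mono) auto
    then have "pi \<le> 2 * (4 * pi * y1)" by simp
    then have "4 * pi * y1 > 1" using pi_gt3 by linarith
    then show ?thesis using exp_ge_add_one_self[of "4 * pi * y1"] by linarith
  qed
  then have "exp (4 * pi * y1) ^ K > 2 ^ K" using K by (intro power_strict_mono) auto
  ultimately show False by simp
qed

subsection \<open>Vanishing at infinity to high order\<close>

lemma holomorphic_prod_zero:
  assumes "finite I" and hol: "\<And>i. i \<in> I \<Longrightarrow> g i holomorphic_on S" and S: "open S" "connected S" "S \<noteq> {}"
    and zero: "\<And>z. z \<in> S \<Longrightarrow> (\<Prod>i\<in>I. g i z) = (0::complex)"
  shows "\<exists>i\<in>I. \<forall>z\<in>S. g i z = 0"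
  using assms(1) hol zero
proof (induction I rule: finite_induct)
  case empty
  then show ?case using S by auto
next
  case (insert i I)
  show ?case
  proof (cases "\<forall>z\<in>S. g i z = 0")
    case False
    then obtain z0 where z0: "z0 \<in> S" "g i z0 \<noteq> 0" by blast
    have cont: "continuous_on S (g i)" using insert.prems(1) holomorphic_on_imp_continuous_on by blast
    define U where "U = {z \<in> S. g i z \<noteq> 0}"
    have "open U"
    proof -
      have "U = S \<inter> g i -` (- {0})" by (auto simp: U_def)
      then show ?thesis using continuous_open_preimage[OF cont S(1) open_Compl[OF closed_singleton[of 0]]] by simp
    qed
    have zU: "(\<Prod>j\<in>I. g j z) = 0" if "z \<in> U" for z
      using insert.prems(2)[of z] insert.hyps that by (auto simp: U_def)
    have hol: "(\<lambda>z. \<Prod>j\<in>I. g j z) holomorphic_on S"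
      using insert.prems(1) by (intro holomorphic_on_prod) auto
    have "(\<Prod>j\<in>I. g j z) = 0" if z: "z \<in> S" for z
      by (rule analytic_continuation_open[OF \<open>open U\<close> S(1) _ S(2) _ hol holomorphic_on_const])
         (use z0 zU z in \<open>auto simp: U_def\<close>)
    then show ?thesis using insert.IH insert.prems by auto
  qed auto
qed

definition residue_vector :: "int \<Rightarrow> mat2 \<Rightarrow> int \<times> int \<times> int \<times> int" where
  "residue_vector N M = (case M of M2 a b c d \<Rightarrow> (a mod N, b mod N, c mod N, d mod N))"

lemma slash_residue_vector:
  assumes f: "modform w N f" and det: "mdet A = 1" "mdet B = 1"
    and eq: "residue_vector N A = residue_vector N B"
  shows "slash w f A = slash w f B"
proof -
  obtain a b c d where A: "A = M2 a b c d" by (cases A)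
  obtain a' b' c' d' where B: "B = M2 a' b' c' d'" by (cases B)
  have dv: "N dvd a - a'" "N dvd b - b'" "N dvd c - c'" "N dvd d - d'"
    using eq by (simp_all add: A B residue_vector_def mod_eq_dvd_iff)
  have "Gamma_N N (A * adj B)"
  proof -
    have e: "a*d' + b*(-c') - 1 = (a - a')*d' - (b - b')*c' + (a'*d' - b'*c' - 1)"
      "a*(-b') + b*a' = -((a - a')*b') + (b - b')*a'"
      "c*d' + d*(-c') = (c - c')*d' - (d - d')*c'"
      "c*(-b') + d*a' - 1 = -((c - c')*b') + (d - d')*a' + (a'*d' - b'*c' - 1)"
      by (simp_all add: algebra_simps)
    have 0: "a'*d' - b'*c' - 1 = 0" using det B by simp
    have dvs: "N dvd a*d' + b*(-c') - 1" "N dvd a*(-b') + b*a'" "N dvd c*d' + d*(-c')" "N dvd c*(-b') + d*a' - 1"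
      unfolding e 0 using dv by (auto intro!: dvd_add dvd_diff dvd_mult2)
    have "mdet (A * adj B) = 1" using det by simp
    then show ?thesis using dvs by (simp add: A B)
  qed
  then have "slash w f (A * adj B) = slash w f 1" using f by (simp add: modform_def)
  then have "slash w (slash w f (A * adj B)) B = slash w f B"
    using slash_slash_1[of B w f] det by simp
  moreover have "slash w (slash w f (A * adj B)) B = slash w f A"
    using det mult_adj(2)[OF det(2)] by (subst slash_mult) (simp_all add: mult.assoc)
  ultimately show ?thesis by simp
qed

definition conjugates :: "nat \<Rightarrow> (complex \<Rightarrow> complex) \<Rightarrow> (complex \<Rightarrow> complex) set" where
  "conjugates w f = {slash w f \<gamma> | \<gamma>. mdet \<gamma> = 1}"

lemma conjugates_finite_card:
  assumes f: "modform w N f" and N: "N > 0"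
  shows "finite (conjugates w f)" and "card (conjugates w f) \<le> nat N ^ 4"
proof -
  define R where "R = {0..<N} \<times> {0..<N} \<times> {0..<N} \<times> {0..<N}"
  define h where "h r = slash w f (SOME \<gamma>. mdet \<gamma> = 1 \<and> residue_vector N \<gamma> = r)" for r
  have sub: "conjugates w f \<subseteq> h ` R"
  proof
    fix g assume "g \<in> conjugates w f"
    then obtain \<gamma> where g: "g = slash w f \<gamma>" "mdet \<gamma> = 1" by (auto simp: conjugates_def)
    define \<delta> where "\<delta> = (SOME \<delta>. mdet \<delta> = 1 \<and> residue_vector N \<delta> = residue_vector N \<gamma>)"
    have "mdet \<delta> = 1 \<and> residue_vector N \<delta> = residue_vector N \<gamma>"
      unfolding \<delta>_def by (rule someI[of _ \<gamma>]) (use g in simp)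
    then have "h (residue_vector N \<gamma>) = g"
      unfolding h_def \<delta>_def[symmetric] g(1) using g(2) slash_residue_vector[OF f] by blast
    moreover have "residue_vector N \<gamma> \<in> R" using N by (cases \<gamma>) (simp add: residue_vector_def R_def)
    ultimately show "g \<in> h ` R" by blast
  qed
  have R: "finite R" "card R = nat N ^ 4"
    by (simp_all add: R_def card_cartesian_product power4_eq_xxxx)
  then show "finite (conjugates w f)" using sub finite_subset by blast
  have "card (conjugates w f) \<le> card (h ` R)" using sub R by (intro card_mono) auto
  also have "\<dots> \<le> nat N ^ 4" using card_image_le[OF R(1), of h] R(2) by simp
  finally show "card (conjugates w f) \<le> nat N ^ 4" .
qed

lemma conjugates_slash_bij:
  assumes "mdet \<gamma> = 1"
  shows "bij_betw (\<lambda>g. slash w g \<gamma>) (conjugates w f) (conjugates w f)"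
proof (rule bij_betw_byWitness[where f' = "\<lambda>g. slash w g (adj \<gamma>)"])
  have m: "slash w (slash w f \<delta>) \<beta> = slash w f (\<delta> * \<beta>)" if "mdet \<delta> = 1" "mdet \<beta> = 1" for \<delta> \<beta>
    using that by (intro slash_mult) auto
  show "\<forall>g\<in>conjugates w f. slash w (slash w g \<gamma>) (adj \<gamma>) = g"
    "\<forall>g\<in>conjugates w f. slash w (slash w g (adj \<gamma>)) \<gamma> = g"
    using assms mult_adj[OF assms] by (auto simp: conjugates_def m mult.assoc)
  show "(\<lambda>g. slash w g \<gamma>) ` conjugates w f \<subseteq> conjugates w f"
    using assms by (auto simp: conjugates_def m)
  show "(\<lambda>g. slash w g (adj \<gamma>)) ` conjugates w f \<subseteq> conjugates w f"
    using assms by (auto simp: conjugates_def m)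
qed

text \<open>
  The product of all conjugates is a form for the full modular group whose weight is bounded in terms
  of \<open>w\<close> and \<open>N\<close>, and it inherits the vanishing of \<open>f\<close> at infinity.
\<close>

lemma modform_vanishing:
  assumes f: "modform w N f" and N: "N > 0" and w: "w \<ge> 1"
    and decay: "\<And>c. c > 0 \<Longrightarrow> \<exists>C. \<forall>z. Im z \<ge> c \<longrightarrow>
      norm (f z) \<le> C * exp (- 2 * pi * (real (w * nat N ^ 4) + 1) * Im z)"
    and z: "Im z > 0"
  shows "f z = 0"
proof -
  define orb where "orb = conjugates w f"
  define K where "K = w * card orb"
  define F where "F z = (\<Prod>g\<in>orb. g z)" for z
  note fin = conjugates_finite_card[OF f N, folded orb_def]
  have forb: "slash w f 1 \<in> orb" by (auto simp: orb_def conjugates_def intro!: exI[of _ 1])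
  then have "card orb > 0" using fin by (auto simp: card_gt_0_iff)
  then have K: "K \<ge> 1" using w by (simp add: K_def)
  have Kle: "K \<le> w * nat N ^ 4" unfolding K_def using fin by simp
  have hol: "g holomorphic_on uhp" if "g \<in> orb" for g
    using that f slash_holomorphic[of f] by (auto simp: orb_def conjugates_def modform_def)
  have Fz: "F z = 0" if "Im z > 0" for z
  proof (rule level_one_vanishing[OF _ K _ _ that])
    show "F holomorphic_on uhp" unfolding F_def by (intro holomorphic_on_prod hol)
    show "norm (F (act \<gamma> z)) = norm (aut \<gamma> z) ^ K * norm (F z)" if g: "mdet \<gamma> = 1" "Im z > 0" for \<gamma> z
    proof -
      have nz: "aut \<gamma> z \<noteq> 0" using aut_nonzero[of \<gamma> z] g by simp
      have "F (act \<gamma> z) = (\<Prod>g\<in>orb. aut \<gamma> z ^ w * slash w g \<gamma> z)"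
        unfolding F_def by (intro prod.cong refl) (use g nz in \<open>simp add: slash_def\<close>)
      also have "\<dots> = (aut \<gamma> z ^ w) ^ card orb * (\<Prod>g\<in>orb. slash w g \<gamma> z)" by (simp add: prod.distrib)
      also have "(\<Prod>g\<in>orb. slash w g \<gamma> z) = F z"
        unfolding F_def orb_def
        by (rule prod.reindex_bij_betw[OF conjugates_slash_bij[OF g(1), of w f], of "\<lambda>g. g z"])
      finally show ?thesis by (simp add: norm_mult norm_power K_def power_mult)
    qed
    fix c :: real assume c: "c > 0"
    obtain C where C: "\<And>z. Im z \<ge> c \<Longrightarrow> norm (f z) \<le> C * exp (- 2 * pi * (real (w * nat N ^ 4) + 1) * Im z)"
      using decay[OF c] by blast
    have "\<exists>B. \<forall>z. Im z \<ge> c \<longrightarrow> norm (g z) \<le> B" if "g \<in> orb" for g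
      using that f c by (auto simp: orb_def conjugates_def modform_def)
    then obtain B where B: "\<And>g z. g \<in> orb \<Longrightarrow> Im z \<ge> c \<Longrightarrow> norm (g z) \<le> B g" by metis
    have "norm (F z) \<le> (\<bar>C\<bar> * (\<Prod>g\<in>orb - {slash w f 1}. B g)) * exp (- 2 * pi * (real K + 1) * Im z)"
      if z: "Im z \<ge> c" for z
    proof -
      have z0: "Im z > 0" using z c by linarith
      have "norm (F z) = norm (slash w f 1 z) * (\<Prod>g\<in>orb - {slash w f 1}. norm (g z))"
        unfolding F_def using fin forb by (simp add: prod.remove[of orb "slash w f 1"] norm_mult prod_norm)
      also have "\<dots> \<le> (\<bar>C\<bar> * exp (- 2 * pi * (real K + 1) * Im z)) * (\<Prod>g\<in>orb - {slash w f 1}. B g)"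
      proof (intro mult_mono prod_mono conjI)
        have "norm (slash w f 1 z) \<le> C * exp (- 2 * pi * (real (w * nat N ^ 4) + 1) * Im z)"
          using C[OF z] z0 by (simp add: slash_1)
        also have "\<dots> \<le> \<bar>C\<bar> * exp (- 2 * pi * (real K + 1) * Im z)"
        proof (intro mult_mono)
          have "real K + 1 \<le> real (w * nat N ^ 4) + 1" using Kle by (simp only: of_nat_le_iff add_le_cancel_right)
          then have "(2 * pi * Im z) * (real K + 1) \<le> (2 * pi * Im z) * (real (w * nat N ^ 4) + 1)"
            using z0 by (intro mult_left_mono) auto
          then show "exp (- 2 * pi * (real (w * nat N ^ 4) + 1) * Im z) \<le> exp (- 2 * pi * (real K + 1) * Im z)"
            by (simp add: mult_ac)
        qed auto
        finally show "norm (slash w f 1 z) \<le> \<bar>C\<bar> * exp (- 2 * pi * (real K + 1) * Im z)" .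
      qed (use B z in \<open>auto intro!: prod_nonneg\<close>)
      finally show ?thesis by (simp add: mult_ac)
    qed
    then show "\<exists>C. \<forall>z. Im z \<ge> c \<longrightarrow> norm (F z) \<le> C * exp (- 2 * pi * (real K + 1) * Im z)" by blast
  qed
  have "\<exists>g\<in>orb. \<forall>z\<in>uhp. g z = 0"
    by (rule holomorphic_prod_zero[OF fin(1) hol open_uhp connected_uhp])
       (use Fz z in \<open>auto simp: F_def\<close>)
  then obtain \<gamma> where g: "mdet \<gamma> = 1" "\<And>z. Im z > 0 \<Longrightarrow> slash w f \<gamma> z = 0"
    by (auto simp: orb_def conjugates_def)
  have "slash w f \<gamma> (act (adj \<gamma>) z) = 0" using g act_uhp[of "adj \<gamma>" z] z by simp
  moreover have "act \<gamma> (act (adj \<gamma>) z) = z"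
    using act_mult[of \<gamma> "adj \<gamma>" z] mult_adj(1)[OF g(1)] g z by simp
  moreover have "Im (act (adj \<gamma>) z) > 0" using g act_uhp[of "adj \<gamma>" z] z by simp
  ultimately show ?thesis using aut_nonzero[of \<gamma> "act (adj \<gamma>) z"] g by (simp add: slash_def)
qed

section \<open>Forms with integral coefficients\<close>

definition cfps :: "int fps \<Rightarrow> complex fps" where "cfps A = Abs_fps (\<lambda>n. of_int (A $ n))"

lemma cfps_nth [simp]: "cfps A $ n = of_int (A $ n)" by (simp add: cfps_def)

lemma cfps_mult: "cfps (A * B) = cfps A * cfps B"
  by (simp add: fps_eq_iff fps_mult_nth)
lemma cfps_diff: "cfps (A - B) = cfps A - cfps B"
  by (simp add: fps_eq_iff)
lemma cfps_1: "cfps 1 = 1" and cfps_const: "cfps (fps_const c) = fps_const (of_int c)"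
  and cfps_X: "cfps fps_X = fps_X"
  by (simp_all add: fps_eq_iff fps_X_def)
lemma cfps_power: "cfps (A ^ n) = cfps A ^ n"
  by (induction n) (simp_all add: cfps_1 cfps_mult)

definition conv1 :: "int fps \<Rightarrow> bool" where "conv1 A \<longleftrightarrow> fps_conv_radius (cfps A) \<ge> 1"

definition ev :: "int fps \<Rightarrow> complex \<Rightarrow> complex" where "ev A x = eval_fps (cfps A) x"

lemma conv1_radius: "conv1 A \<Longrightarrow> norm x < 1 \<Longrightarrow> ereal (norm x) < fps_conv_radius (cfps A)"
  unfolding conv1_def by (metis ereal_less(3) ereal_less_eq(3) less_ereal.simps(1) one_ereal_def order_less_le_trans)

lemma conv1_mult: "conv1 A \<Longrightarrow> conv1 B \<Longrightarrow> conv1 (A * B)"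
  unfolding conv1_def cfps_mult by (meson fps_conv_radius_mult min.boundedI order.trans)
lemma conv1_diff: "conv1 A \<Longrightarrow> conv1 B \<Longrightarrow> conv1 (A - B)"
  unfolding conv1_def cfps_diff by (meson fps_conv_radius_diff min.boundedI order.trans)
lemma conv1_const: "conv1 (fps_const c)"
  by (simp add: conv1_def cfps_const)
lemma conv1_1: "conv1 1" by (simp add: conv1_def cfps_1)
lemma conv1_power: "conv1 A \<Longrightarrow> conv1 (A ^ n)"
  by (induction n) (simp_all add: conv1_1 conv1_mult)
lemma conv1_X_power: "conv1 (fps_X ^ n)"
  by (simp add: conv1_def cfps_power cfps_X)

lemma ev_mult: "conv1 A \<Longrightarrow> conv1 B \<Longrightarrow> norm x < 1 \<Longrightarrow> ev (A * B) x = ev A x * ev B x"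
  unfolding ev_def cfps_mult by (intro eval_fps_mult conv1_radius)
lemma ev_diff: "conv1 A \<Longrightarrow> conv1 B \<Longrightarrow> norm x < 1 \<Longrightarrow> ev (A - B) x = ev A x - ev B x"
  unfolding ev_def cfps_diff by (intro eval_fps_diff conv1_radius)
lemma ev_const: "ev (fps_const c) x = of_int c" by (simp add: ev_def cfps_const)
lemma ev_1: "ev 1 x = 1" by (simp add: ev_def cfps_1)
lemma ev_power: "conv1 A \<Longrightarrow> norm x < 1 \<Longrightarrow> ev (A ^ n) x = ev A x ^ n"
  by (induction n) (simp_all add: ev_1 ev_mult conv1_power)
lemma ev_X_power: "ev (fps_X ^ n) x = x ^ n"
  by (simp add: ev_def cfps_power cfps_X)

lemma ev_sums: "conv1 A \<Longrightarrow> norm x < 1 \<Longrightarrow> (\<lambda>n. of_int (A $ n) * x ^ n) sums ev A x"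
  using sums_eval_fps[OF conv1_radius] by (simp add: ev_def)

lemma ev_continuous: "conv1 A \<Longrightarrow> continuous_on (ball 0 1) (ev A)"
  unfolding ev_def
  by (rule continuous_on_eval_fps[THEN continuous_on_subset]) (auto intro: conv1_radius)

lemma conv1_shift: "conv1 A \<Longrightarrow> conv1 (fps_shift n A)"
proof -
  have "cfps (fps_shift n A) = fps_shift n (cfps A)" by (simp add: fps_eq_iff)
  then show "conv1 A \<Longrightarrow> conv1 (fps_shift n A)" by (simp add: conv1_def)
qed

lemma ev_zero_imp_zero:
  assumes A: "conv1 A" and zero: "\<And>x. norm x < 1 \<Longrightarrow> ev A x = 0"
  shows "A = 0"
proof -
  have "cfps A = 0"
  proof (rule eval_fps_eqD)
    show "fps_conv_radius (cfps A) > 0"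
      using A unfolding conv1_def by (metis less_le_trans zero_less_one_ereal zero_less_one one_ereal_def ereal_less(2))
    have "eventually (\<lambda>x. x \<in> ball 0 1) (nhds (0::complex))" by (rule eventually_nhds_in_open) auto
    then show "eventually (\<lambda>z. eval_fps (cfps A) z = eval_fps 0 z) (nhds 0)"
      by eventually_elim (use zero in \<open>auto simp: ev_def\<close>)
  qed auto
  then have "of_int (A $ n) = (0 :: complex)" for n by (metis cfps_nth fps_zero_nth)
  then show ?thesis by (auto simp: fps_eq_iff)
qed

text \<open>
  The variable of the series is \<open>exp(2\<pi>iz/N)\<close>, the local parameter of \<open>\<Gamma>(N)\<close> at infinity.
\<close>

definition intform :: "nat \<Rightarrow> int \<Rightarrow> int fps \<Rightarrow> bool" where
  "intform w N A \<longleftrightarrow> conv1 A \<and> modform w N (\<lambda>z. ev A (ee (z / of_int N)))"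

lemma norm_ee_div: "Im z > 0 \<Longrightarrow> N > 0 \<Longrightarrow> norm (ee (z / of_int N)) < 1"
  by (intro norm_ee_less_1) (simp add: Im_divide_of_real[of z "of_int N", simplified])

lemma intform_diff_scaled:
  assumes "intform w N A" "intform w N B" "N > 0"
  shows "intform w N (A - fps_const t * B)"
  unfolding intform_def
proof
  show "conv1 (A - fps_const t * B)"
    using assms by (intro conv1_diff conv1_mult conv1_const) (auto simp: intform_def)
  have "modform w N (\<lambda>z. ev A (ee (z / of_int N)) + of_int (-t) * ev B (ee (z / of_int N)))"
    using assms by (intro modform_add modform_cmult) (auto simp: intform_def)
  then show "modform w N (\<lambda>z. ev (A - fps_const t * B) (ee (z / of_int N)))"
  proof (rule modform_cong)
    fix z :: complex assume "Im z > 0"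
    then show "ev A (ee (z / of_int N)) + of_int (-t) * ev B (ee (z / of_int N)) =
        ev (A - fps_const t * B) (ee (z / of_int N))"
      using assms norm_ee_div[of z N]
      by (simp add: intform_def ev_diff ev_mult ev_const conv1_mult conv1_const)
  qed
qed

text \<open>
  A bound of the kind given by Sturm: \<open>N(w N\<^sup>4 + 1)\<close> vanishing coefficients in \<open>exp(2\<pi>iz/N)\<close> provide the decay that forces
  the form to be zero.
\<close>

lemma intform_vanishing:
  assumes A: "intform w N A" and N: "N > 0" and w: "w \<ge> 1"
    and zero: "\<And>n. n < nat N * (w * nat N ^ 4 + 1) \<Longrightarrow> A $ n = 0"
  shows "A = 0"
proof (rule ev_zero_imp_zero)
  show cA: "conv1 A" using A by (simp add: intform_def)
  define X where "X = nat N * (w * nat N ^ 4 + 1)"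
  have "A = fps_X ^ X * fps_shift X A"
    using zero by (auto simp: fps_eq_iff fps_X_power_mult_nth X_def not_less)
  then have evA: "ev A x = x ^ X * ev (fps_shift X A) x" if "norm x < 1" for x
    using that by (metis ev_mult ev_X_power conv1_X_power conv1_shift cA)
  have van: "ev A (ee (z / of_int N)) = 0" if "Im z > 0" for z
  proof (rule modform_vanishing[OF _ N w _ that])
    show "modform w N (\<lambda>z. ev A (ee (z / of_int N)))" using A by (simp add: intform_def)
    fix c :: real assume c: "c > 0"
    define r where "r = exp (- 2 * pi * (c / of_int N))"
    have r: "r < 1" using c N by (simp add: r_def)
    have "continuous_on (cball 0 r) (ev (fps_shift X A))"
      by (rule continuous_on_subset[OF ev_continuous[OF conv1_shift[OF cA]]]) (use r in auto)
    then have "bounded (ev (fps_shift X A) ` cball 0 r)"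
      by (intro compact_imp_bounded compact_continuous_image compact_cball)
    then obtain B where "\<forall>y\<in>ev (fps_shift X A) ` cball 0 r. norm y \<le> B"
      unfolding bounded_iff by blast
    then have B: "norm (ev (fps_shift X A) x) \<le> B" if "norm x \<le> r" for x
      using that by simp
    have "norm (ev A (ee (z / of_int N))) \<le> B * exp (- 2 * pi * (real (w * nat N ^ 4) + 1) * Im z)"
      if z: "Im z \<ge> c" for z
    proof -
      define x where "x = ee (z / of_int N)"
      have nx: "norm x = exp (- 2 * pi * (Im z / of_int N))"
        by (simp add: x_def norm_ee Im_divide_of_real[of z "of_int N", simplified])
      also have "\<dots> \<le> r" unfolding r_def using z N by (simp add: divide_right_mono)
      finally have xr: "norm x \<le> r" .
      have "norm x ^ X = exp (- 2 * pi * (real (w * nat N ^ 4) + 1) * Im z)"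
      proof -
        have "real X = real_of_int N * (real (w * nat N ^ 4) + 1)" using N by (simp add: X_def distrib_left)
        then show ?thesis unfolding nx exp_of_nat_mult[symmetric] using N by simp
      qed
      moreover have "norm (ev A x) = norm x ^ X * norm (ev (fps_shift X A) x)"
        using evA[of x] xr r by (simp add: norm_mult norm_power)
      ultimately show ?thesis
        unfolding x_def[symmetric] using B[OF xr] by (simp add: mult.commute[of B])
    qed
    then show "\<exists>C. \<forall>z. Im z \<ge> c \<longrightarrow> norm (ev A (ee (z / of_int N))) \<le>
        C * exp (- 2 * pi * (real (w * nat N ^ 4) + 1) * Im z)" by blast
  qed
  fix x :: complex assume x: "norm x < 1"
  show "ev A x = 0"
  proof (cases "x = 0")
    case True
    have "A $ 0 = 0" using zero[of 0] N by simp
    then show ?thesis using True by (simp add: ev_def eval_fps_at_0)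
  next
    case False
    define z where "z = of_int N * Ln x / (2 * of_real pi * \<i>)"
    have "ee (z / of_int N) = x" using False N by (simp add: ee_def z_def)
    moreover have "Im z > 0"
    proof -
      have "z = of_real (of_int N / (2 * pi)) * (- \<i> * Ln x)" by (simp add: z_def field_simps)
      then have "Im z = (of_int N / (2 * pi)) * (- ln (norm x))" using False by simp
      moreover have "ln (norm x) < 0" using x False by simp
      ultimately show ?thesis using N by (simp add: mult_pos_neg divide_neg_pos)
    qed
    ultimately show ?thesis using van[of z] by simp
  qed
qed

text \<open>
  A group of integral series on which finitely many coefficients form a faithful system of coordinates
  is finitely generated, hence finite modulo \<open>m\<close>.
\<close>

lemma finite_reductions:
  fixes L :: "int fps set"
  assumes "finite I" and "m > 0"
    and "\<And>a b t. a \<in> L \<Longrightarrow> b \<in> L \<Longrightarrow> a - fps_const t * b \<in> L"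
    and "\<And>a. a \<in> L \<Longrightarrow> (\<And>i. i \<in> I \<Longrightarrow> a $ i = 0) \<Longrightarrow> a = 0"
  shows "finite ((\<lambda>a n. a $ n mod m) ` L)"
  using assms(1,3,4)
proof (induction I arbitrary: L rule: finite_induct)
  case empty
  then have "L \<subseteq> {0}" by blast
  then have "(\<lambda>a n. a $ n mod m) ` L \<subseteq> (\<lambda>a n. a $ n mod m) ` {0}" by blast
  then show ?case using finite_subset by blast
next
  case (insert i I)
  define L' where "L' = {a \<in> L. a $ i = 0}"
  have fin': "finite ((\<lambda>a n. a $ n mod m) ` L')"
  proof (rule insert.IH)
    show "a - fps_const t * b \<in> L'" if "a \<in> L'" "b \<in> L'" for a b t
      using that insert.prems(1) by (auto simp: L'_def)
    show "a = 0" if "a \<in> L'" "\<And>i. i \<in> I \<Longrightarrow> a $ i = 0" for a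
      by (rule insert.prems(2)) (use that in \<open>auto simp: L'_def\<close>)
  qed
  show ?case
  proof (cases "L = L'")
    case True
    then show ?thesis using fin' by simp
  next
    case False
    then obtain a0 where a0: "a0 \<in> L" "a0 $ i \<noteq> 0" by (auto simp: L'_def)
    define P where "P d \<longleftrightarrow> d > 0 \<and> (\<exists>a\<in>L. \<bar>a $ i\<bar> = int d)" for d :: nat
    have "P (nat \<bar>a0 $ i\<bar>)" using a0 by (auto simp: P_def)
    then have Pd: "P (LEAST d. P d)" by (rule LeastI)
    define d where "d = (LEAST d. P d)"
    from Pd obtain e where e: "e \<in> L" "\<bar>e $ i\<bar> = int d" "d > 0" by (auto simp: P_def d_def)
    have dec: "\<exists>t. a - fps_const t * e \<in> L'" if a: "a \<in> L" for a
    proof -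
      define t where "t = (a $ i) div (e $ i)"
      have "\<bar>a $ i mod e $ i\<bar> < int d" using e abs_mod_less[of "e $ i" "a $ i"] by auto
      moreover have "(a - fps_const t * e) $ i = a $ i mod e $ i"
        by (simp add: t_def minus_div_mult_eq_mod[symmetric])
      moreover have in_L: "a - fps_const t * e \<in> L" using insert.prems(1) a e by blast
      ultimately have lt: "\<bar>(a - fps_const t * e) $ i\<bar> < int d" by simp
      have "(a - fps_const t * e) $ i = 0"
      proof (rule ccontr)
        assume "(a - fps_const t * e) $ i \<noteq> 0"
        then have "P (nat \<bar>(a - fps_const t * e) $ i\<bar>)"
          unfolding P_def by (intro conjI bexI[OF _ in_L]) simp_all
        then have "d \<le> nat \<bar>(a - fps_const t * e) $ i\<bar>" unfolding d_def by (rule Least_le)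
        then show False using lt by linarith
      qed
      then show ?thesis using in_L by (auto simp: L'_def)
    qed
    have "(\<lambda>a n. a $ n mod m) ` L \<subseteq>
        (\<lambda>(t, f) n. (t * e $ n + f n) mod m) ` ({0..<m} \<times> (\<lambda>a n. a $ n mod m) ` L')"
    proof
      fix g assume "g \<in> (\<lambda>a n. a $ n mod m) ` L"
      then obtain a where a: "a \<in> L" "g = (\<lambda>n. a $ n mod m)" by auto
      obtain t where t: "a - fps_const t * e \<in> L'" using dec a by blast
      have "g n = ((t mod m) * e $ n + (a - fps_const t * e) $ n mod m) mod m" for n
      proof -
        have "((t mod m) * e $ n + (a - fps_const t * e) $ n mod m) mod m =
            (t * e $ n + (a - fps_const t * e) $ n) mod m"
          by (metis mod_add_left_eq mod_add_right_eq mod_mult_left_eq)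
        then show ?thesis by (simp add: a)
      qed
      then have "g = (\<lambda>(t, f) n. (t * e $ n + f n) mod m) (t mod m, \<lambda>n. (a - fps_const t * e) $ n mod m)"
        by auto
      moreover have "(t mod m, \<lambda>n. (a - fps_const t * e) $ n mod m) \<in> {0..<m} \<times> (\<lambda>a n. a $ n mod m) ` L'"
        using assms(2) by (intro SigmaI image_eqI[OF _ t]) simp_all
      ultimately show "g \<in> (\<lambda>(t, f) n. (t * e $ n + f n) mod m) ` ({0..<m} \<times> (\<lambda>a n. a $ n mod m) ` L')"
        by blast
    qed
    then show ?thesis using fin' finite_subset by blast
  qed
qed

section \<open>Hecke operators\<close>

text \<open>
  Representatives of the cosets \<open>SL\<^sub>2(\<int>) \<beta>\<close> of integer matrices \<open>\<beta>\<close> of determinant \<open>p\<close>. The multiples of \<open>N\<close> in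
  the upper right corner make them diagonal modulo \<open>N\<close>, so that passing between cosets stays under control modulo \<open>N\<close>.
\<close>

definition hecke_rep :: "nat \<Rightarrow> int \<Rightarrow> nat \<Rightarrow> mat2" where
  "hecke_rep p N j = (if j < p then M2 1 (N * int j) 0 (int p) else M2 (int p) 0 0 1)"

lemma hecke_rep_det [simp]: "mdet (hecke_rep p N j) = int p"
  by (simp add: hecke_rep_def)

lemma hecke_rep_exists:
  assumes p: "prime p" and cop: "coprime (int p) N" and det: "mdet \<beta> = int p"
  shows "\<exists>j\<le>p. \<exists>\<delta>. mdet \<delta> = 1 \<and> \<beta> = \<delta> * hecke_rep p N j"
proof -
  obtain a b c d where B: "\<beta> = M2 a b c d" by (cases \<beta>)
  have pp: "prime (int p)" using p by simp
  have p0: "int p > 0" using p prime_gt_0_nat by simp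
  have D: "a * d - b * c = int p" using det B by simp
  show ?thesis
  proof (cases "int p dvd a \<and> int p dvd c")
    case True
    then obtain a' c' where ac: "a = int p * a'" "c = int p * c'" by (auto elim!: dvdE)
    have "int p * (a' * d - b * c') = int p * 1" using D by (simp add: ac algebra_simps)
    then have "a' * d - b * c' = 1" using p0 by simp
    then have "mdet (M2 a' b c' d) = 1 \<and> \<beta> = M2 a' b c' d * hecke_rep p N p"
      by (simp add: B ac hecke_rep_def)
    then show ?thesis by blast
  next
    case False
    have inv: "\<exists>j<p. int p dvd y - N * int j * x" if "\<not> int p dvd x" for x y
    proof -
      have "coprime (N * x) (int p)"
        using cop prime_imp_coprime[OF pp that] by (simp add: coprime_commute)
      then obtain u where u: "[N * x * u = 1] (mod int p)" using cong_solve_coprime_int by blast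
      define j where "j = nat ((u * y) mod int p)"
      have j: "int j = (u * y) mod int p" "j < p"
        using p0 by (simp_all add: j_def nat_less_iff)
      have "[int j = u * y] (mod int p)" by (simp add: j cong_def)
      then have "[N * x * int j = N * x * (u * y)] (mod int p)" by (rule cong_mult[OF cong_refl])
      also have "N * x * (u * y) = N * x * u * y" by simp
      also have "[N * x * u * y = 1 * y] (mod int p)" by (rule cong_mult[OF u cong_refl])
      finally have "int p dvd y - N * int j * x"
        by (simp add: cong_iff_dvd_diff dvd_diff_commute mult_ac)
      then show ?thesis using j by blast
    qed
    have "\<exists>j<p. int p dvd b - N * int j * a \<and> int p dvd d - N * int j * c"
    proof (cases "int p dvd a")
      case False
      then obtain j where j: "j < p" "int p dvd b - N * int j * a" using inv by blast
      have "a * (d - N * int j * c) = int p + c * (b - N * int j * a)" using D by (simp add: algebra_simps)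
      then have "int p dvd a * (d - N * int j * c)" using j by simp
      then have "int p dvd d - N * int j * c" using False prime_dvd_mult_iff[OF pp] by blast
      then show ?thesis using j by blast
    next
      case True
      then have "\<not> int p dvd c" using \<open>\<not> (int p dvd a \<and> int p dvd c)\<close> by blast
      then obtain j where j: "j < p" "int p dvd d - N * int j * c" using inv by blast
      have "c * (b - N * int j * a) = a * (d - N * int j * c) - int p" using D by (simp add: algebra_simps)
      then have "int p dvd c * (b - N * int j * a)" using j by simp
      then have "int p dvd b - N * int j * a" using \<open>\<not> int p dvd c\<close> prime_dvd_mult_iff[OF pp] by blast
      then show ?thesis using j by blast
    qed
    then obtain j b' d' where j: "j < p" and bd: "b - N * int j * a = int p * b'" "d - N * int j * c = int p * d'"
      by (auto elim!: dvdE)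
    have b: "b = N * int j * a + int p * b'" and d: "d = N * int j * c + int p * d'" using bd by simp_all
    have "int p * (a * d' - b' * c) = int p * 1" using D by (simp add: b d algebra_simps)
    then have "a * d' - b' * c = 1" using p0 by simp
    then have "mdet (M2 a b' c d') = 1 \<and> \<beta> = M2 a b' c d' * hecke_rep p N j"
      using j by (simp add: B b d hecke_rep_def algebra_simps)
    then show ?thesis using j less_imp_le by blast
  qed
qed

lemma hecke_rep_unique:
  assumes p: "prime p" and cop: "coprime (int p) N" and E: "mdet E = 1"
    and eq: "hecke_rep p N j = E * hecke_rep p N j'" and j: "j \<le> p" "j' \<le> p"
  shows "j = j'"
proof -
  obtain a b c d where abcd: "E = M2 a b c d" by (cases E)
  have p1: "int p > 1" using p prime_gt_1_nat by simp
  have np: "x * int p \<noteq> 1" for x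
    using p1 by (metis dvd_triv_right zdvd1_eq abs_of_nat less_irrefl)
  show ?thesis
  proof (cases "j < p"; cases "j' < p")
    assume lt: "j < p" "j' < p"
    then have "a = 1" "N * int j = a * (N * int j') + b * int p" using eq by (simp_all add: hecke_rep_def abcd)
    then have "N * (int j - int j') = b * int p" by (simp add: algebra_simps)
    then have "int p dvd N * (int j - int j')" by simp
    then have "int p dvd int j - int j'" using cop by (simp add: coprime_dvd_mult_right_iff)
    then have "int j mod int p = int j' mod int p" by (simp add: mod_eq_dvd_iff)
    then show ?thesis using lt by simp
  next
    assume "j < p" "\<not> j' < p"
    then show ?thesis using eq np[of a] by (auto simp: hecke_rep_def abcd)
  next
    assume "\<not> j < p" "j' < p"
    then show ?thesis using eq np[of d] by (auto simp: hecke_rep_def abcd)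
  next
    assume "\<not> j < p" "\<not> j' < p"
    then show ?thesis using j by simp
  qed
qed

definition hecke_sum :: "nat \<Rightarrow> int \<Rightarrow> complex \<Rightarrow> nat \<Rightarrow> (complex \<Rightarrow> complex) \<Rightarrow> complex \<Rightarrow> complex" where
  "hecke_sum p N \<kappa> w f z = (\<Sum>j\<le>p. (if j < p then 1 else \<kappa>) * slash w f (hecke_rep p N j) z)"

lemma slash_hecke_sum:
  assumes p: "p > 0" and g: "mdet \<gamma> = 1"
  shows "slash w (hecke_sum p N \<kappa> w f) \<gamma> z =
    (\<Sum>j\<le>p. (if j < p then 1 else \<kappa>) * slash w f (hecke_rep p N j * \<gamma>) z)"
proof -
  have "slash w (hecke_sum p N \<kappa> w f) \<gamma> z =
      (\<Sum>j\<le>p. (if j < p then 1 else \<kappa>) * slash w (slash w f (hecke_rep p N j)) \<gamma> z)"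
    unfolding slash_def[of w "hecke_sum p N \<kappa> w f"] hecke_sum_def
    by (simp add: slash_def[of w "slash w f (hecke_rep p N _)"] sum_divide_distrib)
  then show ?thesis using g p by (simp add: slash_mult)
qed

text \<open>
  The sign \<open>\<kappa>\<close> is the value at \<open>p\<close> of the nebentypus of \<open>f\<close>. It compensates for taking \<open>diag(p, 1)\<close> instead of a
  representative that is congruent to \<open>diag(1, p)\<close> modulo \<open>N\<close>.
\<close>

lemma modform_hecke_sum:
  assumes f: "modform w N f" and p: "prime p" and cop: "coprime (int p) N" and \<kappa>: "\<kappa> * \<kappa> = 1"
    and neb: "\<And>a b c d. mdet (M2 a b c d) = 1 \<Longrightarrow> N dvd b \<Longrightarrow> N dvd c \<Longrightarrow> N dvd a - int p \<or> N dvd d - int p \<Longrightarrow>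
       slash w f (M2 a b c d) = (\<lambda>z. \<kappa> * slash w f 1 z)"
  shows "modform w N (hecke_sum p N \<kappa> w f)"
proof -
  define kap where "kap j = (if j < p then 1 else \<kappa>)" for j
  have p0: "int p > 0" using p prime_gt_0_nat by simp
  have slash_sum: "slash w (hecke_sum p N \<kappa> w f) \<gamma> = (\<lambda>z. \<Sum>j\<le>p. kap j * slash w f (hecke_rep p N j * \<gamma>) z)"
    if g: "mdet \<gamma> = 1" for \<gamma>
    using p0 by (intro ext) (simp only: kap_def slash_hecke_sum[OF _ g] of_nat_0_less_iff)
  show ?thesis
    unfolding modform_def
  proof (intro conjI allI impI)
    have "slash w f (hecke_rep p N j) holomorphic_on uhp" for j
      using f p0 by (intro slash_holomorphic) (auto simp: modform_def)
    then show "hecke_sum p N \<kappa> w f holomorphic_on uhp"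
      unfolding hecke_sum_def[abs_def] by (intro holomorphic_intros)
  next
    fix \<gamma> and c :: real assume g: "mdet \<gamma> = 1" and c: "c > 0"
    have "\<exists>C. \<forall>z. Im z \<ge> c \<longrightarrow> norm (slash w f (hecke_rep p N j * \<gamma>) z) \<le> C" for j
      by (rule modform_bounded[OF f _ c]) (use g p0 in simp)
    then obtain C where C: "\<And>j z. Im z \<ge> c \<Longrightarrow> norm (slash w f (hecke_rep p N j * \<gamma>) z) \<le> C j" by metis
    show "\<exists>C. \<forall>z. Im z \<ge> c \<longrightarrow> norm (slash w (hecke_sum p N \<kappa> w f) \<gamma> z) \<le> C"
      unfolding slash_sum[OF g]
      by (intro exI[of _ "\<Sum>j\<le>p. norm (kap j) * C j"] allI impI order.trans[OF norm_sum] sum_mono)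
         (auto simp: norm_mult intro!: mult_left_mono C)
  next
    fix \<gamma> assume G: "Gamma_N N \<gamma>"
    obtain a b c d where \<gamma>: "\<gamma> = M2 a b c d" by (cases \<gamma>)
    have g: "mdet \<gamma> = 1" using G by (rule Gamma_N_det)
    have cong: "[a = 1] (mod N)" "[b = 0] (mod N)" "[c = 0] (mod N)" "[d = 1] (mod N)"
      using G by (auto simp: \<gamma> cong_iff_dvd_diff cong_0_iff)
    have "\<forall>j. \<exists>i \<delta>. j \<le> p \<longrightarrow> i \<le> p \<and> mdet \<delta> = 1 \<and> hecke_rep p N j * \<gamma> = \<delta> * hecke_rep p N i"
      using hecke_rep_exists[OF p cop, of "hecke_rep p N _ * \<gamma>"] g by (metis hecke_rep_det mdet_mult mult.right_neutral)
    then obtain \<pi> \<delta> where \<pi>: "\<And>j. j \<le> p \<Longrightarrow> \<pi> j \<le> p" "\<And>j. j \<le> p \<Longrightarrow> mdet (\<delta> j) = 1"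
      "\<And>j. j \<le> p \<Longrightarrow> hecke_rep p N j * \<gamma> = \<delta> j * hecke_rep p N (\<pi> j)" by metis
    have inj: "inj_on \<pi> {..p}"
    proof (rule inj_onI)
      fix j j' assume j: "j \<in> {..p}" "j' \<in> {..p}" "\<pi> j = \<pi> j'"
      have "hecke_rep p N j = \<delta> j * hecke_rep p N (\<pi> j) * adj \<gamma>"
        using \<pi>(3)[of j] j mult_adj(1)[OF g] by (metis atMost_iff mult.assoc mult.right_neutral)
      also have "hecke_rep p N (\<pi> j) = adj (\<delta> j') * (hecke_rep p N j' * \<gamma>)"
        using \<pi>(3)[of j'] \<pi>(2)[of j'] j mult_adj(2)[of "\<delta> j'"] by (metis atMost_iff mult.assoc mult.left_neutral)
      also have "\<delta> j * (adj (\<delta> j') * (hecke_rep p N j' * \<gamma>)) * adj \<gamma> = \<delta> j * adj (\<delta> j') * hecke_rep p N j'"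
        using mult_adj(1)[OF g] by (simp add: mult.assoc)
      finally show "j = j'"
        by (intro hecke_rep_unique[OF p cop, of "\<delta> j * adj (\<delta> j')"]) (use j \<pi>(2) in auto)
    qed
    \<comment> \<open>Right multiplication by \<open>\<gamma>\<close> permutes the cosets.\<close>
    have bij: "bij_betw \<pi> {..p} {..p}"
      using inj \<pi>(1) by (intro bij_betw_imageI endo_inj_surj) auto
    have summand: "kap j * slash w f (hecke_rep p N j * \<gamma>) z = kap (\<pi> j) * slash w f (hecke_rep p N (\<pi> j)) z"
      if j: "j \<le> p" for j z
    proof -
      obtain a' b' c' d' where \<delta>: "\<delta> j = M2 a' b' c' d'" by (cases "\<delta> j")
      have det: "a' * d' - b' * c' = 1" using \<pi>(2)[OF j] \<delta> by simp
      have canc: "[x = y] (mod N)" if "[x * int p = y * int p] (mod N)" for x y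
        using that cop by (simp add: cong_mult_rcancel coprime_commute)
      have canc0: "[x = 0] (mod N)" if "[x * int p = 0] (mod N)" for x
        using canc[of x 0] that by simp
      have z1: "[u * (N * v) = 0] (mod N)" "[N * v * u = 0] (mod N)" for u v by (simp_all add: cong_0_iff)
      have dk: "(\<lambda>z. kap j * slash w f (\<delta> j) z) = (\<lambda>z. kap (\<pi> j) * slash w f 1 z)"
      proof (cases "j < p"; cases "\<pi> j < p")
        assume lt: "j < p" "\<pi> j < p"
        then have e: "a' = a + N * int j * c" "a' * (N * int (\<pi> j)) + b' * int p = b + N * int j * d"
          "c' = int p * c" "c' * (N * int (\<pi> j)) + d' * int p = int p * d"
          using \<pi>(3)[OF j] by (simp_all add: hecke_rep_def \<gamma> \<delta>)
        have 1: "[a' = 1] (mod N)" unfolding e using cong_add[OF cong(1) z1(2)] by simp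
        have 2: "[c' = 0] (mod N)" unfolding e using cong_mult[OF cong_refl cong(3)] by simp
        have "b' * int p = b + N * int j * d - a' * (N * int (\<pi> j))" using e(2) by simp
        then have "[b' * int p = 0] (mod N)"
          using cong_diff[OF cong_add[OF cong(2) z1(2)[of "int j" d]] z1(1)[of a' "int (\<pi> j)"]]
          by simp
        then have 3: "[b' = 0] (mod N)" by (rule canc0)
        have "d' * int p = int p * d - c' * (N * int (\<pi> j))" using e(4) by simp
        then have "[d' * int p = 1 * int p] (mod N)"
          using cong_diff[OF cong_mult[OF cong_refl cong(4)] z1(1)[of c' "int (\<pi> j)"], of "int p"]
          by simp
        then have 4: "[d' = 1] (mod N)" by (rule canc)
        have "Gamma_N N (\<delta> j)" using 1 2 3 4 det by (simp add: \<delta> cong_iff_dvd_diff)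
        then show ?thesis using f lt by (simp add: modform_def kap_def)
      next
        assume lt: "j < p" "\<not> \<pi> j < p"
        then have "M2 (a + N * int j * c) (b + N * int j * d) (int p * c) (int p * d) =
            M2 (a' * int p) b' (c' * int p) d'"
          using \<pi>(3)[OF j] by (simp add: hecke_rep_def \<gamma> \<delta> del: mat2.inject)
        then have e: "a' * int p = a + N * int j * c" "b' = b + N * int j * d"
          "c' * int p = int p * c" "d' = int p * d"
          by (simp_all only: mat2.inject)
        have "N dvd b'" unfolding e using cong(2) by (simp add: cong_0_iff)
        moreover have "c' = c" using e(3) p0 by simp
        moreover have "[d' = int p * 1] (mod N)" unfolding e using cong_mult[OF cong_refl cong(4)] by blast
        ultimately have "slash w f (\<delta> j) = (\<lambda>z. \<kappa> * slash w f 1 z)"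
          unfolding \<delta> using cong(3) det by (intro neb) (simp_all add: cong_0_iff cong_iff_dvd_diff)
        then show ?thesis using lt by (simp add: kap_def)
      next
        assume lt: "\<not> j < p" "\<pi> j < p"
        then have e: "a' = int p * a" "a' * (N * int (\<pi> j)) + b' * int p = int p * b"
          "c' = c" "c' * (N * int (\<pi> j)) + d' * int p = d"
          using \<pi>(3)[OF j] by (simp_all add: hecke_rep_def \<gamma> \<delta>)
        have "b' * int p = int p * b - a' * (N * int (\<pi> j))" using e(2) by simp
        then have "[b' * int p = 0] (mod N)"
          using cong_diff[OF cong_mult[OF cong_refl cong(2)] z1(1)[of a' "int (\<pi> j)"], of "int p"]
          by simp
        then have "N dvd b'" using canc0[of b'] unfolding cong_0_iff by blast
        moreover have "[a' = int p * 1] (mod N)" unfolding e using cong_mult[OF cong_refl cong(1)] by blast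
        ultimately have "slash w f (\<delta> j) = (\<lambda>z. \<kappa> * slash w f 1 z)"
          unfolding \<delta> using cong(3) e(3) det by (intro neb) (simp_all add: cong_0_iff cong_iff_dvd_diff)
        then show ?thesis using lt \<kappa> by (simp add: kap_def flip: mult.assoc)
      next
        assume lt: "\<not> j < p" "\<not> \<pi> j < p"
        then have "M2 (int p * a) (int p * b) c d = M2 (a' * int p) b' (c' * int p) d'"
          using \<pi>(3)[OF j] by (simp add: hecke_rep_def \<gamma> \<delta> del: mat2.inject)
        then have e: "a' * int p = int p * a" "b' = int p * b" "c' * int p = c" "d' = d"
          by (simp_all only: mat2.inject)
        have "a' = a" using e(1) p0 by simp
        moreover have "[c' = 0] (mod N)" by (rule canc0) (simp add: e(3) cong)
        moreover have "[b' = 0] (mod N)" unfolding e using cong_mult[OF cong_refl cong(2)] by simp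
        ultimately have "Gamma_N N (\<delta> j)" using det cong e by (simp add: \<delta> cong_iff_dvd_diff)
        then show ?thesis using f lt by (simp add: modform_def kap_def)
      qed
      have "kap j * slash w f (hecke_rep p N j * \<gamma>) z =
          slash w (\<lambda>z. kap j * slash w f (\<delta> j) z) (hecke_rep p N (\<pi> j)) z"
        unfolding \<pi>(3)[OF j] slash_cmult using \<pi>(2)[OF j] p0 by (simp add: slash_mult)
      also have "\<dots> = kap (\<pi> j) * slash w f (hecke_rep p N (\<pi> j)) z"
        unfolding dk slash_cmult using p0 by (simp add: slash_slash_1)
      finally show ?thesis .
    qed
    have "(\<Sum>j\<le>p. kap j * slash w f (hecke_rep p N j * \<gamma>) z) = (\<Sum>j\<le>p. kap j * slash w f (hecke_rep p N j * 1) z)" for z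
    proof -
      have "(\<Sum>j\<le>p. kap j * slash w f (hecke_rep p N j * \<gamma>) z) =
          (\<Sum>j\<le>p. kap (\<pi> j) * slash w f (hecke_rep p N (\<pi> j)) z)"
        by (intro sum.cong refl summand) simp
      also have "\<dots> = (\<Sum>j\<le>p. kap j * slash w f (hecke_rep p N j) z)"
        by (rule sum.reindex_bij_betw[OF bij])
      finally show ?thesis by simp
    qed
    then show "slash w (hecke_sum p N \<kappa> w f) \<gamma> = slash w (hecke_sum p N \<kappa> w f) 1"
      by (simp add: slash_sum g)
  qed
qed

subsection \<open>The action on coefficients\<close>

definition hecke_fps :: "nat \<Rightarrow> nat \<Rightarrow> int \<Rightarrow> int fps \<Rightarrow> int fps" where
  "hecke_fps p w \<kappa> A = Abs_fps (\<lambda>n. A $ (p * n) + (if p dvd n then \<kappa> * int p ^ (w - 1) * A $ (n div p) else 0))"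

lemma hecke_fps_nth: "hecke_fps p w \<kappa> A $ n =
    A $ (p * n) + (if p dvd n then \<kappa> * int p ^ (w - 1) * A $ (n div p) else 0)"
  by (simp add: hecke_fps_def)

lemma sum_roots_of_unity:
  assumes "p > 0"
  shows "(\<Sum>j<p. ee (of_nat j / of_nat p) ^ n) = (if p dvd n then of_nat p else 0)"
proof -
  define \<zeta> where "\<zeta> = ee (of_nat n / of_nat p)"
  have e: "ee (of_nat j / of_nat p) ^ n = \<zeta> ^ j" for j
    by (simp add: \<zeta>_def ee_power mult.commute)
  show ?thesis
  proof (cases "p dvd n")
    case True
    then have "\<zeta> = 1" using assms by (auto simp: \<zeta>_def elim!: dvdE intro!: ee_int)
    then show ?thesis using True by (simp add: e)
  next
    case False
    have "\<zeta> \<noteq> 1"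
    proof
      assume "\<zeta> = 1"
      then obtain k :: int where "(of_nat n :: complex) / of_nat p = of_int k"
        by (auto simp: \<zeta>_def ee_eq_1_iff elim!: Ints_cases)
      then have "(of_nat n :: complex) = of_int (k * int p)" using assms by (simp add: field_simps)
      then have "int n = k * int p" by (metis of_int_eq_iff of_int_of_nat_eq)
      then show False using False by (metis dvd_triv_right int_dvd_int_iff)
    qed
    moreover have "\<zeta> ^ p = 1" using assms by (simp add: \<zeta>_def ee_power ee_int)
    ultimately have "(\<Sum>j<p. \<zeta> ^ j) = 0" by (simp add: geometric_sum)
    then show ?thesis using False by (simp add: e)
  qed
qed

text \<open>
  The average over the \<open>p\<close>-th roots of unity keeps the exponents divisible by \<open>p\<close>. The variable is \<open>y\<^sup>p\<close> because the
  translated terms of the Hecke operator involve a \<open>p\<close>-th root of the local parameter.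
\<close>

lemma hecke_fps_sums:
  assumes A: "conv1 A" and p: "p > 0" and y: "norm y < 1"
  shows "(\<lambda>n. of_int (hecke_fps p w \<kappa> A $ n) * (y ^ p) ^ n) sums
    ((\<Sum>j<p. ev A (ee (of_nat j / of_nat p) * y)) / of_nat p +
      of_int \<kappa> * of_nat p ^ (w - 1) * ev A (y ^ (p * p)))"
proof -
  have mono: "strict_mono (\<lambda>n::nat. p * n)" using p by (simp add: strict_mono_def)
  have notin: "n \<notin> range (\<lambda>n. p * n) \<Longrightarrow> \<not> p dvd n" for n by (auto elim!: dvdE)
  have "(\<lambda>n. of_int (A $ n) * (ee (of_nat j / of_nat p) * y) ^ n) sums ev A (ee (of_nat j / of_nat p) * y)" for j
    by (rule ev_sums[OF A]) (use y in \<open>simp add: norm_mult norm_ee\<close>)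
  then have "(\<lambda>n. \<Sum>j<p. of_int (A $ n) * (ee (of_nat j / of_nat p) * y) ^ n) sums
      (\<Sum>j<p. ev A (ee (of_nat j / of_nat p) * y))"
    by (intro sums_sum)
  also have "(\<lambda>n. \<Sum>j<p. of_int (A $ n) * (ee (of_nat j / of_nat p) * y) ^ n) =
      (\<lambda>n. of_int (A $ n) * y ^ n * (if p dvd n then of_nat p else 0))"
    unfolding sum_roots_of_unity[OF p, symmetric] sum_distrib_left
    by (intro ext sum.cong refl) (simp add: power_mult_distrib mult_ac)
  finally have "(\<lambda>n. of_int (A $ (p * n)) * y ^ (p * n) * of_nat p) sums
      (\<Sum>j<p. ev A (ee (of_nat j / of_nat p) * y))"
    by (subst (asm) sums_mono_reindex[OF mono, symmetric]) (auto dest: notin)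
  from sums_divide[OF this, of "of_nat p"]
  have 1: "(\<lambda>n. of_int (A $ (p * n)) * (y ^ p) ^ n) sums
      ((\<Sum>j<p. ev A (ee (of_nat j / of_nat p) * y)) / of_nat p)"
    using p by (simp add: power_mult)
  have "(\<lambda>n. if p dvd n then of_int (A $ (n div p)) * (y ^ p) ^ n else 0) sums ev A (y ^ (p * p))"
  proof (subst sums_mono_reindex[OF mono, symmetric])
    have "(\<lambda>n. of_int (A $ n) * (y ^ (p * p)) ^ n) sums ev A (y ^ (p * p))"
      by (rule ev_sums[OF A]) (use y p in \<open>simp add: norm_power power_less_one_iff\<close>)
    then show "(\<lambda>n. if p dvd p * n then of_int (A $ (p * n div p)) * (y ^ p) ^ (p * n) else 0) sums ev A (y ^ (p * p))"
      using p by (simp add: power_mult[symmetric] mult_ac)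
  qed (auto dest: notin)
  from sums_mult[OF this, of "of_int \<kappa> * of_nat p ^ (w - 1)"] sums_add[OF 1]
  have "(\<lambda>n. of_int (A $ (p * n)) * (y ^ p) ^ n + of_int \<kappa> * of_nat p ^ (w - 1) *
        (if p dvd n then of_int (A $ (n div p)) * (y ^ p) ^ n else 0)) sums
      ((\<Sum>j<p. ev A (ee (of_nat j / of_nat p) * y)) / of_nat p +
        of_int \<kappa> * of_nat p ^ (w - 1) * ev A (y ^ (p * p)))"
    by blast
  also have "(\<lambda>n. of_int (A $ (p * n)) * (y ^ p) ^ n + of_int \<kappa> * of_nat p ^ (w - 1) *
        (if p dvd n then of_int (A $ (n div p)) * (y ^ p) ^ n else 0)) =
      (\<lambda>n. of_int (hecke_fps p w \<kappa> A $ n) * (y ^ p) ^ n)"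
    by (auto simp: hecke_fps_nth fun_eq_iff distrib_right)
  finally show ?thesis .
qed

lemma conv1_hecke_fps:
  assumes A: "conv1 A" and p: "p > 0"
  shows "conv1 (hecke_fps p w \<kappa> A)"
  unfolding conv1_def fps_conv_radius_def
proof (rule conv_radius_geI_ex)
  fix r :: real assume r: "0 < r" "ereal r < 1"
  define y where "y = complex_of_real (root p r)"
  have "norm y < 1" using r p by (simp add: y_def)
  moreover have "y ^ p = of_real r" using r p by (simp add: y_def flip: of_real_power)
  ultimately show "\<exists>z. norm z = r \<and> summable (\<lambda>n. fps_nth (cfps (hecke_fps p w \<kappa> A)) n * z ^ n)"
    using hecke_fps_sums[OF A p, of y w \<kappa>] r by (intro exI[of _ "y ^ p"]) (auto simp: sums_iff)
qed

lemma ev_hecke_fps: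
  assumes cA: "conv1 A" and N: "N > 0" and w: "w \<ge> 1" and p0: "p > 0" and z: "Im z > 0"
  defines "f \<equiv> \<lambda>z. ev A (ee (z / of_int N))"
  shows "of_nat p ^ (w - 1) * hecke_sum p N (of_int \<kappa>) w f z = ev (hecke_fps p w \<kappa> A) (ee (z / of_int N))"
proof -
  define y where "y = ee (z / (of_int N * of_nat p))"
  have y: "norm y < 1"
    using norm_ee_div[of z "N * int p"] z N p0 by (simp add: y_def)
  have yp: "y ^ p = ee (z / of_int N)" "y ^ (p * p) = ee (of_nat p * z / of_int N)"
    using p0 N by (simp_all add: y_def ee_power)
  have j: "slash w f (hecke_rep p N j) z = ev A (ee (of_nat j / of_nat p) * y) / of_nat p ^ w" if "j < p" for j
  proof -
    have "(z + of_int N * of_nat j) / of_nat p / of_int N = of_nat j / of_nat p + z / (of_int N * of_nat p)"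
      using p0 N by (simp add: field_simps)
    then show ?thesis
      using that z by (simp add: slash_def hecke_rep_def f_def y_def flip: ee_add)
  qed
  have inf: "slash w f (hecke_rep p N p) z = ev A (y ^ (p * p))"
    using z by (simp add: slash_def hecke_rep_def f_def yp)
  have "hecke_sum p N (of_int \<kappa>) w f z = (\<Sum>j<p. ev A (ee (of_nat j / of_nat p) * y) / of_nat p ^ w) +
      of_int \<kappa> * ev A (y ^ (p * p))"
    unfolding hecke_sum_def lessThan_Suc_atMost[symmetric] sum.lessThan_Suc inf
    by (simp add: j)
  also have "of_nat p ^ (w - 1) * \<dots> = (\<Sum>j<p. ev A (ee (of_nat j / of_nat p) * y)) / of_nat p +
      of_int \<kappa> * of_nat p ^ (w - 1) * ev A (y ^ (p * p))"
  proof -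
    have "(of_nat p :: complex) ^ w = of_nat p ^ (w - 1) * of_nat p"
      using w by (metis Suc_diff_1 Suc_le_eq One_nat_def power_Suc2)
    then show ?thesis using p0 by (simp add: distrib_left sum_divide_distrib[symmetric] mult_ac)
  qed
  also have "\<dots> = ev (hecke_fps p w \<kappa> A) (y ^ p)"
  proof -
    have "norm (y ^ p) < 1" using y p0 by (simp add: norm_power power_less_one_iff)
    from ev_sums[OF conv1_hecke_fps[OF cA p0] this] hecke_fps_sums[OF cA p0 y]
    show ?thesis using sums_unique2 by blast
  qed
  finally show ?thesis by (simp add: yp)
qed

lemma intform_hecke_fps:
  assumes A: "intform w N A" and N: "N > 0" and w: "w \<ge> 1" and p: "prime p" "coprime (int p) N"
    and \<kappa>: "\<kappa> = 1 \<or> \<kappa> = (-1 :: int)"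
    and neb: "\<And>a b c d. mdet (M2 a b c d) = 1 \<Longrightarrow> N dvd b \<Longrightarrow> N dvd c \<Longrightarrow> N dvd a - int p \<or> N dvd d - int p \<Longrightarrow>
       slash w (\<lambda>z. ev A (ee (z / of_int N))) (M2 a b c d) =
       (\<lambda>z. of_int \<kappa> * slash w (\<lambda>z. ev A (ee (z / of_int N))) 1 z)"
  shows "intform w N (hecke_fps p w \<kappa> A)"
proof -
  define f where "f z = ev A (ee (z / of_int N))" for z
  have p0: "p > 0" using p prime_gt_0_nat by simp
  have cA: "conv1 A" "modform w N f" using A by (auto simp: intform_def f_def[abs_def])
  have "modform w N (hecke_sum p N (of_int \<kappa>) w f)"
    by (rule modform_hecke_sum[OF cA(2) p]) (use \<kappa> neb in \<open>auto simp: f_def[abs_def]\<close>)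
  then have "modform w N (\<lambda>z. of_nat p ^ (w - 1) * hecke_sum p N (of_int \<kappa>) w f z)"
    by (rule modform_cmult)
  then have "modform w N (\<lambda>z. ev (hecke_fps p w \<kappa> A) (ee (z / of_int N)))"
  proof (rule modform_cong)
    fix z :: complex assume z: "Im z > 0"
    show "of_nat p ^ (w - 1) * hecke_sum p N (of_int \<kappa>) w f z = ev (hecke_fps p w \<kappa> A) (ee (z / of_int N))"
      using ev_hecke_fps[OF cA(1) N w p0 z, of \<kappa>] unfolding f_def[abs_def] .
  qed
  then show ?thesis using conv1_hecke_fps[OF cA(1) p0] by (simp add: intform_def)
qed

lemma intform_hecke_fps_principal:
  assumes A: "intform w N A" and N: "N > 0" and w: "w \<ge> 1" and Q: "prime Q" "N dvd int Q - 1"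
  shows "intform w N (hecke_fps Q w 1 A)"
proof (rule intform_hecke_fps[OF A N w Q(1)])
  show "coprime (int Q) N"
    by (rule coprime_divisors[OF dvd_refl Q(2)]) (subst coprime_commute, rule coprime_diff_one_left)
  fix a b c d assume *: "mdet (M2 a b c d) = 1" "N dvd b" "N dvd c" "N dvd a - int Q \<or> N dvd d - int Q"
  have bc: "N dvd b * c" using * by simp
  have "[a * d = 1] (mod N)"
  proof -
    have "a * d - 1 = b * c" using * by simp
    then show ?thesis using bc by (simp add: cong_iff_dvd_diff)
  qed
  moreover have "[a = 1] (mod N) \<or> [d = 1] (mod N)"
    using *(4) Q(2) by (metis cong_iff_dvd_diff cong_trans)
  ultimately have "[a = 1] (mod N) \<and> [d = 1] (mod N)"
    by (metis cong_mult cong_refl cong_sym cong_trans mult.left_neutral mult.right_neutral)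
  then have "Gamma_N N (M2 a b c d)" using * by (simp add: cong_iff_dvd_diff)
  then show "slash w (\<lambda>z. ev A (ee (z / of_int N))) (M2 a b c d) =
       (\<lambda>z. of_int 1 * slash w (\<lambda>z. ev A (ee (z / of_int N))) 1 z)"
    using A by (simp add: intform_def modform_def)
qed simp

subsection \<open>Periodicity of the powers of a Hecke operator modulo \<open>m\<close>\<close>

text \<open>
  The Hecke operators of index \<open>Q\<^sup>i\<close> applied to \<open>A\<close>.
\<close>

fun hecke_seq :: "nat \<Rightarrow> nat \<Rightarrow> int fps \<Rightarrow> nat \<Rightarrow> int fps" where
  "hecke_seq Q w A 0 = A"
| "hecke_seq Q w A (Suc 0) = hecke_fps Q w 1 A"
| "hecke_seq Q w A (Suc (Suc i)) =
     hecke_fps Q w 1 (hecke_seq Q w A (Suc i)) - fps_const (int Q ^ (w - 1)) * hecke_seq Q w A i"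

lemma hecke_seq_nth:
  assumes "Q > 0"
  shows "hecke_seq Q w A (Suc i) $ n =
    A $ (Q ^ Suc i * n) + (if Q dvd n then int Q ^ (w - 1) * hecke_seq Q w A i $ (n div Q) else 0)"
proof (induction i arbitrary: n)
  case 0
  then show ?case by (simp add: hecke_fps_nth)
next
  case (Suc i)
  have "hecke_seq Q w A (Suc i) $ (Q * n) = A $ (Q ^ Suc (Suc i) * n) + int Q ^ (w - 1) * hecke_seq Q w A i $ n"
    using Suc[of "Q * n"] assms by (simp add: mult_ac)
  then show ?case by (simp add: hecke_fps_nth)
qed

lemma intform_hecke_seq:
  assumes "intform w N A" "N > 0" "w \<ge> 1" "prime Q" "N dvd int Q - 1"
  shows "intform w N (hecke_seq Q w A i) \<and> intform w N (hecke_seq Q w A (Suc i))"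
  by (induction i)
     (use assms in \<open>auto intro!: intform_diff_scaled intform_hecke_fps_principal\<close>)

lemma cong_hecke_fps:
  fixes A B :: "int fps"
  assumes "\<And>n. [A $ n = B $ n] (mod m)"
  shows "[hecke_fps Q w \<kappa> A $ n = hecke_fps Q w \<kappa> B $ n] (mod m)"
  using assms by (auto simp: hecke_fps_nth intro!: cong_add cong_mult cong_refl)

text \<open>
  The recursion for the Hecke operators of prime power index runs on finitely many pairs of forms modulo \<open>m\<close>
  and is reversible because \<open>Q\<close> is invertible. The orbit of \<open>(0, A)\<close>, whose first entry is zero, therefore returns to \<open>(0, A)\<close>.
  On indices prime to \<open>Q\<close> the Hecke operator of index \<open>Q\<^sup>i\<close> just picks the coefficient at \<open>Q\<^sup>i n\<close>.
\<close>

theorem hecke_annihilation: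
  fixes A :: "int fps" and m :: int
  assumes A: "intform w N A" and N: "N > 0" and w: "w \<ge> 1" and Q: "prime Q" "N dvd int Q - 1"
    and m: "m > 0" and cop: "coprime (int Q) m"
  shows "\<exists>i. \<forall>n. \<not> Q dvd n \<longrightarrow> m dvd A $ (Q ^ i * n)"
proof -
  define x where "x = hecke_seq Q w A"
  define q where "q = int Q ^ (w - 1)"
  define eqv where "eqv a b \<longleftrightarrow> (\<forall>n. [a $ n = b $ n] (mod m))" for a b :: "int fps"
  define red :: "int fps \<Rightarrow> nat \<Rightarrow> int" where "red a = (\<lambda>n. a $ n mod m)" for a
  have red: "red a = red b \<longleftrightarrow> eqv a b" for a b
    by (auto simp: red_def eqv_def cong_def fun_eq_iff)
  have Q0: "Q > 0" using Q prime_gt_0_nat by simp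
  have copq: "coprime q m" using cop by (simp add: q_def)
  have xform: "intform w N (x i)" for i
    unfolding x_def using intform_hecke_seq[OF A N w Q] by blast
  have fin: "finite (red ` {a. intform w N a})"
    unfolding red_def
  proof (rule finite_reductions[where I = "{..<nat N * (w * nat N ^ 4 + 1)}"])
    show "a = 0" if "a \<in> {a. intform w N a}" "\<And>i. i \<in> {..<nat N * (w * nat N ^ 4 + 1)} \<Longrightarrow> a $ i = 0" for a
      using intform_vanishing[of w N a] that N w by auto
  qed (use m N in \<open>auto intro: intform_diff_scaled\<close>)
  define P where "P i = (red (x i), red (x (Suc i)))" for i
  have "range P \<subseteq> red ` {a. intform w N a} \<times> red ` {a. intform w N a}"
    using xform by (auto simp: P_def)
  then have "finite (range P)" using fin finite_subset by blast
  then have "\<not> inj P" using finite_imageD infinite_UNIV_nat by blast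
  then obtain i j where ij: "i < j" "P i = P j" by (metis injI linorder_neqE_nat)
  define d where "d = j - i"
  have step: "q * x i $ n = hecke_fps Q w 1 (x (Suc i)) $ n - x (Suc (Suc i)) $ n" for i n
    by (simp add: x_def q_def)
  have cancel: "eqv a b" if "\<And>n. [q * fps_nth a n = q * fps_nth b n] (mod m)" for a b
    using that copq by (simp add: eqv_def cong_mult_lcancel)
  have backward: "P i = P (i + d) \<Longrightarrow> P 0 = P d" for i
  proof (induction i)
    case (Suc i)
    then have e: "eqv (x (Suc i)) (x (Suc (i + d)))" "eqv (x (Suc (Suc i))) (x (Suc (Suc (i + d))))"
      by (simp_all add: P_def red)
    have "eqv (x i) (x (i + d))"
      by (rule cancel, unfold step, intro cong_diff cong_hecke_fps) (use e in \<open>auto simp: eqv_def\<close>)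
    then show ?case using e Suc.IH by (simp add: P_def red)
  qed simp
  have "P 0 = P d" by (rule backward[of i]) (use ij in \<open>simp add: d_def\<close>)
  then have e: "eqv (x 0) (x d)" "eqv (x 1) (x (Suc d))" by (simp_all add: P_def red)
  obtain k where k: "d = Suc k" using ij by (metis d_def Suc_pred zero_less_diff)
  have "[q * x k $ n = q * 0 $ n] (mod m)" for n
  proof -
    have "[hecke_fps Q w 1 (x (Suc k)) $ n - x (Suc (Suc k)) $ n =
        hecke_fps Q w 1 (x 0) $ n - x 1 $ n] (mod m)"
      by (intro cong_diff cong_hecke_fps) (use e k in \<open>auto simp: eqv_def intro: cong_sym\<close>)
    moreover have "hecke_fps Q w 1 (x 0) $ n - x 1 $ n = 0" by (simp add: x_def)
    ultimately show ?thesis by (simp add: step)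
  qed
  then have "eqv (x k) 0" by (rule cancel)
  then have xk: "m dvd x k $ n" for n by (simp add: eqv_def cong_0_iff)
  have "m dvd A $ (Q ^ k * n)" if "\<not> Q dvd n" for n
  proof (cases k)
    case 0
    then show ?thesis using xk[of n] by (simp add: x_def)
  next
    case (Suc k')
    then show ?thesis using xk[of n] hecke_seq_nth[OF Q0, of w A k' n] that by (simp add: x_def)
  qed
  then show ?thesis by blast
qed

section \<open>Regular partitions and formal power series\<close>

subsection \<open>Partitions with parts in a finite set\<close>

definition parts_in :: "nat set \<Rightarrow> nat \<Rightarrow> nat multiset set" where
  "parts_in S n = {p. set_mset p \<subseteq> S \<and> sum_mset p = n}"

definition parts_fps :: "nat set \<Rightarrow> int fps" where
  "parts_fps S = Abs_fps (\<lambda>n. int (card (parts_in S n)))"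

lemma finite_parts_in: "0 \<notin> S \<Longrightarrow> finite (parts_in S n)"
  by (rule finite_subset[OF _ finite_partitions[of n]]) (auto simp: parts_in_def partitions_def)

text \<open>
  Removing one copy of \<open>i\<close> is a bijection from the partitions of \<open>n\<close> that contain \<open>i\<close> to the partitions of \<open>n - i\<close>.
\<close>

lemma parts_fps_insert:
  assumes S: "0 \<notin> S" and i: "i > 0" "i \<notin> S"
  shows "parts_fps (insert i S) * (1 - fps_X ^ i) = parts_fps S"
proof (rule fps_ext)
  fix n
  have S': "0 \<notin> insert i S" using S i by simp
  have "card (parts_in (insert i S) n) =
      card (parts_in S n) + (if i \<le> n then card (parts_in (insert i S) (n - i)) else 0)"
  proof -
    have split: "parts_in (insert i S) n = parts_in S n \<union> {p \<in> parts_in (insert i S) n. i \<in># p}"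
      using i by (auto simp: parts_in_def)
    have disj: "parts_in S n \<inter> {p \<in> parts_in (insert i S) n. i \<in># p} = {}"
      using i by (auto simp: parts_in_def)
    have "card {p \<in> parts_in (insert i S) n. i \<in># p} =
        (if i \<le> n then card (parts_in (insert i S) (n - i)) else 0)"
    proof (cases "i \<le> n")
      case True
      have "bij_betw (\<lambda>p. add_mset i p) (parts_in (insert i S) (n - i)) {p \<in> parts_in (insert i S) n. i \<in># p}"
      proof (rule bij_betw_byWitness[where f' = "\<lambda>p. p - {#i#}"])
        show "(\<lambda>p. p - {#i#}) ` {p \<in> parts_in (insert i S) n. i \<in># p} \<subseteq> parts_in (insert i S) (n - i)"
        proof
          fix q assume "q \<in> (\<lambda>p. p - {#i#}) ` {p \<in> parts_in (insert i S) n. i \<in># p}"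
          then obtain p where p: "q = p - {#i#}" "p \<in> parts_in (insert i S) n" "i \<in># p" by auto
          then obtain r where r: "p = add_mset i r" by (metis insert_DiffM)
          then show "q \<in> parts_in (insert i S) (n - i)" using p by (auto simp: parts_in_def)
        qed
      qed (use True in \<open>auto simp: parts_in_def\<close>)
      from bij_betw_same_card[OF this] show ?thesis using True by simp
    next
      case False
      have "\<not> i \<in># p" if "p \<in> parts_in (insert i S) n" for p
      proof
        assume "i \<in># p"
        then obtain r where "p = add_mset i r" by (metis insert_DiffM)
        then show False using that False by (simp add: parts_in_def)
      qed
      then have empty: "{p \<in> parts_in (insert i S) n. i \<in># p} = {}" by blast
      show ?thesis unfolding empty using False by simp
    qed
    then show ?thesis
      using card_Un_disjoint[OF finite_parts_in[OF S, of n] _ disj] finite_parts_in[OF S', of n]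
      by (subst split) simp
  qed
  moreover have "(parts_fps (insert i S) * fps_X ^ i) $ n =
      (if i \<le> n then int (card (parts_in (insert i S) (n - i))) else 0)"
    by (simp add: fps_X_power_mult_right_nth parts_fps_def)
  ultimately show "(parts_fps (insert i S) * (1 - fps_X ^ i)) $ n = parts_fps S $ n"
    by (simp add: right_diff_distrib parts_fps_def)
qed

lemma parts_fps_prod:
  assumes "finite S" "0 \<notin> S"
  shows "parts_fps S * (\<Prod>i\<in>S. 1 - fps_X ^ i) = 1"
  using assms
proof (induction S rule: finite_induct)
  case empty
  have "parts_in {} n = (if n = 0 then {{#}} else {})" for n by (auto simp: parts_in_def)
  then show ?case by (simp add: parts_fps_def fps_eq_iff)
next
  case (insert i S)
  have "parts_fps (insert i S) * (\<Prod>i\<in>insert i S. 1 - fps_X ^ i) =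
      (parts_fps (insert i S) * (1 - fps_X ^ i)) * (\<Prod>i\<in>S. 1 - fps_X ^ i)"
    using insert.hyps by (simp add: mult.assoc)
  also have "\<dots> = 1"
    using insert parts_fps_insert[of S i] by simp
  finally show ?case .
qed

subsection \<open>Agreement up to a given degree\<close>

definition agree :: "nat \<Rightarrow> int fps \<Rightarrow> int fps \<Rightarrow> bool" where
  "agree n A B \<longleftrightarrow> (\<forall>i\<le>n. A $ i = B $ i)"

lemma agree_refl [simp]: "agree n A A"
  and agree_sym: "agree n A B \<Longrightarrow> agree n B A"
  and agree_trans: "agree n A B \<Longrightarrow> agree n B C \<Longrightarrow> agree n A C"
  by (auto simp: agree_def)

lemma agree_mult: "agree n A B \<Longrightarrow> agree n C D \<Longrightarrow> agree n (A * C) (B * D)"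
  by (auto simp: agree_def fps_mult_nth intro!: sum.cong)

lemma agree_power: "agree n A B \<Longrightarrow> agree n (A ^ k) (B ^ k)"
  by (induction k) (auto intro: agree_mult)

lemma agree_all_eq: "(\<And>n. agree n A B) \<Longrightarrow> A = B"
  by (auto simp: agree_def fps_eq_iff)

definition euler_prod :: "nat \<Rightarrow> int fps" where
  "euler_prod n = (\<Prod>i\<in>{1..n}. 1 - fps_X ^ i)"

text \<open>
  The factors beyond the \<open>n\<close>-th do not change the coefficient of index \<open>n\<close>.
\<close>

definition euler_fps :: "int fps" where
  "euler_fps = Abs_fps (\<lambda>n. euler_prod n $ n)"

lemma agree_one_minus: "n < i \<Longrightarrow> agree n (1 - fps_X ^ i) 1"
  by (auto simp: agree_def)

lemma agree_euler_prod_mono: "n \<le> N \<Longrightarrow> agree n (euler_prod N) (euler_prod n)"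
proof (induction N rule: dec_induct)
  case (step N)
  have "agree n (euler_prod N * (1 - fps_X ^ Suc N)) (euler_prod n * 1)"
    by (rule agree_mult[OF step.IH agree_one_minus]) (use step in simp)
  then show ?case by (simp add: euler_prod_def)
qed simp

lemma agree_euler_fps: "n \<le> N \<Longrightarrow> agree n euler_fps (euler_prod N)"
proof -
  assume n: "n \<le> N"
  have "euler_fps $ i = euler_prod N $ i" if "i \<le> n" for i
    using agree_euler_prod_mono[of i N] that n by (simp add: euler_fps_def agree_def)
  then show ?thesis by (simp add: agree_def)
qed

definition stretch :: "nat \<Rightarrow> int fps \<Rightarrow> int fps" where
  "stretch k A = fps_compose A (fps_X ^ k)"

lemma stretch_nth: "k > 0 \<Longrightarrow> stretch k A $ n = (if k dvd n then A $ (n div k) else 0)"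
  unfolding stretch_def by (rule fps_nth_compose_X_power)

lemma stretch_mult: "k > 0 \<Longrightarrow> stretch k (A * B) = stretch k A * stretch k B"
  unfolding stretch_def by (rule fps_compose_mult_distrib) (simp add: fps_X_power_nth)
lemma stretch_1 [simp]: "stretch k 1 = 1" by (simp add: stretch_def)
lemma stretch_power: "k > 0 \<Longrightarrow> stretch k (A ^ n) = stretch k A ^ n"
  by (induction n) (simp_all add: stretch_mult)
lemma stretch_one_minus: "k > 0 \<Longrightarrow> stretch k (1 - fps_X ^ i) = 1 - fps_X ^ (k * i)"
  by (auto simp: fps_eq_iff stretch_nth elim!: dvdE)
lemma stretch_stretch: "k > 0 \<Longrightarrow> l > 0 \<Longrightarrow> stretch k (stretch l A) = stretch (k * l) A"
  by (auto simp: fps_eq_iff stretch_nth dvd_div_iff_mult mult.commute div_mult2_eq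
      elim: dvd_mult_left dest: dvd_mult_left dvd_mult_right)

lemma agree_stretch: "k > 0 \<Longrightarrow> agree n A B \<Longrightarrow> agree n (stretch k A) (stretch k B)"
  by (auto simp: agree_def stretch_nth intro: div_le_dividend order.trans)

lemma stretch_euler_prod: "k > 0 \<Longrightarrow> stretch k (euler_prod n) = (\<Prod>i\<in>{1..n}. 1 - fps_X ^ (k * i))"
  unfolding euler_prod_def
proof (induction n)
  case (Suc n)
  have "stretch k (\<Prod>i = 1..Suc n. 1 - fps_X ^ i) =
      stretch k (\<Prod>i = 1..n. 1 - fps_X ^ i) * stretch k (1 - fps_X ^ Suc n)"
    using Suc.prems by (simp only: prod.nat_ivl_Suc' stretch_mult[symmetric] mult.commute le_add1 plus_1_eq_Suc)
  also have "\<dots> = (\<Prod>i = 1..Suc n. 1 - fps_X ^ (k * i))"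
    unfolding stretch_one_minus[OF Suc.prems] Suc.IH[OF Suc.prems] by (simp add: prod.nat_ivl_Suc' mult.commute)
  finally show ?case .
qed simp

subsection \<open>The generating function of regular partitions\<close>

definition regular_fps :: "nat \<Rightarrow> int fps" where
  "regular_fps k = Abs_fps (\<lambda>n. int (num_regular_partitions k n))"

text \<open>
  Up to degree \<open>n\<close> only parts up to \<open>kn\<close> matter. Among the factors \<open>1 - x\<^sup>i\<close> with \<open>i \<le> kn\<close>, those with \<open>k\<close> not dividing \<open>i\<close>
  cancel against the generating function and the others form the stretched product.
\<close>

theorem regular_fps_euler:
  assumes k: "k > 0"
  shows "regular_fps k * euler_fps = stretch k euler_fps"
proof (rule agree_all_eq)
  fix n
  define S where "S = {i \<in> {1..k * n}. \<not> k dvd i}"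
  define D where "D = {i \<in> {1..k * n}. k dvd i}"
  have "regular_partitions k i = parts_in S i" if i: "i \<le> n" for i
  proof -
    have kn: "i \<le> k * n" using i k by (cases k) auto
    have "x \<in> S" if "p \<in> regular_partitions k i" "x \<in># p" for p x
    proof -
      have "x \<le> sum_mset p" using that(2) by (metis insert_DiffM le_add1 sum_mset.add_mset)
      then show ?thesis using that kn
        by (auto simp: regular_partitions_def partitions_def S_def Suc_le_eq intro: Nat.gr0I)
    qed
    then show ?thesis
      by (auto simp: regular_partitions_def partitions_def parts_in_def S_def)
  qed
  then have 1: "agree n (regular_fps k) (parts_fps S)"
    by (simp add: agree_def regular_fps_def parts_fps_def num_regular_partitions_def)
  have "{1..k * n} = S \<union> D" "S \<inter> D = {}" by (auto simp: S_def D_def)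
  then have prod_split: "euler_prod (k * n) = (\<Prod>i\<in>S. 1 - fps_X ^ i) * (\<Prod>i\<in>D. 1 - fps_X ^ i)"
    unfolding euler_prod_def by (metis finite_Un finite_atLeastAtMost prod.union_disjoint)
  have D: "(\<Prod>i\<in>D. 1 - fps_X ^ i) = stretch k (euler_prod n)"
    unfolding stretch_euler_prod[OF k]
    by (rule prod.reindex_bij_witness[of _ "\<lambda>i. k * i" "\<lambda>i. i div k"])
       (use k in \<open>auto simp: D_def Suc_le_eq elim!: dvdE\<close>)
  have "agree n euler_fps (euler_prod (k * n))" by (rule agree_euler_fps) (use k in simp)
  then have "agree n (regular_fps k * euler_fps) (parts_fps S * euler_prod (k * n))"
    by (rule agree_mult[OF 1])
  also have "parts_fps S * euler_prod (k * n) = stretch k (euler_prod n)"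
    using parts_fps_prod[of S] by (simp add: prod_split D S_def flip: mult.assoc)
  finally show "agree n (regular_fps k * euler_fps) (stretch k euler_fps)"
    using agree_stretch[OF k agree_sym[OF agree_euler_fps[of n n]]] agree_trans by blast
qed

subsection \<open>Congruences between power series\<close>

definition fcong :: "nat \<Rightarrow> int fps \<Rightarrow> int fps \<Rightarrow> bool" where
  "fcong m A B \<longleftrightarrow> (\<forall>n. int m dvd A $ n - B $ n)"

lemma fcong_refl [simp]: "fcong m A A" by (simp add: fcong_def)
lemma fcong_sym: "fcong m A B \<Longrightarrow> fcong m B A"
  by (simp add: fcong_def dvd_diff_commute)
lemma fcong_trans: "fcong m A B \<Longrightarrow> fcong m B C \<Longrightarrow> fcong m A C"
  unfolding fcong_def
proof
  fix n assume "\<forall>n. int m dvd A $ n - B $ n" "\<forall>n. int m dvd B $ n - C $ n"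
  then have "int m dvd (A $ n - B $ n) + (B $ n - C $ n)" by (intro dvd_add) auto
  then show "int m dvd A $ n - C $ n" by simp
qed

lemma fcong_mult:
  assumes "fcong m A B" "fcong m C D"
  shows "fcong m (A * C) (B * D)"
  unfolding fcong_def
proof
  fix n
  have "(A * C) $ n - (B * D) $ n = (\<Sum>i=0..n. (A $ i - B $ i) * C $ (n - i) + B $ i * (C $ (n - i) - D $ (n - i)))"
    by (simp add: fps_mult_nth sum_subtractf[symmetric] algebra_simps)
  also have "int m dvd \<dots>"
  proof (rule dvd_sum)
    fix i
    have "int m dvd A $ i - B $ i" "int m dvd C $ (n - i) - D $ (n - i)"
      using assms unfolding fcong_def by blast+
    then show "int m dvd (A $ i - B $ i) * C $ (n - i) + B $ i * (C $ (n - i) - D $ (n - i))"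
      by (intro dvd_add dvd_mult2[of _ "A $ i - B $ i"] dvd_mult[of _ "C $ (n - i) - D $ (n - i)"])
  qed
  finally show "int m dvd (A * C) $ n - (B * D) $ n" .
qed

lemma fcong_prod: "finite S \<Longrightarrow> (\<And>i. i \<in> S \<Longrightarrow> fcong m (f i) (g i)) \<Longrightarrow> fcong m (\<Prod>i\<in>S. f i) (\<Prod>i\<in>S. g i)"
  by (induction S rule: finite_induct) (auto intro: fcong_mult)

lemma fcong_stretch: "k > 0 \<Longrightarrow> fcong m A B \<Longrightarrow> fcong m (stretch k A) (stretch k B)"
  by (auto simp: fcong_def stretch_nth)

text \<open>The Frobenius map modulo \<open>m\<close>.\<close>

lemma one_minus_power_fcong:
  assumes m: "prime m" "odd m"
  shows "fcong m ((1 - fps_X ^ i) ^ m) (1 - fps_X ^ (m * i))"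
proof -
  define y :: "int fps" where "y = - (fps_X ^ i)"
  have m1: "m > 1" using m prime_gt_1_nat by blast
  have "(y + 1) ^ m = (\<Sum>k\<le>m. of_nat (m choose k) * y ^ k)"
    by (simp add: binomial_ring)
  also have "{..m} = {0, m} \<union> {0<..<m}" using m1 by auto
  also have "(\<Sum>k\<in>{0, m} \<union> {0<..<m}. of_nat (m choose k) * y ^ k) =
      (\<Sum>k\<in>{0, m}. of_nat (m choose k) * y ^ k) + (\<Sum>k\<in>{0<..<m}. of_nat (m choose k) * y ^ k)"
    by (rule sum.union_disjoint) auto
  also have "(\<Sum>k\<in>{0, m}. of_nat (m choose k) * y ^ k) = 1 + y ^ m" using m1 by simp
  also have "y ^ m = - (fps_X ^ (m * i))"
    using m(2) by (simp add: y_def power_mult[symmetric] mult.commute)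
  finally have e: "(1 - fps_X ^ i) ^ m = (1 - fps_X ^ (m * i)) + (\<Sum>k\<in>{0<..<m}. of_nat (m choose k) * y ^ k)"
    by (simp add: y_def add.commute)
  have "int m dvd (of_nat (m choose k) * y ^ k) $ n" if "k \<in> {0<..<m}" for k n
  proof -
    have "m dvd m choose k" using that m(1) by (intro dvd_choose_prime) auto
    then have "int m dvd int (m choose k)" by simp
    moreover have "(of_nat (m choose k) * y ^ k) $ n = int (m choose k) * (y ^ k) $ n"
      by (metis fps_mult_left_const_nth fps_of_nat)
    ultimately show ?thesis by simp
  qed
  then show ?thesis unfolding fcong_def e by (auto simp: fps_sum_nth intro!: dvd_sum)
qed

lemma euler_fps_power_fcong:
  assumes m: "prime m" "odd m"
  shows "fcong m (euler_fps ^ m) (stretch m euler_fps)"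
  unfolding fcong_def
proof
  fix n
  have m0: "m > 0" using m prime_gt_0_nat by blast
  have "fcong m (euler_prod n ^ m) (stretch m (euler_prod n))"
    unfolding stretch_euler_prod[OF m0] unfolding euler_prod_def prod_power_distrib
    by (intro fcong_prod one_minus_power_fcong m) simp
  moreover have "(euler_fps ^ m) $ n = (euler_prod n ^ m) $ n"
    using agree_power[OF agree_euler_fps[of n n]] by (auto simp: agree_def)
  moreover have "stretch m euler_fps $ n = stretch m (euler_prod n) $ n"
    using agree_stretch[OF m0 agree_euler_fps[of n n]] by (auto simp: agree_def)
  ultimately show "int m dvd (euler_fps ^ m) $ n - stretch m euler_fps $ n"
    by (simp add: fcong_def)
qed

lemma euler_fps_nth_0: "euler_fps $ 0 = 1"
  by (simp add: euler_fps_def euler_prod_def)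

definition euler_inv :: "int fps" where "euler_inv = fps_left_inverse euler_fps 1"

lemma euler_inv_mult: "euler_inv * euler_fps = 1"
  unfolding euler_inv_def by (rule fps_left_inverse) (simp add: euler_fps_nth_0)

section \<open>Evaluation of the Euler series\<close>

lemma conv1_euler_prod: "conv1 (euler_prod n)"
  unfolding euler_prod_def
  by (induction n) (simp_all add: conv1_1 conv1_mult conv1_diff conv1_X_power prod.nat_ivl_Suc' del: power_Suc)

lemma ev_euler_prod: "norm x < 1 \<Longrightarrow> ev (euler_prod n) x = (\<Prod>i<n. 1 - x ^ Suc i * 1)"
proof (induction n)
  case (Suc n)
  have "euler_prod (Suc n) = euler_prod n * (1 - fps_X ^ Suc n)"
    by (simp add: euler_prod_def prod.nat_ivl_Suc' mult.commute)
  then show ?case using Suc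
    by (simp add: ev_mult ev_diff ev_1 ev_X_power conv1_euler_prod conv1_diff conv1_1 conv1_X_power del: power_Suc)
qed (simp add: euler_prod_def ev_1)

lemma euler_phi_uniform_limit:
  "uniform_limit (cball 0 (1/2)) (\<lambda>N q. \<Prod>n<N. 1 - q ^ Suc n * 1) euler_phi sequentially"
proof -
  have "uniformly_convergent_on (cball 0 (1/2)) (\<lambda>N q. \<Sum>n<N. norm (- (q ^ Suc n * 1) :: complex))"
  proof (rule Weierstrass_m_test'[of _ _ "\<lambda>n. (1/2) ^ Suc n"])
    fix n and x :: complex assume "x \<in> cball 0 (1/2)"
    then have "norm x ^ Suc n \<le> (1/2) ^ Suc n" by (intro power_mono) auto
    then show "norm (norm (- (x ^ Suc n * 1))) \<le> (1/2) ^ Suc n" by (simp add: norm_power norm_mult)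
  qed (simp add: summable_mult)
  then have "uniformly_convergent_on (cball 0 (1/2)) (\<lambda>N q::complex. \<Prod>n<N. 1 + - (q ^ Suc n * 1))"
    by (intro uniformly_convergent_on_prod compact_cball continuous_intros)
  then have "\<exists>l. uniform_limit (cball 0 (1/2)) (\<lambda>N q::complex. \<Prod>n<N. 1 - q ^ Suc n * 1) l sequentially"
    by (simp add: uniformly_convergent_on_def)
  then obtain l where l: "uniform_limit (cball 0 (1/2)) (\<lambda>N q::complex. \<Prod>n<N. 1 - q ^ Suc n * 1) l sequentially"
    by blast
  have "l q = euler_phi q" if "q \<in> cball 0 (1/2)" for q
  proof -
    have "(\<lambda>N. \<Prod>n<N. 1 - q ^ Suc n * 1) \<longlonglongrightarrow> l q" by (rule tendsto_uniform_limitI[OF l that])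
    moreover have "(\<lambda>N. \<Prod>n<N. 1 - q ^ Suc n * 1) \<longlonglongrightarrow> euler_phi q"
      unfolding euler_phi_def by (rule qpoch_LIMSEQ) (use that in auto)
    ultimately show ?thesis by (rule LIMSEQ_unique)
  qed
  then show ?thesis by (intro iffD1[OF uniform_limit_cong' l]) auto
qed

text \<open>
  The partial products converge uniformly on a disc, so by Cauchy's inequalities their Taylor coefficients converge, and
  each coefficient is eventually constant.
\<close>

lemma cfps_euler_fps: "cfps euler_fps = fps_expansion euler_phi 0"
proof (rule fps_ext)
  fix n
  let ?p = "\<lambda>N q. (\<Prod>i<N. 1 - q ^ Suc i * 1 :: complex)"
  have coeff: "(deriv ^^ n) (?p N) 0 / fact n = of_int (euler_fps $ n)" if "n \<le> N" for N
  proof -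
    have "(?p N) has_fps_expansion cfps (euler_prod N)"
      unfolding has_fps_expansion_def
    proof
      show "fps_conv_radius (cfps (euler_prod N)) > 0"
        by (rule less_le_trans[OF _ conv1_euler_prod[of N, unfolded conv1_def]]) simp
      have "eventually (\<lambda>x. x \<in> ball 0 1) (nhds (0::complex))" by (rule eventually_nhds_in_open) auto
      then show "eventually (\<lambda>z. eval_fps (cfps (euler_prod N)) z = ?p N z) (nhds 0)"
        by eventually_elim (use ev_euler_prod in \<open>auto simp: ev_def\<close>)
    qed
    from fps_nth_fps_expansion[OF this, of n]
    have "(deriv ^^ n) (?p N) 0 / fact n = of_int (euler_prod N $ n)" by simp
    moreover have "euler_prod N $ n = euler_fps $ n"
      using agree_euler_fps[OF that] by (auto simp: agree_def)
    ultimately show ?thesis by simp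
  qed
  have hol: "euler_phi holomorphic_on ball 0 (1/2)" "continuous_on (cball 0 (1/2)) euler_phi"
    using euler_phi_holomorphic
    by (auto intro!: holomorphic_on_imp_continuous_on intro: holomorphic_on_subset)
  have bnd: "norm (of_int (euler_fps $ n) - (deriv ^^ n) euler_phi 0 / fact n) \<le> e" if e: "e > 0" for e :: real
  proof -
    define d where "d = e * (1/2) ^ n"
    have "d > 0" using e by (simp add: d_def)
    have "eventually (\<lambda>N. \<forall>q\<in>cball 0 (1/2). dist (?p N q) (euler_phi q) < d) sequentially"
      using euler_phi_uniform_limit \<open>d > 0\<close> by (simp add: uniform_limit_iff)
    then obtain N0 where N0: "\<And>N q. N \<ge> N0 \<Longrightarrow> q \<in> cball 0 (1/2) \<Longrightarrow> dist (?p N q) (euler_phi q) < d"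
      unfolding eventually_sequentially by blast
    define N where "N = max N0 n"
    have holp: "(\<lambda>q. ?p N q) holomorphic_on S" for S by (intro holomorphic_intros)
    have "norm ((deriv ^^ n) (\<lambda>q. ?p N q - euler_phi q) 0) \<le> fact n * d / (1/2) ^ n"
    proof (rule Cauchy_inequality)
      show "(\<lambda>q. ?p N q - euler_phi q) holomorphic_on ball 0 (1/2)"
        by (intro holomorphic_on_diff holp hol)
      show "continuous_on (cball 0 (1/2)) (\<lambda>q. ?p N q - euler_phi q)"
        by (intro continuous_on_diff holomorphic_on_imp_continuous_on[OF holp] hol)
      show "norm (?p N x - euler_phi x) \<le> d" if "norm (0 - x) = 1/2" for x
        using N0[of N x] that by (auto simp: N_def dist_norm less_imp_le)
    qed simp
    moreover have "(deriv ^^ n) (\<lambda>q. ?p N q - euler_phi q) 0 = (deriv ^^ n) (?p N) 0 - (deriv ^^ n) euler_phi 0"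
      by (rule higher_deriv_diff[OF holp hol(1)]) auto
    ultimately have "norm ((deriv ^^ n) (?p N) 0 - (deriv ^^ n) euler_phi 0) \<le> fact n * d / (1/2) ^ n"
      by (simp only:)
    then have "norm ((deriv ^^ n) (?p N) 0 - (deriv ^^ n) euler_phi 0) / fact n \<le> e"
      by (simp add: d_def field_simps)
    moreover have "norm ((deriv ^^ n) (?p N) 0 - (deriv ^^ n) euler_phi 0) / fact n =
        norm ((deriv ^^ n) (?p N) 0 / fact n - (deriv ^^ n) euler_phi 0 / fact n)"
      by (simp add: diff_divide_distrib[symmetric] norm_divide)
    ultimately show ?thesis using coeff[of N] by (simp add: N_def)
  qed
  have "norm (of_int (euler_fps $ n) - (deriv ^^ n) euler_phi 0 / fact n) \<le> 0"
  proof (rule field_le_epsilon)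
    fix e :: real assume "0 < e"
    from bnd[OF this] show "norm (of_int (euler_fps $ n) - (deriv ^^ n) euler_phi 0 / fact n) \<le> 0 + e"
      by (simp only: add_0)
  qed
  then show "cfps euler_fps $ n = fps_expansion euler_phi 0 $ n"
    by (simp add: fps_expansion_def)
qed

lemma euler_phi_holomorphic_eball: "euler_phi holomorphic_on eball 0 1"
  using euler_phi_holomorphic by (simp add: one_ereal_def)

lemma conv1_euler_fps: "conv1 euler_fps"
  unfolding conv1_def cfps_euler_fps
  by (rule conv_radius_fps_expansion[OF euler_phi_holomorphic_eball])

lemma ev_euler_fps: "norm x < 1 \<Longrightarrow> ev euler_fps x = euler_phi x"
  unfolding ev_def cfps_euler_fps
  using eval_fps_expansion'[OF euler_phi_holomorphic_eball, of x] by (simp add: one_ereal_def)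

text \<open>
  Euler's product has no zeros in the unit disc, so its reciprocal is holomorphic there.
\<close>

lemma conv1_euler_inv: "conv1 euler_inv"
proof -
  have "cfps (euler_inv * euler_fps) = 1" unfolding euler_inv_mult by (rule cfps_1)
  then have inv: "cfps euler_fps * cfps euler_inv = 1" by (simp add: cfps_mult mult.commute)
  have hol: "(\<lambda>x. inverse (euler_phi x)) holomorphic_on eball 0 1"
    using euler_phi_nonzero by (intro holomorphic_intros euler_phi_holomorphic_eball) (auto simp: one_ereal_def)
  have "euler_phi has_fps_expansion cfps euler_fps"
    unfolding cfps_euler_fps
    by (rule has_fps_expansion_fps_expansion[OF open_ball _ euler_phi_holomorphic]) simp
  then have "(\<lambda>x. inverse (euler_phi x)) has_fps_expansion inverse (cfps euler_fps)"
    by (rule has_fps_expansion_inverse) (simp add: euler_fps_nth_0)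
  then have "(\<lambda>x. inverse (euler_phi x)) has_fps_expansion cfps euler_inv"
    unfolding fps_inverse_unique[OF inv] .
  then show ?thesis
    unfolding conv1_def using hol by (rule holomorphic_on_imp_fps_conv_radius_ge)
qed

lemma stretch_sums:
  assumes A: "conv1 A" and k: "k > 0" and x: "norm x < 1"
  shows "(\<lambda>n. of_int (stretch k A $ n) * x ^ n) sums ev A (x ^ k)"
proof -
  have mono: "strict_mono (\<lambda>n::nat. k * n)" using k by (simp add: strict_mono_def)
  have "(\<lambda>n. of_int (A $ n) * (x ^ k) ^ n) sums ev A (x ^ k)"
    by (rule ev_sums[OF A]) (use x k in \<open>simp add: norm_power power_less_one_iff\<close>)
  then have "(\<lambda>n. of_int (stretch k A $ (k * n)) * x ^ (k * n)) sums ev A (x ^ k)"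
    using k by (simp add: stretch_nth power_mult)
  then show ?thesis
    by (subst (asm) sums_mono_reindex[OF mono]) (use k in \<open>auto simp: stretch_nth elim!: dvdE\<close>)
qed

lemma conv1_stretch: "conv1 A \<Longrightarrow> k > 0 \<Longrightarrow> conv1 (stretch k A)"
  unfolding conv1_def[of "stretch k A"] fps_conv_radius_def
proof (rule conv_radius_geI_ex)
  fix r :: real assume "conv1 A" "k > 0" and r: "0 < r" "ereal r < 1"
  then have "(\<lambda>n. of_int (stretch k A $ n) * of_real r ^ n) sums ev A (of_real r ^ k)"
    by (intro stretch_sums) simp_all
  then have "summable (\<lambda>n. fps_nth (cfps (stretch k A)) n * of_real r ^ n)"
    unfolding cfps_nth by (rule sums_summable)
  moreover have "norm (of_real r :: complex) = r" using r by simp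
  ultimately show "\<exists>z. norm z = r \<and> summable (\<lambda>n. fps_nth (cfps (stretch k A)) n * z ^ n)" by blast
qed

lemma ev_stretch: "conv1 A \<Longrightarrow> k > 0 \<Longrightarrow> norm x < 1 \<Longrightarrow> ev (stretch k A) x = ev A (x ^ k)"
  using stretch_sums[of A k x] ev_sums[OF conv1_stretch[of A k], of x] sums_unique2 by blast

section \<open>Growth of eta products at the cusps\<close>

lemma eta_growth:
  assumes c: "c > 0"
  obtains C1 C2 where "C1 > 0" "C2 > 0"
    "\<And>z. Im z \<ge> c \<Longrightarrow> C1 * exp (- (pi/12) * Im z) \<le> norm (eta z)"
    "\<And>z. Im z \<ge> c \<Longrightarrow> norm (eta z) \<le> C2 * exp (- (pi/12) * Im z)"
proof -
  define r where "r = exp (- 2 * pi * c)"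
  have r: "r < 1" "r \<ge> 0" using c by (simp_all add: r_def)
  have cont: "continuous_on (cball 0 r) (\<lambda>x. norm (euler_phi x))"
    using r by (intro continuous_intros continuous_on_subset[OF holomorphic_on_imp_continuous_on[OF euler_phi_holomorphic]]) auto
  obtain x1 where x1: "x1 \<in> cball 0 r" "\<And>x. x \<in> cball 0 r \<Longrightarrow> norm (euler_phi x1) \<le> norm (euler_phi x)"
    using continuous_attains_inf[OF compact_cball _ cont] r by force
  obtain x2 where x2: "x2 \<in> cball 0 r" "\<And>x. x \<in> cball 0 r \<Longrightarrow> norm (euler_phi x) \<le> norm (euler_phi x2)"
    using continuous_attains_sup[OF compact_cball _ cont] r by force
  have pos: "norm (euler_phi x1) > 0" "norm (euler_phi x2) > 0"
    using x1(1) x2(1) r euler_phi_nonzero[of x1] euler_phi_nonzero[of x2] by auto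
  have eq: "norm (eta z) = exp (- (pi/12) * Im z) * norm (euler_phi (ee z))" for z
    by (simp add: eta_def norm_mult norm_ee)
  have mem: "ee z \<in> cball 0 r" if "Im z \<ge> c" for z
    using that by (simp add: norm_ee r_def)
  show ?thesis
  proof (rule that[OF pos])
    fix z assume "Im z \<ge> c"
    from x1(2)[OF mem[OF this]] show "norm (euler_phi x1) * exp (- (pi/12) * Im z) \<le> norm (eta z)"
      unfolding eq mult.commute[of "exp _"] by (rule mult_right_mono) simp
  next
    fix z assume "Im z \<ge> c"
    from x2(2)[OF mem[OF this]] show "norm (eta z) \<le> norm (euler_phi x2) * exp (- (pi/12) * Im z)"
      unfolding eq mult.commute[of "exp _"] by (rule mult_right_mono) simp
  qed
qed

text \<open>
  At the cusp \<open>\<gamma>(\<infinity>)\<close> the function \<open>\<eta>(kz)\<close> behaves like \<open>\<eta>((Az + B)/D)\<close>, where \<open>AD = k\<close>; this is \<open>A/D\<close>.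
\<close>

definition cusp_ratio :: "nat \<Rightarrow> mat2 \<Rightarrow> real" where
  "cusp_ratio k \<gamma> = (if int k dvd lowleft \<gamma> then real k else 1 / real k)"

text \<open>
  Write \<open>diag(k, 1) \<gamma> = \<delta> (A, B; 0, D)\<close>. Comparing first columns shows that \<open>k\<close> divides \<open>A\<close> exactly if it divides the lower left entry
  of \<open>\<gamma>\<close>.
\<close>

lemma eta_scaled_act:
  assumes k: "prime k" and g: "mdet \<gamma> = 1"
  obtains A B D :: int where "A > 0" "D > 0" "real_of_int A / real_of_int D = cusp_ratio k \<gamma>"
    "\<And>z. Im z > 0 \<Longrightarrow> norm (eta (of_nat k * act \<gamma> z)) ^ 2 =
       norm (aut \<gamma> z) / real_of_int D * norm (eta ((of_int A * z + of_int B) / of_int D)) ^ 2"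
proof -
  obtain a b c d where abcd: "\<gamma> = M2 a b c d" by (cases \<gamma>)
  have k0: "k > 0" using k prime_gt_0_nat by blast
  define K where "K = M2 (int k) 0 0 1"
  have K: "mdet K = int k" "act K z = of_nat k * z" "aut K z = 1" for z by (simp_all add: K_def)
  have "mdet (K * \<gamma>) > 0" using g K k0 by simp
  then obtain \<delta> A B D where d: "mdet \<delta> = 1" "K * \<gamma> = \<delta> * M2 A B 0 D" "A > 0" "D > 0"
    by (rule hermite_decomposition)
  obtain a' b' c' d' where \<delta>: "\<delta> = M2 a' b' c' d'" by (cases \<delta>)
  have AD: "A * D = int k"
  proof -
    have "mdet (K * \<gamma>) = A * D" unfolding d(2) mdet_mult using d(1) by simp
    then show ?thesis using g K by simp
  qed
  have col: "int k * a = a' * A" "c = c' * A" using d(2) by (simp_all add: K_def abcd \<delta>)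
  have ratio: "real_of_int A / real_of_int D = cusp_ratio k \<gamma>"
  proof (cases "int k dvd c")
    case True
    have "\<not> int k dvd a"
    proof
      assume "int k dvd a"
      then have "int k dvd a * d - b * c" using True by simp
      then show False using g abcd k by (auto simp: prime_nat_iff)
    qed
    have "\<not> int k dvd D"
    proof
      assume "int k dvd D"
      then obtain e where "D = int k * e" by (elim dvdE)
      then have "A * e = 1" using AD k0 by simp
      then have A1: "A = 1" using pos_zmult_eq_1_iff[OF d(3)] by blast
      then have a': "a' = int k * a" "c' = c" using col by simp_all
      have "a' * d' - b' * c' = 1" using d(1) \<delta> by simp
      then have "int k dvd 1" using a' True by (metis dvd_diff dvd_mult dvd_triv_left dvd_mult2)
      then show False using k by (auto simp: prime_nat_iff)
    qed
    moreover have "int k dvd A * D" using AD by simp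
    ultimately have "int k dvd A" using k prime_dvd_mult_iff[of "int k"] by simp
    then obtain e where "A = int k * e" by (elim dvdE)
    then have "e * D = 1" using AD k0 by simp
    then have "D = 1" using pos_zmult_eq_1_iff[OF d(4), of e] by (simp add: mult.commute)
    then show ?thesis using True AD abcd by (simp add: cusp_ratio_def)
  next
    case False
    then have "\<not> int k dvd A" using col(2) by auto
    moreover have "prime (int k)" using k by simp
    ultimately have "coprime A (int k)" using prime_imp_coprime coprime_commute by blast
    moreover have "A dvd int k" using AD by (metis dvd_triv_left)
    ultimately have "A dvd 1" using coprime_common_divisor[of A "int k" A] by simp
    then have "A = 1" using d(3) by simp
    then show ?thesis using False AD abcd by (simp add: cusp_ratio_def)
  qed
  show ?thesis
  proof (rule that[OF d(3,4) ratio])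
    fix z :: complex assume z: "Im z > 0"
    define U where "U = M2 A B 0 D"
    have U: "mdet U > 0" "act U z = (of_int A * z + of_int B) / of_int D" "aut U z = of_int D"
      using d by (simp_all add: U_def)
    have "of_nat k * act \<gamma> z = act (K * \<gamma>) z" using act_mult[of K \<gamma> z] K g k0 z by simp
    also have "\<dots> = act \<delta> (act U z)" unfolding d(2) U_def[symmetric] using act_mult[of \<delta> U z] d(1) U z by simp
    finally have 1: "of_nat k * act \<gamma> z = act \<delta> (act U z)" .
    have "aut (K * \<gamma>) z = aut \<gamma> z" using aut_mult[of \<gamma> z K] K g z by simp
    moreover have "aut (K * \<gamma>) z = aut \<delta> (act U z) * of_int D"
      unfolding d(2) U_def[symmetric] using aut_mult[of U z \<delta>] U z by simp
    ultimately have "aut \<delta> (act U z) = aut \<gamma> z / of_int D" using d(4) by (simp add: eq_divide_eq)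
    then show "norm (eta (of_nat k * act \<gamma> z)) ^ 2 =
       norm (aut \<gamma> z) / real_of_int D * norm (eta ((of_int A * z + of_int B) / of_int D)) ^ 2"
      unfolding 1 using norm_eta_act[OF d(1) act_uhp[OF U(1) z]] d(4) U(2) by (simp add: norm_divide)
  qed
qed

definition eta_prod :: "nat \<Rightarrow> nat \<Rightarrow> nat \<Rightarrow> complex \<Rightarrow> complex" where
  "eta_prod k i j z = eta z ^ i * eta (of_nat k * z) ^ j"

lemma eta_prod_growth:
  assumes k: "prime k" and g: "mdet \<gamma> = 1" and w: "i + j = 2 * w" and c: "c > 0"
  obtains C1 C2 where "C1 > 0" "C2 > 0"
    "\<And>z. Im z \<ge> c \<Longrightarrow> C1 * exp (- (pi/12) * (real i + real j * cusp_ratio k \<gamma>) * Im z) \<le> norm (slash w (eta_prod k i j) \<gamma> z)"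
    "\<And>z. Im z \<ge> c \<Longrightarrow> norm (slash w (eta_prod k i j) \<gamma> z) \<le> C2 * exp (- (pi/12) * (real i + real j * cusp_ratio k \<gamma>) * Im z)"
proof -
  obtain A B D where ABD: "A > 0" "D > 0" "real_of_int A / real_of_int D = cusp_ratio k \<gamma>"
    "\<And>z. Im z > 0 \<Longrightarrow> norm (eta (of_nat k * act \<gamma> z)) ^ 2 =
       norm (aut \<gamma> z) / real_of_int D * norm (eta ((of_int A * z + of_int B) / of_int D)) ^ 2"
    using eta_scaled_act[OF k g] by metis
  define \<rho> where "\<rho> = cusp_ratio k \<gamma>"
  have \<rho>: "\<rho> > 0" using ABD by (simp add: \<rho>_def flip: ABD(3))
  obtain a1 a2 where a: "a1 > 0" "a2 > 0"
    "\<And>z. Im z \<ge> c \<Longrightarrow> a1 * exp (- (pi/12) * Im z) \<le> norm (eta z)"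
    "\<And>z. Im z \<ge> c \<Longrightarrow> norm (eta z) \<le> a2 * exp (- (pi/12) * Im z)"
    using eta_growth[OF c] by metis
  obtain b1 b2 where b: "b1 > 0" "b2 > 0"
    "\<And>z. Im z \<ge> \<rho> * c \<Longrightarrow> b1 * exp (- (pi/12) * Im z) \<le> norm (eta z)"
    "\<And>z. Im z \<ge> \<rho> * c \<Longrightarrow> norm (eta z) \<le> b2 * exp (- (pi/12) * Im z)"
    using eta_growth[of "\<rho> * c"] \<rho> c by (metis mult_pos_pos)
  define S where "S = sqrt (real_of_int D) ^ j"
  have S: "S > 0" using ABD by (simp add: S_def)
  have formula: "norm (slash w (eta_prod k i j) \<gamma> z) =
      norm (eta z) ^ i * norm (eta ((of_int A * z + of_int B) / of_int D)) ^ j / S" if z: "Im z > 0" for z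
  proof -
    have nz: "norm (aut \<gamma> z) > 0" using aut_nonzero[of \<gamma> z] g z by simp
    have e1: "norm (eta (act \<gamma> z)) = sqrt (norm (aut \<gamma> z)) * norm (eta z)"
      using norm_eta_act[OF g z] by (metis norm_ge_zero real_sqrt_abs abs_of_nonneg real_sqrt_mult)
    have e2: "norm (eta (of_nat k * act \<gamma> z)) =
        sqrt (norm (aut \<gamma> z)) / sqrt (real_of_int D) * norm (eta ((of_int A * z + of_int B) / of_int D))"
      using ABD(4)[OF z] by (metis norm_ge_zero real_sqrt_abs abs_of_nonneg real_sqrt_mult real_sqrt_divide)
    have "sqrt (norm (aut \<gamma> z)) ^ i * sqrt (norm (aut \<gamma> z)) ^ j = norm (aut \<gamma> z) ^ w"
      unfolding power_add[symmetric] w by (simp add: power_mult)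
    moreover have "norm (slash w (eta_prod k i j) \<gamma> z) =
        (sqrt (norm (aut \<gamma> z)) * norm (eta z)) ^ i * (sqrt (norm (aut \<gamma> z)) / sqrt (real_of_int D) *
        norm (eta ((of_int A * z + of_int B) / of_int D))) ^ j / norm (aut \<gamma> z) ^ w"
      using z by (simp only: slash_def eta_prod_def norm_mult norm_divide norm_power e1 e2 if_True)
    moreover have "(u * X) ^ i * (u / v * Y) ^ j / W = (u ^ i * u ^ j) * (X ^ i * Y ^ j / v ^ j) / W"
      for u v X Y W :: real
      by (simp add: power_mult_distrib power_divide)
    ultimately show ?thesis using nz by (simp add: S_def)
  qed
  have Im: "Im ((of_int A * z + of_int B) / of_int D) = \<rho> * Im z" for z
    using ABD(2) by (simp add: \<rho>_def Im_divide power2_eq_square field_simps flip: ABD(3))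
  have expo: "exp (- (pi/12) * y) ^ i * exp (- (pi/12) * (\<rho> * y)) ^ j =
      exp (- (pi/12) * (real i + real j * \<rho>) * y)" for y
    by (simp add: exp_of_nat_mult[symmetric] exp_add[symmetric] algebra_simps)
  show ?thesis
  proof (rule that[of "a1 ^ i * b1 ^ j / S" "a2 ^ i * b2 ^ j / S"])
    fix z assume z: "Im z \<ge> c"
    then have z0: "Im z > 0" using c by linarith
    let ?\<zeta> = "(of_int A * z + of_int B) / of_int D"
    have Im\<zeta>: "Im ?\<zeta> \<ge> \<rho> * c" unfolding Im using z \<rho> by simp
    show "a1 ^ i * b1 ^ j / S * exp (- (pi/12) * (real i + real j * cusp_ratio k \<gamma>) * Im z) \<le>
        norm (slash w (eta_prod k i j) \<gamma> z)"
    proof -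
      have "(a1 * exp (- (pi/12) * Im z)) ^ i * (b1 * exp (- (pi/12) * Im ?\<zeta>)) ^ j \<le>
          norm (eta z) ^ i * norm (eta ?\<zeta>) ^ j"
        by (intro mult_mono power_mono a b) (use a b z Im\<zeta> in auto)
      then show ?thesis
        unfolding formula[OF z0] \<rho>_def[symmetric] expo[symmetric] Im power_mult_distrib
        using S by (simp add: field_simps)
    qed
    show "norm (slash w (eta_prod k i j) \<gamma> z) \<le>
        a2 ^ i * b2 ^ j / S * exp (- (pi/12) * (real i + real j * cusp_ratio k \<gamma>) * Im z)"
    proof -
      have "norm (eta z) ^ i * norm (eta ?\<zeta>) ^ j \<le>
          (a2 * exp (- (pi/12) * Im z)) ^ i * (b2 * exp (- (pi/12) * Im ?\<zeta>)) ^ j"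
        by (intro mult_mono power_mono a b) (use a b z Im\<zeta> in \<open>auto intro!: mult_nonneg_nonneg\<close>)
      then show ?thesis
        unfolding formula[OF z0] \<rho>_def[symmetric] expo[symmetric] Im power_mult_distrib
        using S by (simp add: field_simps)
    qed
  qed (use a b S in auto)
qed

text \<open>
  A bound for a periodic function improves to the next integral exponent, because the function has an expansion in
  \<open>exp(2\<pi>iz/N)\<close>.
\<close>

lemma periodic_integral_exponent:
  assumes g: "g holomorphic_on uhp" and per: "\<And>z. Im z > 0 \<Longrightarrow> g (z + of_int N) = g z" and N: "N > 0"
    and bnd: "\<And>z. Im z \<ge> 1 \<Longrightarrow> norm (g z) \<le> C * exp (- 2 * pi * \<beta> * Im z / of_int N)"
    and \<beta>: "\<beta> > real n - 1"
  shows "\<exists>C. \<forall>z. Im z \<ge> 1 \<longrightarrow> norm (g z) \<le> C * exp (- 2 * pi * real n * Im z / of_int N)"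
proof -
  define L where "L x = of_int N * Ln x / (2 * of_real pi * \<i>)" for x
  define F where "F x = g (L x)" for x
  have ImL: "Im (L x) = - of_int N * ln (norm x) / (2 * pi)" if "x \<noteq> 0" for x
  proof -
    have "L x = of_real (of_int N / (2 * pi)) * (- \<i> * Ln x)" by (simp add: L_def field_simps)
    then show ?thesis using that by simp
  qed
  have ImLpos: "Im (L x) > 0" if "x \<noteq> 0" "norm x < 1" for x
    using that N by (simp add: ImL mult_pos_neg divide_neg_pos)
  have perN: "g (z + of_nat j * of_int N) = g z" if "Im z > 0" for z j
  proof (induction j)
    case (Suc j)
    have "g (z + of_nat (Suc j) * of_int N) = g ((z + of_nat j * of_int N) + of_int N)"
      by (simp add: algebra_simps)
    also have "\<dots> = g (z + of_nat j * of_int N)" by (rule per) (use that in simp)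
    finally show ?case using Suc by simp
  qed simp
  have perZ: "g (z + of_int j * of_int N) = g z" if "Im z > 0" for z j
    using perN[of z "nat j"] perN[of "z + of_int j * of_int N" "nat (-j)"] that
    by (cases "j \<ge> 0") auto
  have gF: "F (ee (z / of_int N)) = g z" if z: "Im z > 0" for z
  proof -
    have "exp (Ln (ee (z / of_int N))) = exp (2 * of_real pi * \<i> * (z / of_int N))"
      by (simp add: ee_def)
    then obtain j :: int where j: "Ln (ee (z / of_int N)) = 2 * of_real pi * \<i> * (z / of_int N) + (of_int (2 * j) * pi) * \<i>"
      unfolding exp_eq by blast
    then have "L (ee (z / of_int N)) = z + of_int j * of_int N"
      using N by (simp add: L_def field_simps)
    then show ?thesis using perZ[OF z] by (simp add: F_def)
  qed
  have Fhol: "F holomorphic_on ball 0 1 - {0}"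
  proof -
    have diff: "F field_differentiable at x" if x: "x \<noteq> 0" "norm x < 1" for x :: complex
    proof -
      \<comment> \<open>Near \<open>x\<close> the function \<open>F\<close> agrees with a branch of the logarithm, rotated away from the cut, followed by \<open>g\<close>.\<close>
      have branch: "(\<lambda>y. g (of_int N * (Ln (c * y) - Ln c) / (2 * of_real pi * \<i>))) field_differentiable at x \<and>
          (\<forall>y. y \<noteq> 0 \<longrightarrow> norm y < 1 \<longrightarrow> g (of_int N * (Ln (c * y) - Ln c) / (2 * of_real pi * \<i>)) = F y)"
        if c: "norm c = 1" "c * x \<notin> \<real>\<^sub>\<le>\<^sub>0" for c
      proof
        define h where "h y = of_int N * (Ln (c * y) - Ln c) / (2 * of_real pi * \<i>)" for y :: complex
        have c0: "c \<noteq> 0" using c by auto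
        have him: "Im (h y) = Im (L y)" if "y \<noteq> 0" for y :: complex
        proof -
          have "h y = of_real (of_int N / (2 * pi)) * (- \<i> * (Ln (c * y) - Ln c))"
            by (simp add: h_def field_simps)
          then show ?thesis using that c c0 by (simp add: ImL norm_mult)
        qed
        have "h field_differentiable at x"
          unfolding h_def[abs_def]
          by (intro field_differentiable_divide field_differentiable_mult field_differentiable_diff
              field_differentiable_const field_differentiable_compose[of "\<lambda>y. c * y" x Ln, unfolded o_def]
              field_differentiable_at_Ln field_differentiable_ident) (use c in auto)
        moreover have "g field_differentiable at (h x)"
          using holomorphic_on_imp_differentiable_at[OF g open_uhp] him[OF x(1)] ImLpos[OF x] by simp
        ultimately show "(\<lambda>y. g (of_int N * (Ln (c * y) - Ln c) / (2 * of_real pi * \<i>))) field_differentiable at x"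
          using field_differentiable_compose[of h x g] by (simp add: o_def h_def)
        show "\<forall>y. y \<noteq> 0 \<longrightarrow> norm y < 1 \<longrightarrow> g (of_int N * (Ln (c * y) - Ln c) / (2 * of_real pi * \<i>)) = F y"
        proof (intro allI impI)
          fix y :: complex assume y: "y \<noteq> 0" "norm y < 1"
          have "exp (Ln (c * y) - Ln c) = exp (Ln y)" using y c0 by (simp add: exp_diff)
          then obtain j :: int where j: "Ln (c * y) - Ln c = Ln y + (of_int (2 * j) * pi) * \<i>"
            unfolding exp_eq by blast
          have "h y = L y + of_int j * of_int N"
            unfolding h_def j L_def using N by (simp add: field_simps)
          then show "g (of_int N * (Ln (c * y) - Ln c) / (2 * of_real pi * \<i>)) = F y"
            using perZ[OF ImLpos[OF y]] by (simp add: F_def h_def)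
        qed
      qed
      obtain c where c: "norm c = 1" "c * x \<notin> \<real>\<^sub>\<le>\<^sub>0"
      proof (cases "x \<in> \<real>\<^sub>\<le>\<^sub>0")
        case True
        then show ?thesis using that[of "-1"] x by (auto simp: complex_nonpos_Reals_iff complex_eq_iff)
      next
        case False
        then show ?thesis using that[of 1] by simp
      qed
      have "open (ball 0 1 - {0::complex})" by (intro open_Diff) auto
      then have ev: "eventually (\<lambda>y. y \<in> ball 0 1 - {0}) (nhds x)"
        by (rule eventually_nhds_in_open) (use x in auto)
      have evq: "eventually (\<lambda>y. g (of_int N * (Ln (c * y) - Ln c) / (2 * of_real pi * \<i>)) = F y) (nhds x)"
        using ev by eventually_elim (use branch[OF c] in auto)
      obtain f' where "((\<lambda>y. g (of_int N * (Ln (c * y) - Ln c) / (2 * of_real pi * \<i>)))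
          has_field_derivative f') (at x)"
        using branch[OF c, THEN conjunct1] unfolding field_differentiable_def by blast
      from iffD1[OF DERIV_cong_ev[OF refl evq refl] this]
      show ?thesis unfolding field_differentiable_def by blast
    qed
    then show ?thesis by (auto simp: holomorphic_on_def intro: field_differentiable_at_within)
  qed
  define r where "r = exp (- 2 * pi / of_int N)"
  have r: "0 < r" "r < 1" using N by (simp_all add: r_def)
  have Fbnd: "norm (F x) \<le> C * norm x powr \<beta>" if x: "x \<noteq> 0" "norm x \<le> r" for x
  proof -
    have "ln (norm x) \<le> ln r" using x r by simp
    then have "ln (norm x) \<le> - 2 * pi / of_int N" by (simp add: r_def)
    then have "of_int N * ln (norm x) \<le> - 2 * pi" using N by (simp add: field_simps)
    then have "Im (L x) \<ge> 1" using x by (simp add: ImL field_simps)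
    from bnd[OF this] have "norm (F x) \<le> C * exp (- 2 * pi * \<beta> * Im (L x) / of_int N)" by (simp add: F_def)
    also have "- 2 * pi * \<beta> * Im (L x) / of_int N = \<beta> * ln (norm x)" using x N by (simp add: ImL)
    also have "exp \<dots> = norm x powr \<beta>" using x by (simp add: powr_def)
    finally show ?thesis .
  qed
  \<comment> \<open>The bound with \<open>\<beta> > n - 1\<close> gives \<open>xF(x)/x\<^sup>n\<close> a removable zero at the origin, so \<open>F(x)/x\<^sup>n\<close> stays bounded.\<close>
  define h where "h x = (if x = 0 then 0 else x * F x / x ^ n)" for x
  have hhol: "h holomorphic_on ball 0 r"
  proof (rule no_isolated_singularity'[where K = "{0}"])
    have "(\<lambda>x. x * F x / x ^ n) holomorphic_on ball 0 r - {0}"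
      by (intro holomorphic_intros holomorphic_on_subset[OF Fhol]) (use r in auto)
    then show "h holomorphic_on ball 0 r - {0}"
      by (rule holomorphic_transform) (auto simp: h_def)
    fix z :: complex assume "z \<in> {0}"
    have "((\<lambda>x. C * norm x powr (\<beta> - real n + 1)) \<longlongrightarrow> C * 0) (at (0::complex))"
    proof (intro tendsto_mult tendsto_const)
      have "((\<lambda>x::complex. norm x) \<longlongrightarrow> 0) (at 0)" by (intro tendsto_eq_intros) auto
      then show "((\<lambda>x::complex. norm x powr (\<beta> - real n + 1)) \<longlongrightarrow> 0) (at 0)"
        using tendsto_powr2[of "\<lambda>x::complex. norm x" 0 "at 0" "\<lambda>_. \<beta> - real n + 1" "\<beta> - real n + 1"] \<beta> by simp
    qed
    then have lim: "((\<lambda>x. C * norm x powr (\<beta> - real n + 1)) \<longlongrightarrow> 0) (at (0::complex))" by simp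
    have "eventually (\<lambda>x. x \<in> ball 0 r - {0}) (at (0::complex))"
      using r by (auto simp: eventually_at intro!: exI[of _ r])
    then have "eventually (\<lambda>x. norm (h x) \<le> C * norm x powr (\<beta> - real n + 1)) (at 0)"
    proof eventually_elim
      case (elim x)
      then have x: "x \<noteq> 0" "norm x \<le> r" by auto
      have "norm (h x) = norm x * norm (F x) / norm x ^ n" using x by (simp add: h_def norm_mult norm_divide norm_power)
      also have "\<dots> \<le> norm x * (C * norm x powr \<beta>) / norm x ^ n"
        using Fbnd[OF x] by (intro divide_right_mono mult_left_mono) auto
      also have "\<dots> = C * norm x powr (\<beta> - real n + 1)"
        using x by (simp add: powr_add powr_diff powr_realpow)
      finally show ?case .
    qed
    from Lim_null_comparison[OF this lim] have "(h \<longlongrightarrow> 0) (at 0 within ball 0 r)"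
      by (rule tendsto_within_subset) simp
    moreover have "h 0 = 0" by (simp add: h_def)
    ultimately show "(h \<longlongrightarrow> h z) (at z within ball 0 r)" using \<open>z \<in> {0}\<close> by simp
  qed auto
  define v where "v x = (if x = 0 then deriv h 0 else (h x - h 0) / (x - 0))" for x
  have vhol: "v holomorphic_on ball 0 r"
    unfolding v_def by (rule pole_lemma_open[OF hhol open_ball])
  have v: "F x = x ^ n * v x" if "x \<noteq> 0" for x using that by (simp add: v_def h_def)
  have vcont: "continuous_on (ball 0 1) v"
  proof -
    have c1: "continuous_on (ball 0 r) v" by (rule holomorphic_on_imp_continuous_on[OF vhol])
    have "(\<lambda>x. F x / x ^ n) holomorphic_on ball 0 1 - {0}"
      by (intro holomorphic_intros Fhol) auto
    then have "v holomorphic_on ball 0 1 - {0}"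
      by (rule holomorphic_transform) (auto simp: v_def h_def)
    then have c2: "continuous_on (ball 0 1 - {0}) v" by (rule holomorphic_on_imp_continuous_on)
    have "ball 0 1 = ball 0 r \<union> (ball 0 1 - {0::complex})" using r by auto
    moreover have "continuous_on (ball 0 r \<union> (ball 0 1 - {0})) v"
      by (rule continuous_on_open_Un[OF _ _ c1 c2]) (auto intro: open_Diff)
    ultimately show ?thesis by metis
  qed
  have "continuous_on (cball 0 r) v" by (rule continuous_on_subset[OF vcont]) (use r in auto)
  then have "bounded (v ` cball 0 r)"
    by (intro compact_imp_bounded compact_continuous_image compact_cball)
  then obtain B where "\<forall>y\<in>v ` cball 0 r. norm y \<le> B" unfolding bounded_iff by blast
  then have B: "norm (v x) \<le> B" if "norm x \<le> r" for x using that by simp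
  have "norm (g z) \<le> B * exp (- 2 * pi * real n * Im z / of_int N)" if z: "Im z \<ge> 1" for z
  proof -
    define x where "x = ee (z / of_int N)"
    have nx: "norm x = exp (- 2 * pi * (Im z / of_int N))"
      by (simp add: x_def norm_ee Im_divide_of_real[of z "of_int N", simplified])
    have "norm x \<le> r" unfolding nx r_def using z N by (simp add: divide_right_mono)
    have "norm (g z) = norm (F x)" using gF[of z] z by (simp add: x_def)
    also have "\<dots> = norm x ^ n * norm (v x)" using v[of x] by (simp add: x_def norm_mult norm_power)
    also have "\<dots> \<le> norm x ^ n * B" using B[OF \<open>norm x \<le> r\<close>] by (intro mult_left_mono) auto
    also have "norm x ^ n = exp (- 2 * pi * real n * Im z / of_int N)"
      unfolding nx exp_of_nat_mult[symmetric] by (simp add: mult_ac)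
    finally show ?thesis by (simp add: mult.commute)
  qed
  then show ?thesis by blast
qed

lemma slash_Gamma_N_shift:
  assumes inv: "\<And>\<delta>. Gamma_N N \<delta> \<Longrightarrow> slash w f \<delta> = slash w f 1" and g: "mdet \<gamma> = 1" and z: "Im z > 0"
  shows "slash w f \<gamma> (z + of_int N) = slash w f \<gamma> z"
proof -
  obtain a b c d where abcd: "\<gamma> = M2 a b c d" by (cases \<gamma>)
  have det: "a * d - b * c = 1" using g abcd by simp
  have eq: "\<gamma> * TT N * adj \<gamma> = M2 (1 - N * (a * c)) (N * (a * a)) (- (N * (c * c))) (1 + N * (a * c))"
  proof -
    have "a * d + (a * N + b) * - c = (a * d - b * c) - N * (a * c)"
      "c * - b + (c * N + d) * a = (a * d - b * c) + N * (a * c)"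
      by (simp_all add: algebra_simps)
    then show ?thesis unfolding det by (simp add: abcd TT_def algebra_simps)
  qed
  have dets: "mdet (TT N) = 1" "mdet (\<gamma> * TT N * adj \<gamma>) = 1" using g by (simp_all add: TT_def)
  have "Gamma_N N (\<gamma> * TT N * adj \<gamma>)" using dets(2) unfolding eq by simp
  then have 1: "slash w f (\<gamma> * TT N * adj \<gamma>) = slash w f 1" by (rule inv)
  have "slash w f (\<gamma> * TT N) = slash w (slash w f (\<gamma> * TT N * adj \<gamma>)) \<gamma>"
    using dets g mult_adj(2)[OF g] by (subst slash_mult) (simp_all add: mult.assoc)
  also have "\<dots> = slash w f \<gamma>" unfolding 1 using g by (simp add: slash_slash_1)
  finally have "slash w (slash w f \<gamma>) (TT N) z = slash w f \<gamma> z"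
    using slash_mult[of \<gamma> "TT N" w f] g dets by simp
  then show ?thesis using z by (simp add: slash_def[of _ "slash w f \<gamma>"] TT_def)
qed

text \<open>
  By periodicity and compactness of a period strip of finite height, a bound on \<open>Im z \<ge> 1\<close> implies one on every
  half-plane \<open>Im z \<ge> c\<close>.
\<close>

lemma modformI:
  assumes hol: "f holomorphic_on uhp" and inv: "\<And>\<delta>. Gamma_N N \<delta> \<Longrightarrow> slash w f \<delta> = slash w f 1" and N: "N > 0"
    and bnd: "\<And>\<gamma>. mdet \<gamma> = 1 \<Longrightarrow> \<exists>C. \<forall>z. Im z \<ge> 1 \<longrightarrow> norm (slash w f \<gamma> z) \<le> C"
  shows "modform w N f"
  unfolding modform_def
proof (intro conjI allI impI hol inv)
  fix \<gamma> and c :: real assume g: "mdet \<gamma> = 1" and c: "c > 0"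
  obtain C where C: "\<And>z. Im z \<ge> 1 \<Longrightarrow> norm (slash w f \<gamma> z) \<le> C" using bnd[OF g] by blast
  define K where "K = cbox (Complex 0 c) (Complex (of_int N) 1)"
  have "slash w f \<gamma> holomorphic_on uhp" by (rule slash_holomorphic[OF hol]) (use g in simp)
  then have "continuous_on K (slash w f \<gamma>)"
    by (rule holomorphic_on_imp_continuous_on[OF holomorphic_on_subset])
       (use c in \<open>auto simp: K_def in_cbox_complex_iff\<close>)
  then have "bounded (slash w f \<gamma> ` K)"
    by (intro compact_imp_bounded compact_continuous_image) (simp_all add: K_def)
  then obtain B where "\<forall>y\<in>slash w f \<gamma> ` K. norm y \<le> B" unfolding bounded_iff by blast
  then have B: "norm (slash w f \<gamma> z) \<le> B" if "z \<in> K" for z using that by simp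
  have per: "slash w f \<gamma> (z + of_nat j * of_int N) = slash w f \<gamma> z" if "Im z > 0" for z j
  proof (induction j)
    case (Suc j)
    have "slash w f \<gamma> (z + of_nat (Suc j) * of_int N) = slash w f \<gamma> ((z + of_nat j * of_int N) + of_int N)"
      by (simp add: algebra_simps)
    also have "\<dots> = slash w f \<gamma> (z + of_nat j * of_int N)"
      by (rule slash_Gamma_N_shift[OF inv g]) (use that in simp_all)
    finally show ?case using Suc by simp
  qed simp
  have perZ: "slash w f \<gamma> (z + of_int j * of_int N) = slash w f \<gamma> z" if "Im z > 0" for z j
    using per[of z "nat j"] per[of "z + of_int j * of_int N" "nat (-j)"] that
    by (cases "j \<ge> 0") auto
  have "norm (slash w f \<gamma> z) \<le> max C B" if z: "Im z \<ge> c" for z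
  proof (cases "Im z \<ge> 1")
    case True
    then show ?thesis using C[of z] by simp
  next
    case False
    define j where "j = \<lfloor>Re z / of_int N\<rfloor>"
    have j: "of_int j * of_int N \<le> Re z" "Re z \<le> (of_int j + 1) * of_int N"
    proof -
      have "of_int j \<le> Re z / of_int N" "Re z / of_int N \<le> of_int j + 1"
        unfolding j_def by linarith+
      then show "of_int j * of_int N \<le> Re z" "Re z \<le> (of_int j + 1) * of_int N"
        using N by (simp_all add: field_simps)
    qed
    have "z + of_int (-j) * of_int N \<in> K"
      using j False z by (simp add: K_def in_cbox_complex_iff algebra_simps)
    from B[OF this] show ?thesis using perZ[of z "-j"] z c by simp
  qed
  then show "\<exists>C. \<forall>z. Im z \<ge> c \<longrightarrow> norm (slash w f \<gamma> z) \<le> C" by blast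
qed

subsection \<open>Eta products as modular forms\<close>

lemma eta_prod_holomorphic: "k > 0 \<Longrightarrow> eta_prod k i j holomorphic_on uhp"
proof -
  assume k: "k > 0"
  have "(eta \<circ> (\<lambda>z. of_nat k * z)) holomorphic_on uhp"
    by (rule holomorphic_on_compose_gen[OF _ eta_holomorphic]) (use k in \<open>auto intro!: holomorphic_intros\<close>)
  then show ?thesis
    unfolding eta_prod_def[abs_def] by (intro holomorphic_intros eta_holomorphic) (simp add: o_def)
qed

lemma eta_prod_nonzero: "k > 0 \<Longrightarrow> Im z > 0 \<Longrightarrow> eta_prod k i j z \<noteq> 0"
  by (simp add: eta_prod_def eta_nonzero)

lemma eta_prod_diag:
  assumes k: "k > 0" and ij: "even i" "even j" "i + j = 2 * w"
    and g: "mdet (M2 a b c d) = 1" "12 dvd b" "12 * int k dvd c"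
  shows "slash w (eta_prod k i j) (M2 a b c d) = (\<lambda>z. sgn4 d ^ w * slash w (eta_prod k i j) 1 z)"
proof
  fix z
  define \<gamma> where "\<gamma> = M2 a b c d"
  obtain u v where uv: "i = 2 * u" "j = 2 * v" using ij by (auto elim!: evenE)
  then have w: "w = u + v" using ij by simp
  have c12: "12 dvd c" using g(3) by (rule dvd_mult_left)
  have form: "eta_prod k i j y = ((eta y)\<^sup>2) ^ u * ((eta (of_nat k * y))\<^sup>2) ^ v" for y
    by (simp add: eta_prod_def uv power_mult)
  show "slash w (eta_prod k i j) (M2 a b c d) z = sgn4 d ^ w * slash w (eta_prod k i j) 1 z"
  proof (cases "Im z > 0")
    case z: True
    have nz: "aut \<gamma> z \<noteq> 0" using aut_nonzero[of \<gamma> z] g(1) z by (simp add: \<gamma>_def)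
    have "eta_prod k i j (act \<gamma> z) = (sgn4 d * aut \<gamma> z) ^ w * eta_prod k i j z"
      unfolding form eta_square_diag[OF g(1,2) c12 z, folded \<gamma>_def]
        eta_scaled_square_diag[OF g k z, folded \<gamma>_def]
      by (simp add: w power_mult_distrib power_add mult_ac)
    then show ?thesis using z nz by (simp add: slash_def \<gamma>_def[symmetric] power_mult_distrib)
  qed (simp add: slash_def)
qed

lemma Gamma_N_sgn4: "Gamma_N (12 * int k) (M2 a b c d) \<Longrightarrow> sgn4 d = 1"
proof -
  assume "Gamma_N (12 * int k) (M2 a b c d)"
  then have "12 * int k dvd d - 1" by simp
  then obtain e where e: "d - 1 = 12 * int k * e" by (elim dvdE)
  have "(1 + 4 * (3 * int k * e)) mod 4 = 1" by (subst mod_mult_self2) simp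
  moreover have "d = 1 + 4 * (3 * int k * e)" using e by simp
  ultimately have "d mod 4 = 1" by simp
  then show ?thesis by (simp add: sgn4_def)
qed

lemma modform_eta_prod:
  assumes k: "prime k" and ij: "even i" "even j" "i + j = 2 * w"
  shows "modform w (12 * int k) (eta_prod k i j)"
proof (rule modformI)
  have k0: "k > 0" using k prime_gt_0_nat by blast
  show "eta_prod k i j holomorphic_on uhp" by (rule eta_prod_holomorphic[OF k0])
  show "slash w (eta_prod k i j) \<delta> = slash w (eta_prod k i j) 1" if G: "Gamma_N (12 * int k) \<delta>" for \<delta>
  proof -
    obtain a b c d where \<delta>: "\<delta> = M2 a b c d" by (cases \<delta>)
    have b: "12 dvd b" using G unfolding \<delta> by (auto dest: dvd_mult_left)
    have "slash w (eta_prod k i j) (M2 a b c d) = (\<lambda>z. sgn4 d ^ w * slash w (eta_prod k i j) 1 z)"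
      by (rule eta_prod_diag[OF k0 ij _ b]) (use G \<delta> in auto)
    then show ?thesis using Gamma_N_sgn4 G unfolding \<delta> by simp
  qed
  show "12 * int k > 0" using k0 by simp
  show "\<exists>C. \<forall>z. Im z \<ge> 1 \<longrightarrow> norm (slash w (eta_prod k i j) \<gamma> z) \<le> C" if g: "mdet \<gamma> = 1" for \<gamma>
  proof -
    obtain C1 C2 where C: "C2 > 0" "\<And>z. Im z \<ge> 1 \<Longrightarrow> norm (slash w (eta_prod k i j) \<gamma> z) \<le>
        C2 * exp (- (pi/12) * (real i + real j * cusp_ratio k \<gamma>) * Im z)"
      using eta_prod_growth[OF k g ij(3), of 1] by (metis zero_less_one)
    have "norm (slash w (eta_prod k i j) \<gamma> z) \<le> C2" if z: "Im z \<ge> 1" for z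
    proof -
      have "cusp_ratio k \<gamma> \<ge> 0" by (simp add: cusp_ratio_def)
      then have "exp (- (pi/12) * (real i + real j * cusp_ratio k \<gamma>) * Im z) \<le> 1"
        using z by (simp add: mult_nonneg_nonneg)
      then have "C2 * exp (- (pi/12) * (real i + real j * cusp_ratio k \<gamma>) * Im z) \<le> C2 * 1"
        using C(1) by (intro mult_left_mono) auto
      then show ?thesis using C(2)[OF z] by linarith
    qed
    then show ?thesis by blast
  qed
qed

text \<open>
  The expansion of \<open>\<eta>(z)\<^sup>i \<eta>(kz)\<^sup>j\<close> in \<open>exp(2\<pi>iz/12k)\<close>, provided that \<open>e = k(i + kj)/2\<close>.
\<close>

definition eta_prod_fps :: "nat \<Rightarrow> nat \<Rightarrow> nat \<Rightarrow> nat \<Rightarrow> int fps" where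
  "eta_prod_fps k i j e = fps_X ^ e * stretch (12 * k) euler_fps ^ i * stretch (12 * k * k) euler_fps ^ j"

lemma conv1_eta_prod_fps: "k > 0 \<Longrightarrow> conv1 (eta_prod_fps k i j e)"
  unfolding eta_prod_fps_def
  by (intro conv1_mult conv1_power conv1_X_power conv1_stretch conv1_euler_fps) simp_all

lemma ev_eta_prod_fps:
  assumes k: "k > 0" and e: "2 * e = k * (i + k * j)" and z: "Im z > 0"
  shows "ev (eta_prod_fps k i j e) (ee (z / of_int (12 * int k))) = eta_prod k i j z"
proof -
  define x where "x = ee (z / of_int (12 * int k))"
  have x: "norm x < 1" unfolding x_def by (rule norm_ee_div[OF z]) (use k in simp)
  have x1: "x ^ (12 * k) = ee z" "x ^ (12 * k * k) = ee (of_nat k * z)"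
    using k by (simp_all add: x_def ee_power field_simps)
  have "ev (eta_prod_fps k i j e) x = x ^ e * euler_phi (ee z) ^ i * euler_phi (ee (of_nat k * z)) ^ j"
    using k x x1 norm_ee_less_1[OF z] norm_ee_less_1[of "of_nat k * z"] z
    unfolding eta_prod_fps_def
    by (simp add: ev_mult ev_power ev_X_power ev_stretch ev_euler_fps conv1_mult conv1_power
        conv1_X_power conv1_stretch conv1_euler_fps)
  also have "x ^ e = ee (z / 24) ^ i * ee (of_nat k * z / 24) ^ j"
  proof -
    have "2 * (of_nat e :: complex) = of_nat k * (of_nat i + of_nat k * of_nat j)"
      using arg_cong[OF e, of "of_nat :: nat \<Rightarrow> complex"] by simp
    then have "of_nat e * (z / of_int (12 * int k)) = of_nat i * (z / 24) + of_nat j * (of_nat k * z / 24)"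
      using k by (simp add: field_simps)
    then show ?thesis by (simp only: x_def ee_power ee_add)
  qed
  finally show ?thesis by (simp add: x_def eta_prod_def eta_def power_mult_distrib mult_ac)
qed

lemma intform_eta_prod_fps:
  assumes k: "prime k" and ij: "even i" "even j" "i + j = 2 * w" and e: "2 * e = k * (i + k * j)"
  shows "intform w (12 * int k) (eta_prod_fps k i j e)"
proof -
  have k0: "k > 0" using k prime_gt_0_nat by blast
  have "modform w (12 * int k) (\<lambda>z. ev (eta_prod_fps k i j e) (ee (z / of_int (12 * int k))))"
    by (rule modform_cong[OF modform_eta_prod[OF k ij]]) (rule ev_eta_prod_fps[OF k0 e, symmetric])
  then show ?thesis using conv1_eta_prod_fps[OF k0] by (simp add: intform_def)
qed

section \<open>A holomorphic form congruent to the generating function\<close>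

definition sgn4i :: "int \<Rightarrow> int" where "sgn4i d = (if d mod 4 = 1 then 1 else -1)"

text \<open>
  For \<open>t = k(k - 1)/2\<close> this is the expansion of \<open>\<eta>(kz)/\<eta>(z)\<close> in \<open>exp(2\<pi>iz/12k)\<close>.
\<close>

definition regular_form :: "nat \<Rightarrow> nat \<Rightarrow> int fps" where
  "regular_form k t = fps_X ^ t * stretch (12 * k) (regular_fps k)"

text \<open>
  In the variable \<open>exp(2\<pi>iz/12k)\<close> the order of \<open>\<eta>(z)\<eta>(kz)\<close> at infinity is \<open>s\<close>, and that of \<open>\<eta>(kz)/\<eta>(z)\<close> is \<open>t\<close>.
\<close>

context
  fixes k m s t :: nat
  assumes k: "k = 3 \<or> k = 5" and m: "prime m" "m \<ge> 5" "m \<noteq> k"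
    and s: "2 * s = k * (k + 1)" and t: "2 * t = k * (k - 1)"
begin

lemma prime_k: "prime k" and k_pos: "k > 0" using k by auto

lemma m_odd: "odd m" using m prime_odd_nat by auto

text \<open>
  In this order: the form \<open>G = \<eta>(z)\<^sup>m\<^sup>-\<^sup>1 \<eta>(kz)\<^sup>m\<^sup>+\<^sup>1\<close>, the denominator \<open>P = \<eta>(z)\<eta>(kz)\<close>, the image \<open>T\<^sub>m G\<close> and the
  quotient \<open>T\<^sub>m G / P\<close>.
\<close>

definition eta_form :: "int fps" where "eta_form = eta_prod_fps k (m - 1) (m + 1) (m * s + t)"
definition eta_den :: "int fps" where "eta_den = eta_prod_fps k 1 1 s"
definition hecke_form :: "int fps" where "hecke_form = hecke_fps m m (sgn4i (int m)) eta_form"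
definition quot_form :: "int fps" where
  "quot_form = fps_shift s hecke_form * stretch (12 * k) euler_inv * stretch (12 * k * k) euler_inv"

lemma exponent_form: "2 * (m * s + t) = k * (m - 1 + k * (m + 1))"
proof -
  have "2 * (m * s + t) = m * (2 * s) + 2 * t" by simp
  also have "\<dots> = m * (k * (k + 1)) + k * (k - 1)" by (simp only: s t)
  also have "\<dots> = k * (m - 1 + k * (m + 1))"
    using m k by (auto simp: algebra_simps)
  finally show ?thesis .
qed

lemma exponent_den: "2 * s = k * (1 + k * 1)" using s by simp

lemma intform_eta_form: "intform m (12 * int k) eta_form"
  unfolding eta_form_def
  by (rule intform_eta_prod_fps[OF prime_k _ _ _ exponent_form]) (use m_odd m in auto)

lemma coprime_m_level: "coprime (int m) (12 * int k)"
proof -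
  have "coprime m k" using m k prime_k by (intro primes_coprime) auto
  moreover have "coprime m 12"
  proof (rule prime_imp_coprime[OF m(1)])
    show "\<not> m dvd 12"
    proof
      assume "m dvd 12"
      then have "m \<le> 12" by (rule dvd_imp_le) simp
      then have "m \<in> {5..12}" using m by simp
      then have "m \<in> {5,6,7,8,9,10,11,12}" by auto
      then show False using \<open>m dvd 12\<close> m(1) by auto
    qed
  qed
  ultimately have "coprime m (12 * k)" by simp
  then show ?thesis by (metis coprime_int_iff of_nat_mult of_nat_numeral)
qed

text \<open>
  Here \<open>a \<equiv> d\<close> modulo \<open>4\<close>, because \<open>ad \<equiv> 1\<close>; so the character depends only on \<open>m\<close> modulo \<open>4\<close>.
\<close>

lemma eta_form_nebentypus:
  assumes g: "mdet (M2 a b c d) = 1" "12 * int k dvd b" "12 * int k dvd c"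
    and ad: "12 * int k dvd a - int m \<or> 12 * int k dvd d - int m"
  shows "slash m (\<lambda>z. ev eta_form (ee (z / of_int (12 * int k)))) (M2 a b c d) =
    (\<lambda>z. of_int (sgn4i (int m)) * slash m (\<lambda>z. ev eta_form (ee (z / of_int (12 * int k)))) 1 z)"
proof -
  have b12: "12 dvd b" using g(2) by (rule dvd_mult_left)
  have eq: "slash m (\<lambda>z. ev eta_form (ee (z / of_int (12 * int k)))) \<gamma> = slash m (eta_prod k (m - 1) (m + 1)) \<gamma>"
    if "mdet \<gamma> = 1" for \<gamma>
    using that act_uhp[of \<gamma>] ev_eta_prod_fps[OF k_pos exponent_form]
    by (auto simp: slash_def eta_form_def fun_eq_iff)
  have "slash m (eta_prod k (m - 1) (m + 1)) (M2 a b c d) =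
      (\<lambda>z. sgn4 d ^ m * slash m (eta_prod k (m - 1) (m + 1)) 1 z)"
    by (rule eta_prod_diag[OF k_pos _ _ _ g(1) b12 g(3)]) (use m_odd m in auto)
  moreover have "sgn4 d ^ m = of_int (sgn4i (int m))"
  proof -
    have "4 dvd b * c"
    proof -
      have "(4::int) dvd 12 * int k" by (rule dvd_mult2) simp
      then show ?thesis using g(2) by (meson dvd_mult2 dvd_trans)
    qed
    moreover have "a * d = 1 + b * c" using g(1) by simp
    then obtain x where "a * d = 1 + 4 * x" by (metis calculation dvdE)
    moreover have "(1 + 4 * x) mod 4 = 1" by (subst mod_mult_self2) simp
    ultimately have ad1: "(a * d) mod 4 = 1" by simp
    have "(4::int) dvd 12 * int k" by (rule dvd_mult2) simp
    then have "4 dvd a - int m \<or> 4 dvd d - int m" using ad by (meson dvd_trans)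
    then have "a mod 4 = int m mod 4 \<or> d mod 4 = int m mod 4" by (simp add: mod_eq_dvd_iff)
    moreover have "a mod 4 = d mod 4"
    proof -
      have "((a mod 4) * (d mod 4)) mod 4 = 1" using ad1 by (simp add: mod_mult_eq)
      moreover have "a mod 4 \<in> {0,1,2,3}" "d mod 4 \<in> {0,1,2,3}" by (simp, presburger)+
      ultimately show ?thesis by auto
    qed
    ultimately have "d mod 4 = int m mod 4" by auto
    then have "sgn4 d = of_int (sgn4i (int m))" by (simp add: sgn4_def sgn4i_def)
    moreover have "sgn4 d ^ m = sgn4 d" using m_odd by (simp add: sgn4_def)
    ultimately show ?thesis by simp
  qed
  ultimately show ?thesis using eq[OF g(1)] eq[of 1] by simp
qed

lemma intform_hecke_form: "intform m (12 * int k) hecke_form"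
  unfolding hecke_form_def
proof (rule intform_hecke_fps[OF intform_eta_form _ _ m(1) coprime_m_level])
  show "12 * int k > 0" using k_pos by simp
  show "m \<ge> 1" using m by simp
  show "sgn4i (int m) = 1 \<or> sgn4i (int m) = -1" by (simp add: sgn4i_def)
qed (rule eta_form_nebentypus)

text \<open>
  Every exponent of \<open>G\<close> is at least \<open>ms + t\<close>, so \<open>T\<^sub>m\<close> leaves exponents of at least \<open>s\<close>, the order of the denominator.
\<close>

lemma hecke_form_low: "n < s \<Longrightarrow> hecke_form $ n = 0"
proof -
  assume n: "n < s"
  have low: "eta_form $ i = 0" if "i < m * s + t" for i
    using that unfolding eta_form_def eta_prod_fps_def mult.assoc by (simp add: fps_X_power_mult_nth)
  have "m * n < m * s + t" using n m by (simp add: trans_less_add1)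
  moreover have "n div m < m * s + t"
  proof -
    have "n div m \<le> n" by simp
    also have "n < s" by (rule n)
    also have "s \<le> m * s + t" using m by (simp add: trans_le_add1)
    finally show ?thesis .
  qed
  ultimately show ?thesis by (simp add: hecke_form_def hecke_fps_nth low)
qed

lemma stretch_euler_unit: "l > 0 \<Longrightarrow> stretch l euler_fps * stretch l euler_inv = 1"
  by (metis stretch_mult stretch_1 euler_inv_mult mult.commute)

lemma den_quot: "eta_den * quot_form = hecke_form"
proof -
  have sh: "fps_X ^ s * fps_shift s hecke_form = hecke_form"
    using hecke_form_low by (auto simp: fps_eq_iff fps_X_power_mult_nth)
  have "eta_den * quot_form = (fps_X ^ s * fps_shift s hecke_form) *
      (stretch (12 * k) euler_fps * stretch (12 * k) euler_inv) *
      (stretch (12 * k * k) euler_fps * stretch (12 * k * k) euler_inv)"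
    unfolding eta_den_def eta_prod_fps_def quot_form_def power_one_right by (simp only: mult_ac)
  then show ?thesis using k_pos by (simp add: sh stretch_euler_unit)
qed

lemma conv1_quot_form: "conv1 quot_form"
  unfolding quot_form_def using intform_hecke_form k_pos
  by (intro conv1_mult conv1_shift conv1_stretch conv1_euler_inv) (auto simp: intform_def)

lemma ev_quot_form:
  assumes z: "Im z > 0"
  shows "ev quot_form (ee (z / of_int (12 * int k))) =
    ev hecke_form (ee (z / of_int (12 * int k))) / eta_prod k 1 1 z"
proof -
  have x: "norm (ee (z / of_int (12 * int k))) < 1" by (rule norm_ee_div[OF z]) (use k_pos in simp)
  have "conv1 eta_den" unfolding eta_den_def by (rule conv1_eta_prod_fps[OF k_pos])
  from ev_mult[OF this conv1_quot_form x]
  have "ev hecke_form (ee (z / of_int (12 * int k))) =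
      ev eta_den (ee (z / of_int (12 * int k))) * ev quot_form (ee (z / of_int (12 * int k)))"
    unfolding den_quot .
  moreover have "ev eta_den (ee (z / of_int (12 * int k))) = eta_prod k 1 1 z"
    unfolding eta_den_def by (rule ev_eta_prod_fps[OF k_pos exponent_den z])
  ultimately show ?thesis using eta_prod_nonzero[OF k_pos z, of 1 1] by (simp add: field_simps)
qed

text \<open>
  Every term of the Hecke operator is an eta product at the cusp \<open>\<gamma>\<close> evaluated at \<open>(Az + B)/D\<close>
  with \<open>AD = m\<close>, so it decays at least as fast as in the worst case \<open>A/D = 1/m\<close>.
\<close>

lemma hecke_form_decay:
  assumes g: "mdet \<gamma> = 1"
  shows "\<exists>C. \<forall>z. Im z \<ge> 1 \<longrightarrow> norm (slash m (\<lambda>z. ev hecke_form (ee (z / of_int (12 * int k)))) \<gamma> z) \<le>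
    C * exp (- (pi/12) * ((real (m - 1) + real (m + 1) * cusp_ratio k \<gamma>) / real m) * Im z)"
proof -
  define f where "f z = ev eta_form (ee (z / of_int (12 * int k)))" for z
  define E where "E z = exp (- (pi/12) * ((real (m - 1) + real (m + 1) * cusp_ratio k \<gamma>) / real m) * Im z)" for z
  define \<kappa> :: complex where "\<kappa> = of_int (sgn4i (int m))"
  have m0: "m > 0" using m by simp
  have \<rho>0: "cusp_ratio k \<delta> \<ge> 0" for \<delta> by (simp add: cusp_ratio_def)
  have f_eq: "slash m f \<delta> = slash m (eta_prod k (m - 1) (m + 1)) \<delta>" if "mdet \<delta> = 1" for \<delta>
    using that act_uhp[of \<delta>] ev_eta_prod_fps[OF k_pos exponent_form]
    by (auto simp: slash_def eta_form_def f_def fun_eq_iff)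
  have term_bound: "\<exists>C. \<forall>z. Im z \<ge> 1 \<longrightarrow> norm (slash m f (hecke_rep m (12 * int k) j * \<gamma>) z) \<le> C * E z" for j
  proof -
    have "mdet (hecke_rep m (12 * int k) j * \<gamma>) > 0" using g m0 by simp
    then obtain \<delta> A B D where d: "mdet \<delta> = 1" "hecke_rep m (12 * int k) j * \<gamma> = \<delta> * M2 A B 0 D" "A > 0" "D > 0"
      by (rule hermite_decomposition)
    obtain a b c e where abcd: "\<gamma> = M2 a b c e" by (cases \<gamma>)
    obtain a' b' c' e' where \<delta>: "\<delta> = M2 a' b' c' e'" by (cases \<delta>)
    have AD: "A * D = int m"
    proof -
      have "mdet (hecke_rep m (12 * int k) j * \<gamma>) = A * D" unfolding d(2) mdet_mult using d(1) by simp
      then show ?thesis using g by simp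
    qed
    have pk: "prime (int k)" using prime_k by simp
    have km: "\<not> int k dvd int m" using m prime_k by (metis int_dvd_int_iff primes_dvd_imp_eq)
    have kA: "\<not> int k dvd A" using km AD by (metis dvd_mult2)
    have "c' * A = int m * c \<or> c' * A = c"
      using d(2) by (cases "j < m") (simp_all add: hecke_rep_def abcd \<delta>)
    then have "int k dvd c' \<longleftrightarrow> int k dvd c"
      using kA km prime_dvd_mult_iff[OF pk] by metis
    then have ratio: "cusp_ratio k \<delta> = cusp_ratio k \<gamma>" by (simp add: cusp_ratio_def \<delta> abcd)
    define U where "U = M2 A B 0 D"
    have U: "mdet U > 0" "\<And>z. aut U z = of_int D" using d by (simp_all add: U_def)
    have Dm: "real_of_int D \<le> real m" "real_of_int D \<ge> 1" "real_of_int A \<ge> 1"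
    proof -
      have "1 * D \<le> A * D" using d by (intro mult_right_mono) auto
      then have "D \<le> int m" using AD by simp
      then have "real_of_int D \<le> real_of_int (int m)" by (simp only: of_int_le_iff)
      then show "real_of_int D \<le> real m" by simp
      show "real_of_int D \<ge> 1" "real_of_int A \<ge> 1" using d by simp_all
    qed
    have AD1: "1 / real m \<le> real_of_int A / real_of_int D"
      using Dm m0 by (intro frac_le) auto
    have ImU: "Im (act U z) = (real_of_int A / real_of_int D) * Im z" for z
      using d by (simp add: U_def Im_divide power2_eq_square field_simps)
    have ij: "m - 1 + (m + 1) = 2 * m" using m0 by simp
    have c0: "1 / real m > 0" using m0 by simp
    obtain C2 where C: "C2 > 0" "\<And>z. Im z \<ge> 1 / real m \<Longrightarrow> norm (slash m (eta_prod k (m - 1) (m + 1)) \<delta> z) \<le>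
        C2 * exp (- (pi/12) * (real (m - 1) + real (m + 1) * cusp_ratio k \<delta>) * Im z)"
      by (rule eta_prod_growth[OF prime_k d(1) ij c0]) (rule that)
    have "norm (slash m f (hecke_rep m (12 * int k) j * \<gamma>) z) \<le> C2 * E z" if z: "Im z \<ge> 1" for z
    proof -
      define q where "q = real (m - 1) + real (m + 1) * cusp_ratio k \<gamma>"
      have q0: "q \<ge> 0" using \<rho>0 by (simp add: q_def)
      have y: "Im (act U z) \<ge> 1 / real m * Im z" unfolding ImU using AD1 z by (intro mult_right_mono) auto
      have "1 / real m * 1 \<le> 1 / real m * Im z" using z by (intro mult_left_mono) auto
      then have y1: "Im (act U z) \<ge> 1 / real m" using y by linarith
      have "slash m f (hecke_rep m (12 * int k) j * \<gamma>) z = slash m (slash m f \<delta>) U z"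
        unfolding d(2) U_def[symmetric] using slash_mult[of \<delta> U m f] d(1) U(1) by simp
      also have "\<dots> = slash m f \<delta> (act U z) / of_int D ^ m" using z U by (simp add: slash_def[of m "slash m f \<delta>"])
      finally have "norm (slash m f (hecke_rep m (12 * int k) j * \<gamma>) z) =
          norm (slash m f \<delta> (act U z)) / real_of_int D ^ m"
        using d by (simp add: norm_divide norm_power)
      also have "\<dots> \<le> norm (slash m f \<delta> (act U z)) / 1"
        using Dm by (intro divide_left_mono) (auto intro: one_le_power)
      also have "\<dots> \<le> C2 * exp (- (pi/12) * q * Im (act U z))"
        using C(2)[OF y1] by (simp add: f_eq[OF d(1)] ratio q_def)
      also have "exp (- (pi/12) * q * Im (act U z)) \<le> exp (- (pi/12) * q * (1 / real m * Im z))"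
        using mult_left_mono[OF y, of "pi/12 * q"] q0 by simp
      also have "exp (- (pi/12) * q * (1 / real m * Im z)) = E z" by (simp add: E_def q_def)
      finally show ?thesis using C(1) by simp
    qed
    then show ?thesis by blast
  qed
  then obtain C where C: "\<And>j z. Im z \<ge> 1 \<Longrightarrow> norm (slash m f (hecke_rep m (12 * int k) j * \<gamma>) z) \<le> C j * E z"
    by metis
  define W where "W = (\<Sum>j\<le>m. norm (if j < m then 1 else \<kappa>) * C j)"
  have "norm (slash m (\<lambda>z. ev hecke_form (ee (z / of_int (12 * int k)))) \<gamma> z) \<le> (real m ^ (m - 1) * W) * E z"
    if z: "Im z \<ge> 1" for z
  proof -
    have z0: "Im z > 0" using z by simp
    have "ev hecke_form (ee (y / of_int (12 * int k))) = of_nat m ^ (m - 1) * hecke_sum m (12 * int k) \<kappa> m f y"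
      if "Im y > 0" for y
      using ev_hecke_fps[of eta_form "12 * int k" m m y "sgn4i (int m)"] intform_eta_form k_pos m0 that
      by (simp add: hecke_form_def f_def[abs_def] \<kappa>_def intform_def)
    then have "slash m (\<lambda>z. ev hecke_form (ee (z / of_int (12 * int k)))) \<gamma> z =
        of_nat m ^ (m - 1) * slash m (hecke_sum m (12 * int k) \<kappa> m f) \<gamma> z"
      using z0 act_uhp[of \<gamma> z] g by (simp add: slash_def)
    also have "slash m (hecke_sum m (12 * int k) \<kappa> m f) \<gamma> z =
        (\<Sum>j\<le>m. (if j < m then 1 else \<kappa>) * slash m f (hecke_rep m (12 * int k) j * \<gamma>) z)"
      by (rule slash_hecke_sum[OF m0 g])
    finally have "norm (slash m (\<lambda>z. ev hecke_form (ee (z / of_int (12 * int k)))) \<gamma> z) =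
        real m ^ (m - 1) * norm (\<Sum>j\<le>m. (if j < m then 1 else \<kappa>) * slash m f (hecke_rep m (12 * int k) j * \<gamma>) z)"
      by (simp add: norm_mult norm_power)
    also have "norm (\<Sum>j\<le>m. (if j < m then 1 else \<kappa>) * slash m f (hecke_rep m (12 * int k) j * \<gamma>) z) \<le>
        (\<Sum>j\<le>m. norm (if j < m then 1 else \<kappa>) * (C j * E z))"
      by (intro order.trans[OF norm_sum] sum_mono, unfold norm_mult, intro mult_left_mono C[OF z]) simp
    also have "\<dots> = W * E z" by (simp add: W_def sum_distrib_right mult.assoc)
    finally show ?thesis by (simp add: mult.assoc mult_left_mono)
  qed
  then show ?thesis unfolding E_def by blast
qed

text \<open>
  The division by \<open>\<eta>(z)\<eta>(kz)\<close> costs exactly the order of this product at each cusp. At the cusps where \<open>k\<close> does not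
  divide \<open>c\<close> the decay above falls short by \<open>(k - 1)/(24 k m)\<close>, which the integrality of exponents makes up for.
\<close>

lemma modform_quot_form:
  "modform (m - 1) (12 * int k) (\<lambda>z. ev quot_form (ee (z / of_int (12 * int k))))"
proof (rule modformI)
  let ?N = "12 * int k"
  define h where "h z = ev hecke_form (ee (z / of_int ?N))" for z
  define f where "f z = ev quot_form (ee (z / of_int ?N))" for z
  have N0: "?N > 0" using k_pos by simp
  have hform: "modform m ?N h" using intform_hecke_form by (simp add: intform_def h_def[abs_def])
  have f: "f z = h z / eta_prod k 1 1 z" if "Im z > 0" for z
    using ev_quot_form[OF that] by (simp add: f_def h_def)
  have "(\<lambda>z. h z / eta_prod k 1 1 z) holomorphic_on uhp"
    using hform eta_prod_nonzero[OF k_pos]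
    by (intro holomorphic_intros eta_prod_holomorphic k_pos) (auto simp: modform_def)
  then show "(\<lambda>z. ev quot_form (ee (z / of_int ?N))) holomorphic_on uhp"
    by (rule holomorphic_transform) (use f in \<open>auto simp: f_def\<close>)
  have slash_f: "slash (m - 1) f \<gamma> z = slash m h \<gamma> z / slash 1 (eta_prod k 1 1) \<gamma> z"
    if g: "mdet \<gamma> = 1" and z: "Im z > 0" for \<gamma> z
  proof -
    have nz: "aut \<gamma> z \<noteq> 0" using aut_nonzero[of \<gamma> z] g z by simp
    have "aut \<gamma> z ^ m = aut \<gamma> z ^ (m - 1) * aut \<gamma> z"
      using m by (metis Suc_diff_1 power_Suc2 prime_gt_0_nat)
    then show ?thesis using z nz f[OF act_uhp[of \<gamma> z]] g by (simp add: slash_def)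
  qed
  have inv: "slash (m - 1) f \<delta> = slash (m - 1) f 1" if G: "Gamma_N ?N \<delta>" for \<delta>
  proof
    fix z
    have d: "mdet \<delta> = 1" using G by (rule Gamma_N_det)
    obtain a b c d where \<delta>: "\<delta> = M2 a b c d" by (cases \<delta>)
    show "slash (m - 1) f \<delta> z = slash (m - 1) f 1 z"
    proof (cases "Im z > 0")
      case z: True
      have nz: "aut \<delta> z \<noteq> 0" using aut_nonzero[of \<delta> z] d z by simp
      have "eta_prod k 1 1 (act \<delta> z) = aut \<delta> z * eta_prod k 1 1 z"
        using eta_eta_scaled_principal[OF k, of a b c d z] G z unfolding \<delta> by (simp add: eta_prod_def)
      then have "slash 1 (eta_prod k 1 1) \<delta> z = slash 1 (eta_prod k 1 1) 1 z"
        using z nz by (simp add: slash_def)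
      moreover have "slash m h \<delta> z = slash m h 1 z" using hform G by (simp add: modform_def)
      ultimately show ?thesis using slash_f[OF d z] slash_f[of 1 z] z by simp
    qed (simp add: slash_def)
  qed
  then show "slash (m - 1) (\<lambda>z. ev quot_form (ee (z / of_int ?N))) \<delta> =
      slash (m - 1) (\<lambda>z. ev quot_form (ee (z / of_int ?N))) 1" if "Gamma_N ?N \<delta>" for \<delta>
    using that by (simp add: f_def[abs_def])
  show "?N > 0" by (rule N0)
  fix \<gamma> assume g: "mdet \<gamma> = 1"
  define \<rho> where "\<rho> = cusp_ratio k \<gamma>"
  obtain n :: nat where n: "real n = real k * (1 + \<rho>) / 2"
  proof (cases "int k dvd lowleft \<gamma>")
    case True
    have "real (2 * s) = real k * (real k + 1)" unfolding s by (simp add: algebra_simps)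
    then have "real s = real k * (1 + \<rho>) / 2" using True by (simp add: \<rho>_def cusp_ratio_def add.commute)
    then show ?thesis by (rule that)
  next
    case False
    then show ?thesis using that[of "(k + 1) div 2"] k by (auto simp: \<rho>_def cusp_ratio_def)
  qed
  define \<beta> where "\<beta> = real k * (real (m - 1) + real (m + 1) * \<rho>) / (2 * real m)"
  have \<beta>: "\<beta> > real n - 1"
  proof -
    have m1: "real (m - 1) = real m - 1" using m by (simp add: of_nat_diff)
    have "\<rho> = real k \<or> \<rho> = 1 / real k" by (simp add: \<rho>_def cusp_ratio_def)
    then have "real k * (1 - \<rho>) \<le> real k - 1" using k by auto
    also have "real k - 1 < 2 * real m" using k m by auto
    finally have "real k * (1 - \<rho>) / (2 * real m) < 1" using m by simp
    moreover have "\<beta> = real n - real k * (1 - \<rho>) / (2 * real m)"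
      unfolding n \<beta>_def m1 using m by (simp add: field_simps)
    ultimately show ?thesis by simp
  qed
  obtain C where C: "\<And>z. Im z \<ge> 1 \<Longrightarrow> norm (slash m h \<gamma> z) \<le>
      C * exp (- (pi/12) * ((real (m - 1) + real (m + 1) * \<rho>) / real m) * Im z)"
    using hecke_form_decay[OF g] by (auto simp: h_def[abs_def] \<rho>_def)
  have "\<exists>C. \<forall>z. Im z \<ge> 1 \<longrightarrow> norm (slash m h \<gamma> z) \<le> C * exp (- 2 * pi * real n * Im z / of_int ?N)"
  proof (rule periodic_integral_exponent[OF _ _ N0 _ \<beta>])
    show "slash m h \<gamma> holomorphic_on uhp"
      by (rule slash_holomorphic) (use hform g in \<open>auto simp: modform_def\<close>)
    show "slash m h \<gamma> (z + of_int ?N) = slash m h \<gamma> z" if "Im z > 0" for z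
      by (rule slash_Gamma_N_shift[OF _ g that]) (use hform in \<open>auto simp: modform_def\<close>)
    show "norm (slash m h \<gamma> z) \<le> C * exp (- 2 * pi * \<beta> * Im z / of_int ?N)" if "Im z \<ge> 1" for z
    proof -
      have "- 2 * pi * \<beta> * Im z / of_int ?N = - (pi/12) * ((real (m - 1) + real (m + 1) * \<rho>) / real m) * Im z"
        using k_pos m by (simp add: \<beta>_def field_simps)
      then show ?thesis using C[OF that] by simp
    qed
  qed
  then obtain C' where C': "\<And>z. Im z \<ge> 1 \<Longrightarrow> norm (slash m h \<gamma> z) \<le> C' * exp (- 2 * pi * real n * Im z / of_int ?N)"
    by blast
  obtain C1 C2 where P: "C1 > 0" "\<And>z. Im z \<ge> 1 \<Longrightarrow>
      C1 * exp (- (pi/12) * (real 1 + real 1 * cusp_ratio k \<gamma>) * Im z) \<le> norm (slash 1 (eta_prod k 1 1) \<gamma> z)"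
    using eta_prod_growth[OF prime_k g, of 1 1 1 1] by (metis mult_2 nat_mult_1_right zero_less_one one_add_one)
  have "norm (slash (m - 1) f \<gamma> z) \<le> C' / C1" if z: "Im z \<ge> 1" for z
  proof -
    define e where "e = exp (- 2 * pi * real n * Im z / of_int ?N)"
    have z0: "Im z > 0" using z by simp
    have e: "exp (- (pi/12) * (real 1 + real 1 * cusp_ratio k \<gamma>) * Im z) = e"
    proof -
      have "- 2 * pi * real n * Im z / of_int ?N = - (pi/12) * (real 1 + real 1 * cusp_ratio k \<gamma>) * Im z"
        unfolding n using k_pos by (simp add: \<rho>_def field_simps)
      then show ?thesis by (simp add: e_def)
    qed
    have e0: "e > 0" by (simp add: e_def)
    have up: "norm (slash m h \<gamma> z) \<le> C' * e" using C'[OF z] by (simp add: e_def)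
    have lo: "C1 * e \<le> norm (slash 1 (eta_prod k 1 1) \<gamma> z)" using P(2)[OF z] unfolding e .
    have "norm (slash (m - 1) f \<gamma> z) = norm (slash m h \<gamma> z) / norm (slash 1 (eta_prod k 1 1) \<gamma> z)"
      unfolding slash_f[OF g z0] by (simp add: norm_divide)
    also have "\<dots> \<le> (C' * e) / (C1 * e)"
      using up lo P(1) e0 by (intro frac_le) (auto intro: order.trans[OF norm_ge_zero])
    finally show ?thesis using e0 by simp
  qed
  then show "\<exists>C. \<forall>z. Im z \<ge> 1 \<longrightarrow> norm (slash (m - 1) (\<lambda>z. ev quot_form (ee (z / of_int ?N))) \<gamma> z) \<le> C"
    by (auto simp: f_def[abs_def])
qed

lemma intform_quot_form: "intform (m - 1) (12 * int k) quot_form"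
  using modform_quot_form conv1_quot_form by (simp add: intform_def)

lemma stretch_X_power: "l > 0 \<Longrightarrow> stretch l (fps_X ^ e) = fps_X ^ (l * e)"
  by (auto simp: fps_eq_iff stretch_nth elim!: dvdE)

text \<open>
  \<open>G\<close> is \<open>\<eta>(kz)/\<eta>(z)\<close> times the \<open>m\<close>-th power of \<open>\<eta>(z)\<eta>(kz)\<close>, to which the Frobenius congruence applies.
\<close>

lemma eta_form_fcong: "fcong m eta_form (regular_form k t * stretch m eta_den)"
proof -
  define E Ek where "E = stretch (12 * k) euler_fps" and "Ek = stretch (12 * k * k) euler_fps"
  have N0: "12 * k > 0" "12 * k * k > 0" "m > 0" using k_pos m by auto
  have reg: "stretch (12 * k) (regular_fps k) * E = Ek"
    unfolding E_def Ek_def stretch_mult[OF N0(1), symmetric] regular_fps_euler[OF k_pos]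
    by (rule stretch_stretch[OF N0(1) k_pos])
  have frob: "fcong m (stretch l euler_fps ^ m) (stretch m (stretch l euler_fps))" if l: "l > 0" for l
  proof -
    have "fcong m (stretch l (euler_fps ^ m)) (stretch l (stretch m euler_fps))"
      by (rule fcong_stretch[OF l euler_fps_power_fcong[OF m(1) m_odd]])
    then show ?thesis using l N0 by (simp add: stretch_power stretch_stretch mult.commute)
  qed
  have "eta_form = fps_X ^ (m * s + t) * E ^ (m - 1) * (Ek * Ek ^ m)"
    by (simp add: eta_form_def eta_prod_fps_def E_def Ek_def)
  also have "\<dots> = fps_X ^ (m * s + t) * stretch (12 * k) (regular_fps k) * (E * E ^ (m - 1)) * Ek ^ m"
    unfolding reg[symmetric] by (simp only: mult_ac)
  also have "E * E ^ (m - 1) = E ^ m" using N0 by (simp flip: power_Suc)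
  finally have 1: "eta_form = regular_form k t * (fps_X ^ (m * s) * E ^ m * Ek ^ m)"
    by (simp add: regular_form_def power_add mult_ac)
  have 2: "regular_form k t * stretch m eta_den = regular_form k t * (fps_X ^ (m * s) * stretch m E * stretch m Ek)"
    unfolding eta_den_def eta_prod_fps_def
    by (simp add: stretch_mult[OF N0(3)] stretch_X_power[OF N0(3)] E_def Ek_def)
  show ?thesis unfolding 1 2
    by (intro fcong_mult fcong_refl) (use frob N0 in \<open>simp_all add: E_def Ek_def\<close>)
qed

definition section_fps :: "int fps \<Rightarrow> int fps" where "section_fps A = Abs_fps (\<lambda>n. A $ (m * n))"

lemma section_mult_stretch: "section_fps (A * stretch m B) = section_fps A * B"
proof (rule fps_ext)
  fix n
  have m0: "m > 0" using m by simp
  have "(stretch m B * A) $ (m * n) = (\<Sum>i=0..m * n. stretch m B $ i * A $ (m * n - i))"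
    by (simp add: fps_mult_nth)
  also have "\<dots> = (\<Sum>i\<in>(\<lambda>i. m * i) ` {0..n}. stretch m B $ i * A $ (m * n - i))"
    by (rule sum.mono_neutral_right) (use m0 in \<open>auto simp: stretch_nth image_iff elim!: dvdE\<close>)
  also have "\<dots> = (\<Sum>i=0..n. stretch m B $ (m * i) * A $ (m * n - m * i))"
    by (subst sum.reindex) (use m0 in \<open>auto simp: inj_on_def\<close>)
  also have "\<dots> = (\<Sum>i=0..n. B $ i * A $ (m * (n - i)))"
    using m0 by (simp add: stretch_nth diff_mult_distrib2)
  also have "\<dots> = (B * section_fps A) $ n" by (simp add: fps_mult_nth section_fps_def)
  finally show "section_fps (A * stretch m B) $ n = (section_fps A * B) $ n"
    by (simp add: section_fps_def mult.commute)
qed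

lemma quot_form_cong: "int m dvd regular_form k t $ (m * n) - quot_form $ n"
proof -
  have m0: "m > 0" using m by simp
  have k0: "12 * k > 0" "12 * k * k > 0" using k_pos by auto
  have 1: "fcong m hecke_form (section_fps eta_form)"
    unfolding fcong_def
  proof
    fix n
    have "int m dvd int m ^ (m - 1)" using m by (intro dvd_power) auto
    then show "int m dvd hecke_form $ n - section_fps eta_form $ n"
      by (auto simp: hecke_form_def hecke_fps_nth section_fps_def)
  qed
  have 2: "fcong m (section_fps eta_form) (section_fps (regular_form k t * stretch m eta_den))"
    using eta_form_fcong by (simp add: fcong_def section_fps_def)
  have "fcong m (eta_den * quot_form) (section_fps (regular_form k t) * eta_den)"
    unfolding den_quot using fcong_trans[OF 1 2] by (simp add: section_mult_stretch)
  then have "fcong m (eta_den * quot_form * (stretch (12 * k) euler_inv * stretch (12 * k * k) euler_inv))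
      (section_fps (regular_form k t) * eta_den * (stretch (12 * k) euler_inv * stretch (12 * k * k) euler_inv))"
    by (rule fcong_mult) simp
  moreover
  have den: "eta_den * (stretch (12 * k) euler_inv * stretch (12 * k * k) euler_inv) = fps_X ^ s"
  proof -
    have "eta_den * (stretch (12 * k) euler_inv * stretch (12 * k * k) euler_inv) = fps_X ^ s *
      (stretch (12 * k) euler_fps * stretch (12 * k) euler_inv) *
      (stretch (12 * k * k) euler_fps * stretch (12 * k * k) euler_inv)"
      unfolding eta_den_def eta_prod_fps_def power_one_right by (simp only: mult_ac)
    then show ?thesis using k0 by (simp only: stretch_euler_unit mult_1_right)
  qed
  have "eta_den * quot_form * (I * J) = (eta_den * (I * J)) * quot_form"
    "section_fps (regular_form k t) * eta_den * (I * J) = (eta_den * (I * J)) * section_fps (regular_form k t)" for I J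
    by (simp_all only: mult_ac)
  ultimately have "fcong m (fps_X ^ s * quot_form) (fps_X ^ s * section_fps (regular_form k t))"
    by (simp only: den)
  then have "int m dvd (fps_X ^ s * quot_form) $ (n + s) - (fps_X ^ s * section_fps (regular_form k t)) $ (n + s)"
    unfolding fcong_def by blast
  then show ?thesis by (simp add: fps_X_power_mult_nth section_fps_def dvd_diff_commute)
qed

end

section \<open>Congruences for regular partitions\<close>

lemma regular_5_mod_5: "fcong 5 (regular_fps 5) (euler_fps ^ 4)"
proof -
  have "fcong 5 (euler_fps ^ 5) (stretch 5 euler_fps)"
    by (rule euler_fps_power_fcong) simp_all
  then have "fcong 5 (stretch 5 euler_fps * euler_inv) (euler_fps ^ 5 * euler_inv)"
    by (rule fcong_mult[OF fcong_sym fcong_refl])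
  moreover have "stretch 5 euler_fps * euler_inv = regular_fps 5"
    unfolding regular_fps_euler[of 5, simplified, symmetric] mult.assoc
    by (simp add: mult.commute[of euler_fps] euler_inv_mult)
  moreover have "euler_fps ^ 5 * euler_inv = euler_fps ^ 4 * (euler_inv * euler_fps)"
    by (simp add: power_Suc2[symmetric] eval_nat_numeral mult_ac)
  ultimately show ?thesis by (simp add: euler_inv_mult)
qed

text \<open>
  If \<open>m \<noteq> k\<close> the form is \<open>T\<^sub>m G / P\<close> and \<open>c = m\<close>. In the remaining case \<open>m = k = 5\<close> the Frobenius congruence turns \<open>\<eta>(5z)/\<eta>(z)\<close> into \<open>\<eta>(z)\<^sup>4\<close>,
  and \<open>c = 1\<close>.
\<close>

lemma congruent_integral_form:
  fixes k m t :: nat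
  assumes k: "k = 3 \<or> k = 5" and m: "prime m" "m \<ge> 5" and t: "2 * t = k * (k - 1)"
  shows "\<exists>c w H. w \<ge> 1 \<and> c \<ge> 1 \<and> coprime c (12 * k) \<and> intform w (12 * int k) H \<and>
           (\<forall>n. int m dvd regular_form k t $ (c * n) - H $ n)"
proof (cases "m = k")
  case False
  define s where "s = k * (k + 1) div 2"
  have s: "2 * s = k * (k + 1)" using k by (auto simp: s_def)
  show ?thesis
  proof (intro exI conjI allI)
    show "m - 1 \<ge> 1" "m \<ge> 1" using m by simp_all
    show "coprime m (12 * k)"
      using coprime_m_level[OF k m False s t]
      by (metis coprime_int_iff of_nat_mult of_nat_numeral)
    show "intform (m - 1) (12 * int k) (quot_form k m s t)"
      by (rule intform_quot_form[OF k m False s t])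
    show "int m dvd regular_form k t $ (m * n) - quot_form k m s t $ n" for n
      by (rule quot_form_cong[OF k m False s t])
  qed
next
  case True
  then have k5: "k = 5" "m = 5" using k m by auto
  then have t10: "t = 10" using t by simp
  define H where "H = eta_prod_fps 5 4 0 10"
  have H: "intform 2 (12 * int 5) H"
    unfolding H_def by (rule intform_eta_prod_fps) simp_all
  have "fcong 5 (fps_X ^ 10 * stretch 60 (regular_fps 5)) (fps_X ^ 10 * stretch 60 (euler_fps ^ 4))"
    by (intro fcong_mult fcong_refl fcong_stretch regular_5_mod_5) simp
  then have "fcong 5 (regular_form k t) H"
    by (simp add: H_def eta_prod_fps_def k5 t10 regular_form_def stretch_power)
  then have "\<forall>n. int m dvd regular_form k t $ (1 * n) - H $ n" by (simp add: fcong_def k5)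
  then show ?thesis using H k5 by (intro exI[of _ 1] exI[of _ 2] exI[of _ H]) simp
qed

lemma exists_auxiliary_prime:
  fixes k m :: nat
  assumes "k = 3 \<or> k = 5" "prime m"
  obtains Q :: nat where "prime Q" "Q \<noteq> m" "12 * int k dvd int Q - 1"
proof (cases "m = 181")
  case True
  \<comment> \<open>Both \<open>181\<close> and \<open>541\<close> are \<open>1\<close> modulo \<open>180\<close>, the least common multiple of \<open>36\<close> and \<open>60\<close>.\<close>
  have "prime (541 :: nat)" by simp
  moreover have "12 * int k dvd int 541 - 1" using assms(1) by (elim disjE) simp_all
  ultimately show ?thesis using that[of 541] True by linarith
next
  case False
  have "prime (181 :: nat)" by simp
  moreover have "12 * int k dvd int 181 - 1" using assms(1) by (elim disjE) simp_all
  ultimately show ?thesis using that[of 181] False by metis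
qed

text \<open>
  On the indices \<open>n \<equiv> 1\<close> modulo \<open>Q\<close> that lie in the residue class modulo \<open>12k\<close> on which the series is supported, the
  vanishing coefficients form a full arithmetic progression of values of \<open>b\<^sub>k\<close>.
\<close>

lemma exists_ramanujan_congruence:
  fixes k m :: nat
  assumes k: "k = 3 \<or> k = 5" and m: "prime m" "m \<ge> 5"
  shows "\<exists>A B. ramanujan_congruence k m A B"
proof -
  define t where "t = k * (k - 1) div 2"
  have t: "2 * t = k * (k - 1)" using k by (auto simp: t_def)
  define N where "N = 12 * k"
  have N0: "N > 0" using k by (auto simp: N_def)
  obtain c w H where H: "w \<ge> 1" "c \<ge> 1" "coprime c (12 * k)" "intform w (12 * int k) H"
    "\<And>n. int m dvd regular_form k t $ (c * n) - H $ n"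
    using congruent_integral_form[OF k m t] by blast
  obtain Q where Q: "prime Q" "Q \<noteq> m" "12 * int k dvd int Q - 1"
    using exists_auxiliary_prime[OF k m(1)] by blast
  have "coprime (int Q) (int m)" using Q m primes_coprime[of Q m] by simp
  then obtain i where i: "\<And>n. \<not> Q dvd n \<Longrightarrow> int m dvd H $ (Q ^ i * n)"
    using hecke_annihilation[OF H(4) _ H(1) Q(1,3), of "int m"] N0 m prime_gt_0_nat
    by (auto simp: N_def)
  have Q1: "Q > 1" using Q prime_gt_1_nat by blast
  have QN: "[Q = 1] (mod N)"
  proof -
    have "[int Q = int 1] (mod int N)" using Q(3) by (simp add: cong_iff_dvd_diff N_def)
    then show ?thesis by (simp only: cong_int_iff)
  qed
  have copQ: "coprime N Q"
    using QN Q1 by (metis cong_imp_coprime coprime_1_left coprime_commute cong_sym)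
  \<comment> \<open>The series is supported on exponents \<open>\<equiv> t\<close> modulo \<open>N\<close>, and \<open>Q \<equiv> 1\<close>; so \<open>n \<equiv> u\<close> puts \<open>c Q\<^sup>i n\<close> into the support.\<close>
  obtain u where u: "[c * u = t] (mod N)"
  proof -
    obtain v where v: "[c * v = 1] (mod N)" using cong_solve_coprime_nat[of c N] H(3) by (auto simp: N_def)
    have "[c * v * t = 1 * t] (mod N)" by (rule cong_mult[OF v cong_refl])
    then show ?thesis using that[of "v * t"] by (simp add: mult.assoc)
  qed
  obtain x where x: "[x = u] (mod N)" "[x = 1] (mod Q)"
    using binary_chinese_remainder_nat[OF copQ, of u 1] by blast
  \<comment> \<open>The shift makes the index at least \<open>t\<close>, so that it is \<open>t + NB\<close> with a natural number \<open>B\<close>.\<close>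
  define n1 where "n1 = x + N * Q * t"
  have n1: "[n1 = u] (mod N)" "[n1 = 1] (mod Q)" "n1 \<ge> t"
  proof -
    have "n1 = x + (Q * t) * N" by (simp add: n1_def mult.commute)
    then show "[n1 = u] (mod N)" using x(1) by (simp only: cong_def mod_mult_self1)
    have "n1 = x + (N * t) * Q" by (simp add: n1_def mult_ac)
    then show "[n1 = 1] (mod Q)" using x(2) by (simp only: cong_def mod_mult_self1)
    have "t * 1 \<le> t * (N * Q)" using N0 Q1 by (intro mult_left_mono) auto
    moreover have "n1 = x + t * (N * Q)" by (simp add: n1_def mult.commute)
    ultimately show "n1 \<ge> t" by linarith
  qed
  have "[c * Q ^ i * n1 = c * 1 ^ i * u] (mod N)"
    by (intro cong_mult cong_refl cong_pow QN n1(1))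
  then have "[c * Q ^ i * n1 = c * u] (mod N)" by (simp only: power_one mult_1_right)
  then have "[c * Q ^ i * n1 = t] (mod N)" using u by (rule cong_trans)
  moreover have "t \<le> c * Q ^ i * n1"
  proof -
    have "1 \<le> c * Q ^ i" using H(2) Q1 by simp
    then have "1 * n1 \<le> c * Q ^ i * n1" by (rule mult_right_mono) simp
    then show ?thesis using n1(3) unfolding mult_1 by (rule order.trans[rotated])
  qed
  ultimately obtain B where B: "c * Q ^ i * n1 = t + N * B"
    by (metis cong_altdef_nat dvdE le_add_diff_inverse)
  have "ramanujan_congruence k m (c * Q ^ Suc i) B"
    unfolding ramanujan_congruence_def
  proof (intro conjI allI)
    show "c * Q ^ Suc i \<ge> 1" using H(2) Q1 by simp
    fix r
    define n where "n = n1 + N * Q * r"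
    have "n = n1 + (N * r) * Q" by (simp add: n_def mult_ac)
    then have "n mod Q = 1" using n1(2) Q1 by (simp only: cong_def mod_mult_self1 mod_less)
    then have "\<not> Q dvd n" by (simp add: dvd_eq_mod_eq_0)
    then have "int m dvd H $ (Q ^ i * n)" by (rule i)
    moreover have "int m dvd regular_form k t $ (c * (Q ^ i * n)) - H $ (Q ^ i * n)" by (rule H(5))
    ultimately have "int m dvd regular_form k t $ (c * (Q ^ i * n))" by (metis dvd_add diff_add_cancel)
    moreover have "c * (Q ^ i * n) = t + N * (c * Q ^ Suc i * r + B)"
    proof -
      have "c * (Q ^ i * n) = c * Q ^ i * n1 + N * (c * Q ^ Suc i * r)"
        by (simp add: n_def algebra_simps)
      then show ?thesis unfolding B by (simp add: algebra_simps)
    qed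
    moreover have "regular_form k t $ (t + N * j) = int (num_regular_partitions k j)" for j
      using N0 by (simp add: regular_form_def fps_X_power_mult_nth stretch_nth regular_fps_def N_def[symmetric])
    ultimately have "int m dvd int (num_regular_partitions k (c * Q ^ Suc i * r + B))" by metis
    then show "[num_regular_partitions k (c * Q ^ Suc i * r + B) = 0] (mod m)"
      by (simp only: int_dvd_int_iff cong_0_iff)
  qed
  then show ?thesis by blast
qed

lemma ramanujan_congruence_subprogression:
  assumes "ramanujan_congruence k m A B"
  shows "ramanujan_congruence k m (A * Suc j) B"
  using assms unfolding ramanujan_congruence_def
  by (metis mult.assoc One_nat_def Suc_le_eq nat_0_less_mult_iff zero_less_Suc)

lemma infinite_ramanujan_congruences:
  assumes "k = 3 \<or> k = 5" "prime m" "m \<ge> 5"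
  shows "infinite {(A, B). ramanujan_congruence k m A B}"
proof
  assume fin: "finite {(A, B). ramanujan_congruence k m A B}"
  obtain A B where AB: "ramanujan_congruence k m A B"
    using exists_ramanujan_congruence[OF assms] by blast
  have "range (\<lambda>j. (A * Suc j, B)) \<subseteq> {(A, B). ramanujan_congruence k m A B}"
    using ramanujan_congruence_subprogression[OF AB] by auto
  then have "finite (range (\<lambda>j. (A * Suc j, B)))" using fin finite_subset by blast
  moreover have "inj (\<lambda>j. (A * Suc j, B))"
    using AB by (auto simp: inj_def ramanujan_congruence_def)
  ultimately show False using finite_imageD infinite_UNIV_nat by blast
qed

theorem theorem1p1:
  fixes m :: nat
  assumes "prime m" and "m \<ge> 5"
  shows "infinite {(A, B). ramanujan_congruence 3 m A B} \<and>
         infinite {(A, B). ramanujan_congruence 5 m A B}"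
  using infinite_ramanujan_congruences assms by simp

end
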